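(* Let $\Omega\subset\mathbb{R}^d$ ($d=2,3$) be a Lipschitz polygon/polyhedron and let $s\in(1/2,1]$ be such that for every $f\in L^2(\Omega)$ the solution $u\in H^1_0(\Omega)$ of $-\Delta u=f$ belongs to $H^{1+s}(\Omega)$. Let $\Sigma_h\subset\mathbf{H}(\mathrm{div};\Omega)$ and $U_h\subset H^1_0(\Omega)$ be families of finite dimensional (finite element) spaces indexed by $h>0$, and assume that there is a constant $C$ independent of $h$ such that $$\inf_{\boldsymbol{\tau}\in\Sigma_h}\|\boldsymbol{\chi}-\boldsymbol{\tau}\|_{\mathbf{H}(\mathrm{div};\Omega)}\le Ch^s\big(\|\boldsymbol{\chi}\|_{\mathbf{H}^s(\Omega)}+\|\mathrm{div}\,\boldsymbol{\chi}\|_{H^{1+s}(\Omega)}\big),\qquad \inf_{v\in U_h}\|p-v\|_{H^1(\Omega)}\le Ch^s\|p\|_{H^{1+s}(\Omega)}$$ for all $\boldsymbol{\chi}\in\mathbf{H}^s(\Omega)$ with $\mathrm{div}\,\boldsymbol{\chi}\in H^{1+s}(\Omega)$ and all $p\in H^{1+s}(\Omega)\cap H^1_0(\Omega)$. Then there is a function $\rho(h)$, tending to zero as $h\to0$, such that $$\|T_{LL^*}f-T_{LL^*,h}f\|_{L^2(\Omega)}\le\rho(h)\|f\|_{L^2(\Omega)}\qquad\forall f\in L^2(\Omega),$$ where $T_{LL^*}$ and $T_{LL^*,h}$ are the continuous and discrete solution operators defined in the context.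
   Context: $(\cdot,\cdot)$ is the $L^2(\Omega)$ (or $L^2(\Omega)^d$) inner product; $\mathbf{H}(\mathrm{div};\Omega)=\{\boldsymbol{\tau}\in L^2(\Omega)^d:\mathrm{div}\,\boldsymbol{\tau}\in L^2(\Omega)\}$ with the graph norm; $\mathbf{H}^s(\Omega)=H^s(\Omega)^d$. The operator $T_{LL^*}:L^2(\Omega)\to L^2(\Omega)$ maps $f$ to $T_{LL^*}f=p\in H^1_0(\Omega)$, where $(\boldsymbol{\chi},p)\in\mathbf{H}(\mathrm{div};\Omega)\times H^1_0(\Omega)$ is the solution of $$\begin{cases}(\boldsymbol{\chi},\boldsymbol{\xi})+(\mathrm{div}\,\boldsymbol{\chi},\mathrm{div}\,\boldsymbol{\xi})-(\nabla p,\boldsymbol{\xi})=0&\forall\boldsymbol{\xi}\in\mathbf{H}(\mathrm{div};\Omega)\\ -(\boldsymbol{\chi},\nabla q)+(\nabla p,\nabla q)=(f,q)&\forall q\in H^1_0(\Omega).\end{cases}$$ The operator $T_{LL^*,h}:L^2(\Omega)\to L^2(\Omega)$ maps $f$ to $T_{LL^*,h}f=p_h\in U_h$, where $(\boldsymbol{\chi}_h,p_h)\in\Sigma_h\times U_h$ solves the same equations with test functions $\boldsymbol{\xi}\in\Sigma_h$, $q\in U_h$. *)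

theory Defs
  imports "HOL-Analysis.Analysis"
begin

text \<open>
  Functions on a domain \<open>\<Omega>\<close> are total functions of which only the restriction to \<open>\<Omega>\<close> matters.
  Elements of Lebesgue and Sobolev spaces are represented by functions, not by classes modulo
  equality almost everywhere; the Lebesgue and Sobolev spaces, their norms and inner products
  are invariant under changes on null sets.
\<close>

section \<open>Domains\<close>

text \<open>
  Near each boundary point, and in suitable orthogonal coordinates with last axis \<open>e\<close>,
  the set lies on one side of the graph of a Lipschitz function of the remaining coordinates.
\<close>

definition lipschitz_boundary :: "'a::euclidean_space set \<Rightarrow> bool" where
  "lipschitz_boundary \<Omega> \<longleftrightarrow>
     (\<forall>z\<in>frontier \<Omega>. \<exists>W e L \<gamma>. open W \<and> z \<in> W \<and> norm e = 1 \<and>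
        L-lipschitz_on {y. y \<bullet> e = 0} \<gamma> \<and>
        \<Omega> \<inter> W = {x \<in> W. \<gamma> (x - (x \<bullet> e) *\<^sub>R e) < x \<bullet> e})"

definition lipschitz_polytopal_domain :: "'a::euclidean_space set \<Rightarrow> bool" where
  "lipschitz_polytopal_domain \<Omega> \<longleftrightarrow>
     open \<Omega> \<and> connected \<Omega> \<and> \<Omega> \<noteq> {} \<and> bounded \<Omega> \<and> lipschitz_boundary \<Omega> \<and>
     (\<exists>\<P>. finite \<P> \<and> (\<forall>P\<in>\<P>. polytope P) \<and> closure \<Omega> = \<Union>\<P>)"

section \<open>Square integrable functions\<close>

definition L2 :: "'a::euclidean_space set \<Rightarrow> ('a \<Rightarrow> 'b::euclidean_space) set" where
  "L2 \<Omega> = {u \<in> borel_measurable (lebesgue_on \<Omega>).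
             integrable (lebesgue_on \<Omega>) (\<lambda>x. (norm (u x))\<^sup>2)}"

definition L2_inner ::
  "'a::euclidean_space set \<Rightarrow> ('a \<Rightarrow> 'b::euclidean_space) \<Rightarrow> ('a \<Rightarrow> 'b) \<Rightarrow> real" where
  "L2_inner \<Omega> u v = (LINT x|lebesgue_on \<Omega>. u x \<bullet> v x)"

definition L2_norm :: "'a::euclidean_space set \<Rightarrow> ('a \<Rightarrow> 'b::euclidean_space) \<Rightarrow> real" where
  "L2_norm \<Omega> u = sqrt (L2_inner \<Omega> u u)"

section \<open>Test functions\<close>

definition pderiv_at :: "'d::finite \<Rightarrow> (real^'d \<Rightarrow> real) \<Rightarrow> real^'d \<Rightarrow> real" where
  "pderiv_at i \<phi> x = frechet_derivative \<phi> (at x) (axis i 1)"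

definition cgrad :: "(real^'d::finite \<Rightarrow> real) \<Rightarrow> real^'d \<Rightarrow> real^'d" where
  "cgrad \<phi> x = (\<chi> i. pderiv_at i \<phi> x)"

primrec Ck :: "nat \<Rightarrow> (real^'d::finite \<Rightarrow> real) \<Rightarrow> bool" where
  "Ck 0 \<phi> \<longleftrightarrow> continuous_on UNIV \<phi>"
| "Ck (Suc k) \<phi> \<longleftrightarrow> (\<forall>x. \<phi> differentiable (at x)) \<and> (\<forall>i. Ck k (pderiv_at i \<phi>))"

definition test_functions :: "(real^'d::finite) set \<Rightarrow> (real^'d \<Rightarrow> real) set" where
  "test_functions \<Omega> =
     {\<phi>. (\<forall>k. Ck k \<phi>) \<and> compact (closure {x. \<phi> x \<noteq> 0}) \<and> closure {x. \<phi> x \<noteq> 0} \<subseteq> \<Omega>}"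

section \<open>Weak derivatives\<close>

text \<open>
  Weak derivatives are required to be square integrable; nothing weaker is used. They are unique up to
  null sets, so the choice operator below picks a representative.
\<close>

definition has_weak_pderiv ::
  "(real^'d::finite) set \<Rightarrow> 'd \<Rightarrow> (real^'d \<Rightarrow> real) \<Rightarrow> (real^'d \<Rightarrow> real) \<Rightarrow> bool" where
  "has_weak_pderiv \<Omega> i u g \<longleftrightarrow> u \<in> L2 \<Omega> \<and> g \<in> L2 \<Omega> \<and>
     (\<forall>\<phi>\<in>test_functions \<Omega>. L2_inner \<Omega> u (pderiv_at i \<phi>) = - L2_inner \<Omega> g \<phi>)"

definition weak_pderiv ::
  "(real^'d::finite) set \<Rightarrow> 'd \<Rightarrow> (real^'d \<Rightarrow> real) \<Rightarrow> real^'d \<Rightarrow> real" where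
  "weak_pderiv \<Omega> i u = (SOME g. has_weak_pderiv \<Omega> i u g)"

definition grad :: "(real^'d::finite) set \<Rightarrow> (real^'d \<Rightarrow> real) \<Rightarrow> real^'d \<Rightarrow> real^'d" where
  "grad \<Omega> u x = (\<chi> i. weak_pderiv \<Omega> i u x)"

definition has_weak_div ::
  "(real^'d::finite) set \<Rightarrow> (real^'d \<Rightarrow> real^'d) \<Rightarrow> (real^'d \<Rightarrow> real) \<Rightarrow> bool" where
  "has_weak_div \<Omega> \<tau> g \<longleftrightarrow> \<tau> \<in> L2 \<Omega> \<and> g \<in> L2 \<Omega> \<and>
     (\<forall>\<phi>\<in>test_functions \<Omega>. L2_inner \<Omega> \<tau> (cgrad \<phi>) = - L2_inner \<Omega> g \<phi>)"

definition wdiv :: "(real^'d::finite) set \<Rightarrow> (real^'d \<Rightarrow> real^'d) \<Rightarrow> real^'d \<Rightarrow> real" where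
  "wdiv \<Omega> \<tau> = (SOME g. has_weak_div \<Omega> \<tau> g)"

definition Hdiv :: "(real^'d::finite) set \<Rightarrow> (real^'d \<Rightarrow> real^'d) set" where
  "Hdiv \<Omega> = {\<tau>. \<exists>g. has_weak_div \<Omega> \<tau> g}"

definition Hdiv_norm :: "(real^'d::finite) set \<Rightarrow> (real^'d \<Rightarrow> real^'d) \<Rightarrow> real" where
  "Hdiv_norm \<Omega> \<tau> = sqrt ((L2_norm \<Omega> \<tau>)\<^sup>2 + (L2_norm \<Omega> (wdiv \<Omega> \<tau>))\<^sup>2)"

section \<open>Sobolev spaces of real order\<close>

text \<open>
  The square of the Gagliardo--Slobodeckij seminorm of order \<open>\<theta> \<in> (0,1)\<close>. The integrand vanishes
  on the diagonal, since division by zero yields zero.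
\<close>

definition gagliardo :: "real \<Rightarrow> (real^'d::finite) set \<Rightarrow> (real^'d \<Rightarrow> real) \<Rightarrow> ennreal" where
  "gagliardo \<theta> \<Omega> u =
     (\<integral>\<^sup>+x. (\<integral>\<^sup>+y. ennreal ((u x - u y)\<^sup>2 / norm (x - y) powr (real CARD('d) + 2 * \<theta>))
        \<partial>lebesgue_on \<Omega>) \<partial>lebesgue_on \<Omega>)"

text \<open>
  \<open>sobolev m \<theta> \<Omega>\<close> is the space of order \<open>m + \<theta>\<close> with \<open>\<theta> \<in> [0,1)\<close>: all weak derivatives up to
  order \<open>m\<close> are square integrable and, for \<open>\<theta> > 0\<close>, those of order \<open>m\<close> have
  finite Gagliardo seminorm. In the norm, a mixed derivative is counted once for each
  ordering of its indices.
\<close>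

primrec sobolev :: "nat \<Rightarrow> real \<Rightarrow> (real^'d::finite) set \<Rightarrow> (real^'d \<Rightarrow> real) set" where
  "sobolev 0 \<theta> \<Omega> = {u \<in> L2 \<Omega>. \<theta> \<noteq> 0 \<longrightarrow> gagliardo \<theta> \<Omega> u < \<infinity>}"
| "sobolev (Suc m) \<theta> \<Omega> =
     {u \<in> L2 \<Omega>. \<forall>i. (\<exists>g. has_weak_pderiv \<Omega> i u g) \<and> weak_pderiv \<Omega> i u \<in> sobolev m \<theta> \<Omega>}"

primrec sobolev_norm2 :: "nat \<Rightarrow> real \<Rightarrow> (real^'d::finite) set \<Rightarrow> (real^'d \<Rightarrow> real) \<Rightarrow> real" where
  "sobolev_norm2 0 \<theta> \<Omega> u =
     (L2_norm \<Omega> u)\<^sup>2 + (if \<theta> = 0 then 0 else enn2real (gagliardo \<theta> \<Omega> u))"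
| "sobolev_norm2 (Suc m) \<theta> \<Omega> u =
     (L2_norm \<Omega> u)\<^sup>2 + (\<Sum>i\<in>UNIV. sobolev_norm2 m \<theta> \<Omega> (weak_pderiv \<Omega> i u))"

definition Hs :: "real \<Rightarrow> (real^'d::finite) set \<Rightarrow> (real^'d \<Rightarrow> real) set" where
  "Hs r \<Omega> = sobolev (nat \<lfloor>r\<rfloor>) (frac r) \<Omega>"

definition Hs_norm :: "real \<Rightarrow> (real^'d::finite) set \<Rightarrow> (real^'d \<Rightarrow> real) \<Rightarrow> real" where
  "Hs_norm r \<Omega> u = sqrt (sobolev_norm2 (nat \<lfloor>r\<rfloor>) (frac r) \<Omega> u)"

definition Hs_vec :: "real \<Rightarrow> (real^'d::finite) set \<Rightarrow> (real^'d \<Rightarrow> real^'d) set" where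
  "Hs_vec r \<Omega> = {\<tau>. \<forall>i. (\<lambda>x. \<tau> x $ i) \<in> Hs r \<Omega>}"

definition Hs_vec_norm :: "real \<Rightarrow> (real^'d::finite) set \<Rightarrow> (real^'d \<Rightarrow> real^'d) \<Rightarrow> real" where
  "Hs_vec_norm r \<Omega> \<tau> = sqrt (\<Sum>i\<in>UNIV. (Hs_norm r \<Omega> (\<lambda>x. \<tau> x $ i))\<^sup>2)"

text \<open>The closure of the test functions in the first-order Sobolev space.\<close>

definition H10 :: "(real^'d::finite) set \<Rightarrow> (real^'d \<Rightarrow> real) set" where
  "H10 \<Omega> = {u \<in> Hs 1 \<Omega>. \<exists>\<phi>. (\<forall>n. \<phi> n \<in> test_functions \<Omega>) \<and>
              (\<lambda>n. Hs_norm 1 \<Omega> (\<lambda>x. u x - \<phi> n x)) \<longlonglongrightarrow> 0}"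

section \<open>Finite dimensional spaces\<close>

text \<open>Finite dimensionality is understood modulo equality almost everywhere on \<open>\<Omega>\<close>.\<close>

definition finite_dim_space :: "'a::euclidean_space set \<Rightarrow> ('a \<Rightarrow> 'b::euclidean_space) set \<Rightarrow> bool" where
  "finite_dim_space \<Omega> V \<longleftrightarrow>
     (\<lambda>x. 0) \<in> V \<and>
     (\<forall>u\<in>V. \<forall>v\<in>V. (\<lambda>x. u x + v x) \<in> V) \<and>
     (\<forall>c. \<forall>u\<in>V. (\<lambda>x. c *\<^sub>R u x) \<in> V) \<and>
     (\<exists>B. finite B \<and> B \<subseteq> V \<and>
        (\<forall>v\<in>V. \<exists>c. AE x in lebesgue_on \<Omega>. v x = (\<Sum>b\<in>B. c b *\<^sub>R b x)))"

section \<open>Boundary value problems and solution operators\<close>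

definition poisson_solution ::
  "(real^'d::finite) set \<Rightarrow> (real^'d \<Rightarrow> real) \<Rightarrow> (real^'d \<Rightarrow> real) \<Rightarrow> bool" where
  "poisson_solution \<Omega> f u \<longleftrightarrow>
     u \<in> H10 \<Omega> \<and> (\<forall>v\<in>H10 \<Omega>. L2_inner \<Omega> (grad \<Omega> u) (grad \<Omega> v) = L2_inner \<Omega> f v)"

definition LLstar_solution ::
  "(real^'d::finite) set \<Rightarrow> (real^'d \<Rightarrow> real^'d) set \<Rightarrow> (real^'d \<Rightarrow> real) set \<Rightarrow>
   (real^'d \<Rightarrow> real) \<Rightarrow> (real^'d \<Rightarrow> real^'d) \<Rightarrow> (real^'d \<Rightarrow> real) \<Rightarrow> bool" where
  "LLstar_solution \<Omega> S U f \<tau> p \<longleftrightarrow>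
     \<tau> \<in> S \<and> p \<in> U \<and>
     (\<forall>\<xi>\<in>S. L2_inner \<Omega> \<tau> \<xi> + L2_inner \<Omega> (wdiv \<Omega> \<tau>) (wdiv \<Omega> \<xi>)
              - L2_inner \<Omega> (grad \<Omega> p) \<xi> = 0) \<and>
     (\<forall>q\<in>U. - L2_inner \<Omega> \<tau> (grad \<Omega> q) + L2_inner \<Omega> (grad \<Omega> p) (grad \<Omega> q)
              = L2_inner \<Omega> f q)"

text \<open>
  The bilinear form of the system is symmetric and coercive on \<open>Hdiv \<Omega> \<times> H10 \<Omega>\<close>, so the solution exists
  and is unique up to null sets, also on finite dimensional subspaces; the choice operator picks a
  representative of its second component.
\<close>

definition T_LLstar_h ::
  "(real^'d::finite) set \<Rightarrow> (real^'d \<Rightarrow> real^'d) set \<Rightarrow> (real^'d \<Rightarrow> real) set \<Rightarrow>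
   (real^'d \<Rightarrow> real) \<Rightarrow> real^'d \<Rightarrow> real" where
  "T_LLstar_h \<Omega> S U f = (SOME p. \<exists>\<tau>. LLstar_solution \<Omega> S U f \<tau> p)"

definition T_LLstar :: "(real^'d::finite) set \<Rightarrow> (real^'d \<Rightarrow> real) \<Rightarrow> real^'d \<Rightarrow> real" where
  "T_LLstar \<Omega> f = T_LLstar_h \<Omega> (Hdiv \<Omega>) (H10 \<Omega>) f"

end

theory Submission
  imports Defs "HOL-Library.Function_Algebras" "HOL-Computational_Algebra.Polynomial"
begin

text \<open>
  With \<open>w = div \<chi>\<close> the system decouples into \<open>- \<Delta>w = - f\<close> and \<open>- \<Delta>p = f - w\<close> with homogeneous boundary
  values and \<open>\<chi> = \<nabla>(w + p)\<close>. So the regularity of the Poisson problem applies to \<open>p\<close>, \<open>\<chi>\<close> and \<open>div \<chi>\<close>, and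
  Cea's lemma for the coercive form \<open>(\<chi> - \<nabla>p, \<xi> - \<nabla>q) + (div \<chi>, div \<xi>)\<close> bounds the error for each \<open>f\<close>
  by \<open>K f * h powr s\<close>. The regularity assumption comes without a norm bound, so \<open>K f\<close> is not controlled
  directly; the uniform boundedness principle, applied to the error operators divided by
  \<open>h powr s\<close>, replaces it by a multiple of the norm of \<open>f\<close>.
\<close>

section \<open>Spaces with a semi-inner product\<close>

text \<open>Functions stand for themselves rather than for classes, and \<open>grad\<close>,
  \<open>wdiv\<close> and the solution operators rest on choice. None of them is linear on the nose:
  \<open>grad \<Omega> (u + v)\<close> and \<open>grad \<Omega> u + grad \<Omega> v\<close> agree
  only almost everywhere. The abstract theory is therefore carried out for semidefinite forms, and
  linearity is recovered where it counts, inside inner products and norms. The uniform boundedness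
  principle tolerates this, since it asks only for seminorms.

  The principle also suits a purely qualitative regularity assumption. It is applied on L2, so no
  completeness of the higher order Sobolev space enters, as it would in a closed graph argument for
  the Poisson solution map. Each error operator needs some bound of its own, which may blow up as
  \<open>h\<close> tends to 0. It comes from coercivity, and coercivity comes from the Poincare
  inequality together with Green's formula on \<open>H10\<close>.\<close>

instantiation "fun" :: (type, real_vector) real_vector
begin

text \<open>Addition of functions is already pointwise; with this scaling, sets of functions become
  subspaces of a real vector space, which is what the abstract locale speaks about.\<close>

definition "c *\<^sub>R f = (\<lambda>x. c *\<^sub>R f x)"

instance
  by standard (auto simp: scaleR_fun_def fun_eq_iff scaleR_add_right scaleR_add_left)

end

lemma scaleR_fun_apply [simp]: "(c *\<^sub>R f) x = c *\<^sub>R f x"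
  by (simp add: scaleR_fun_def)

text \<open>This is the first variation at a minimum. With \<open>c\<close> positive and above
  \<open>b\<close>, the choice \<open>t = - a / c\<close> makes the linear gain outweigh the
  quadratic term.\<close>

lemma quadratic_nonneg_imp_linear_zero:
  fixes a b :: real
  assumes "\<And>t. 0 \<le> 2 * t * a + t\<^sup>2 * b"
  shows "a = 0"
proof (rule ccontr)
  assume "a \<noteq> 0"
  define c where "c = \<bar>b\<bar> + 1"
  have c: "c > 0" "b < c" by (auto simp: c_def)
  have "0 \<le> 2 * (- a / c) * a + (- a / c)\<^sup>2 * b" by (rule assms)
  also have "\<dots> = (a\<^sup>2 / c) * (b / c - 2)"
    using c by (simp add: field_simps power2_eq_square)
  also have "\<dots> < 0"
    using c \<open>a \<noteq> 0\<close> by (intro mult_pos_neg) (auto simp: field_simps)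
  finally show False by simp
qed

text \<open>Definiteness is absent because functions that vanish almost everywhere have norm zero
  without being zero. The laws are restricted to \<open>V\<close> because the integral of a
  non-integrable function defaults to zero, which destroys additivity outside the space.\<close>

locale semi_inner =
  fixes V :: "'v::real_vector set" and B :: "'v \<Rightarrow> 'v \<Rightarrow> real"
  assumes subspace: "subspace V"
    and B_add: "\<lbrakk>x \<in> V; y \<in> V; z \<in> V\<rbrakk> \<Longrightarrow> B (x + y) z = B x z + B y z"
    and B_scale: "\<lbrakk>x \<in> V; z \<in> V\<rbrakk> \<Longrightarrow> B (c *\<^sub>R x) z = c * B x z"
    and B_sym: "\<lbrakk>x \<in> V; y \<in> V\<rbrakk> \<Longrightarrow> B x y = B y x"
    and B_nonneg: "x \<in> V \<Longrightarrow> 0 \<le> B x x"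
begin

definition N :: "'v \<Rightarrow> real" where "N x = sqrt (B x x)"

definition complete_space :: bool where
  "complete_space \<longleftrightarrow>
     (\<forall>X. range X \<subseteq> V \<and> (\<forall>e>0. \<exists>M. \<forall>m\<ge>M. \<forall>n\<ge>M. N (X m - X n) < e) \<longrightarrow>
        (\<exists>x\<in>V. (\<lambda>n::nat. N (X n - x)) \<longlonglongrightarrow> 0))"

lemma V_0 [simp]: "0 \<in> V" and V_add: "\<lbrakk>x \<in> V; y \<in> V\<rbrakk> \<Longrightarrow> x + y \<in> V"
  and V_scale: "x \<in> V \<Longrightarrow> c *\<^sub>R x \<in> V" and V_diff: "\<lbrakk>x \<in> V; y \<in> V\<rbrakk> \<Longrightarrow> x - y \<in> V"
  using subspace by (auto simp: subspace_0 subspace_add subspace_scale subspace_diff)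

lemmas V_intros = V_0 V_add V_scale V_diff

lemma B_diff: "\<lbrakk>x \<in> V; y \<in> V; z \<in> V\<rbrakk> \<Longrightarrow> B (x - y) z = B x z - B y z"
  using B_add[of x "(-1) *\<^sub>R y" z] B_scale[of y z "-1"] by (simp add: subspace subspace_neg)

lemma B_add2: "\<lbrakk>x \<in> V; y \<in> V; z \<in> V\<rbrakk> \<Longrightarrow> B z (x + y) = B z x + B z y"
  and B_scale2: "\<lbrakk>x \<in> V; z \<in> V\<rbrakk> \<Longrightarrow> B z (c *\<^sub>R x) = c * B z x"
  and B_diff2: "\<lbrakk>x \<in> V; y \<in> V; z \<in> V\<rbrakk> \<Longrightarrow> B z (x - y) = B z x - B z y"
  by (simp_all add: B_sym[of z] V_intros B_add B_scale B_diff)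

lemmas B_expand = B_add B_scale B_diff B_add2 B_scale2 B_diff2

lemma N_nonneg [simp]: "x \<in> V \<Longrightarrow> 0 \<le> N x"
  by (simp add: N_def B_nonneg)

lemma N_power2: "x \<in> V \<Longrightarrow> (N x)\<^sup>2 = B x x"
  by (simp add: N_def B_nonneg)

lemma N_0 [simp]: "N 0 = 0"
  using B_scale[of 0 0 0] by (simp add: N_def)

lemma B_add_scaled:
  assumes "x \<in> V" "y \<in> V"
  shows "B (x + t *\<^sub>R y) (x + t *\<^sub>R y) = B x x + 2 * t * B x y + t\<^sup>2 * B y y"
  using assms by (simp add: B_expand V_intros B_sym[of y x] algebra_simps power2_eq_square)

text \<open>If \<open>B y y = 0\<close> there is no optimal multiple of \<open>y\<close> to
  subtract. Nonnegativity along \<open>x + t *\<^sub>R y\<close> then bounds an affine function of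
  \<open>t\<close> from below, so its slope \<open>2 * B x y\<close> is zero.\<close>

lemma Cauchy_Schwarz:
  assumes "x \<in> V" "y \<in> V"
  shows "\<bar>B x y\<bar> \<le> N x * N y"
proof (cases "B y y = 0")
  case True
  have *: "0 \<le> B x x + 2 * t * B x y" for t
    using B_nonneg[of "x + t *\<^sub>R y"] B_add_scaled[OF assms, of t] True assms by (simp add: V_intros)
  have "B x y = 0"
  proof (rule ccontr)
    assume "B x y \<noteq> 0"
    \<comment> \<open>At this \<open>t\<close> the affine function takes the value - 1.\<close>
    then show False using *[of "- (B x x + 1) / (2 * B x y)"] by (simp add: field_simps)
  qed
  then show ?thesis by (simp add: assms)
next
  case False
  then have pos: "B y y > 0" using B_nonneg[OF assms(2)] by simp
  have "0 \<le> B x x + 2 * (- (B x y / B y y)) * B x y + (- (B x y / B y y))\<^sup>2 * B y y"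
    using B_nonneg[of "x + (- (B x y / B y y)) *\<^sub>R y"] B_add_scaled[OF assms, of "- (B x y / B y y)"] assms
    by (simp add: V_intros)
  also have "\<dots> = B x x - (B x y)\<^sup>2 / B y y"
    using pos by (simp add: field_simps power2_eq_square)
  finally have "(B x y)\<^sup>2 \<le> B x x * B y y" using pos by (simp add: field_simps)
  then have "sqrt ((B x y)\<^sup>2) \<le> sqrt (B x x * B y y)" by (rule real_sqrt_le_mono)
  then show ?thesis by (simp add: N_def real_sqrt_mult)
qed

lemma B_null: "\<lbrakk>x \<in> V; y \<in> V; B x x = 0\<rbrakk> \<Longrightarrow> B y x = 0"
  using Cauchy_Schwarz[of x y] B_sym[of x y] by (auto simp: N_def)

lemma N_scale: "x \<in> V \<Longrightarrow> N (c *\<^sub>R x) = \<bar>c\<bar> * N x"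
  by (simp add: N_def B_expand V_intros real_sqrt_mult flip: mult.assoc)

lemma N_triangle:
  assumes "x \<in> V" "y \<in> V"
  shows "N (x + y) \<le> N x + N y"
proof -
  have "B (x + y) (x + y) \<le> (N x + N y)\<^sup>2"
    using B_add_scaled[OF assms, of 1] Cauchy_Schwarz[OF assms] assms
    by (simp add: power2_sum N_power2)
  then show ?thesis
    unfolding N_def[of "x + y"] using assms by (intro real_le_lsqrt) auto
qed

lemma N_minus_commute: "\<lbrakk>x \<in> V; y \<in> V\<rbrakk> \<Longrightarrow> N (x - y) = N (y - x)"
  using N_scale[of "y - x" "-1"] by (simp add: V_intros)

lemma N_diff_le: "\<lbrakk>x \<in> V; y \<in> V\<rbrakk> \<Longrightarrow> N (x - y) \<le> N x + N y"
  using N_triangle[of x "(-1) *\<^sub>R y"] N_scale[of y "-1"] V_scale[of y "-1"] by simp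

lemma tendsto_B:
  assumes "range X \<subseteq> V" "x \<in> V" "y \<in> V" "(\<lambda>n. N (X n - x)) \<longlonglongrightarrow> 0"
  shows "(\<lambda>n. B (X n) y) \<longlonglongrightarrow> B x y"
proof (rule LIM_zero_cancel)
  have X: "X n \<in> V" for n using assms(1) by auto
  show "(\<lambda>n. B (X n) y - B x y) \<longlonglongrightarrow> 0"
  proof (rule Lim_null_comparison)
    show "\<forall>\<^sub>F n in sequentially. norm (B (X n) y - B x y) \<le> N (X n - x) * N y"
      using Cauchy_Schwarz[OF V_diff[OF X assms(2)] assms(3)] assms X by (simp add: B_expand)
    show "(\<lambda>n. N (X n - x) * N y) \<longlonglongrightarrow> 0"
      using tendsto_mult_left_zero[OF assms(4)] by simp
  qed
qed

text \<open>The representing vector is the limit of a sequence minimizing \<open>B v v - 2 * l v\<close>.\<close>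

lemma Riesz_representation:
  assumes complete: complete_space
    and add: "\<And>x y. \<lbrakk>x \<in> V; y \<in> V\<rbrakk> \<Longrightarrow> l (x + y) = l x + l y"
    and scale: "\<And>x c. x \<in> V \<Longrightarrow> l (c *\<^sub>R x) = c * l x"
    and bound: "\<And>x. x \<in> V \<Longrightarrow> \<bar>l x\<bar> \<le> K * N x"
  shows "\<exists>u\<in>V. \<forall>v\<in>V. B u v = l v"
proof -
  define F where "F v = B v v - 2 * l v" for v
  \<comment> \<open>Completing the square, so that the infimum of \<open>F\<close> is
    finite.\<close>
  have F_lower: "- K\<^sup>2 \<le> F v" if "v \<in> V" for v
  proof -
    have "0 \<le> (N v - K)\<^sup>2" by simp
    then have "- K\<^sup>2 \<le> (N v)\<^sup>2 - 2 * (K * N v)" by (simp add: power2_diff algebra_simps)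
    also have "\<dots> \<le> F v" using bound[OF that] by (simp add: F_def N_power2[OF that])
    finally show ?thesis .
  qed
  define d where "d = Inf (F ` V)"
  have bdd: "bdd_below (F ` V)" using F_lower by (auto intro!: bdd_belowI2)
  have d_le: "d \<le> F v" if "v \<in> V" for v
    unfolding d_def using that bdd by (intro cInf_lower) auto
  have "\<exists>v\<in>V. F v < d + inverse (real (Suc n))" for n
  proof -
    have "F ` V \<noteq> {}" using V_0 by blast
    moreover have "Inf (F ` V) < d + inverse (real (Suc n))" by (simp add: d_def)
    ultimately have "\<exists>x\<in>F ` V. x < d + inverse (real (Suc n))" by (rule cInf_lessD)
    then show ?thesis by blast
  qed
  then obtain X where X: "\<And>n. X n \<in> V" and FX: "\<And>n. F (X n) < d + inverse (real (Suc n))"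
    by metis
  \<comment> \<open>Parallelogram identity: the linear part of \<open>F\<close> cancels, so vectors
    with almost minimal \<open>F\<close> are close to each other.\<close>
  have par: "B (x - y) (x - y) \<le> 2 * (F x - d) + 2 * (F y - d)" if "x \<in> V" "y \<in> V" for x y
  proof -
    have "B (x - y) (x - y) = 2 * F x + 2 * F y - 4 * F ((1/2) *\<^sub>R (x + y))"
      using that by (simp add: F_def B_expand V_intros add scale B_sym[OF that(2,1)] field_simps)
    moreover have "d \<le> F ((1/2) *\<^sub>R (x + y))" using that by (intro d_le V_intros)
    ultimately show ?thesis by simp
  qed
  have "\<exists>M. \<forall>m\<ge>M. \<forall>n\<ge>M. N (X m - X n) < e" if "e > 0" for e
  proof -
    \<comment> \<open>Two terms with factor 2, each factor below \<open>e\<^sup>2 / 4\<close>, add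
      up to less than \<open>e\<^sup>2\<close>.\<close>
    obtain M where M: "inverse (real (Suc M)) < e\<^sup>2 / 4"
      using reals_Archimedean[of "e\<^sup>2 / 4"] \<open>e > 0\<close>
      by (metis divide_pos_pos zero_less_numeral zero_less_power)
    have "N (X m - X n) < e" if "m \<ge> M" "n \<ge> M" for m n
    proof -
      have *: "F (X k) - d < e\<^sup>2 / 4" if "k \<ge> M" for k
      proof -
        have "inverse (real (Suc k)) \<le> inverse (real (Suc M))"
          using that by (intro le_imp_inverse_le) auto
        then show ?thesis using FX[of k] M by linarith
      qed
      have "(N (X m - X n))\<^sup>2 < e\<^sup>2"
        using par[OF X[of m] X[of n]] *[OF \<open>m \<ge> M\<close>] *[OF \<open>n \<ge> M\<close>] by (simp add: N_power2 V_intros X)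
      then show ?thesis by (rule power2_less_imp_less) (use \<open>e > 0\<close> in simp)
    qed
    then show ?thesis by blast
  qed
  moreover have rX: "range X \<subseteq> V" using X by auto
  ultimately obtain u where u: "u \<in> V" and lim: "(\<lambda>n. N (X n - u)) \<longlonglongrightarrow> 0"
    using complete unfolding complete_space_def by metis
  have "B u v = l v" if v: "v \<in> V" for v
  proof -
    have ineq: "0 \<le> 2 * t * (B u v - l v) + t\<^sup>2 * B v v" for t
    proof -
      \<comment> \<open>The members of the sequence are minimizers only up to
        \<open>inverse (real (Suc n))\<close>; this defect disappears in the limit.\<close>
      have 1: "- inverse (real (Suc n)) \<le> 2 * t * (B (X n) v - l v) + t\<^sup>2 * B v v" for n
        using d_le[of "X n + t *\<^sub>R v"] FX[of n] B_add_scaled[OF X v, of n t] v X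
        by (simp add: F_def add scale V_intros algebra_simps)
      have 2: "(\<lambda>n. 2 * t * (B (X n) v - l v) + t\<^sup>2 * B v v)
              \<longlonglongrightarrow> 2 * t * (B u v - l v) + t\<^sup>2 * B v v"
        by (intro tendsto_intros tendsto_B rX u v lim)
      have 3: "(\<lambda>n. - inverse (real (Suc n))) \<longlonglongrightarrow> 0"
        using tendsto_minus[OF LIMSEQ_inverse_real_of_nat] by simp
      show ?thesis by (rule tendsto_le[OF _ 2 3]) (simp_all only: 1 always_eventually trivial_limit_sequentially simp_thms)
    qed
    show ?thesis using quadratic_nonneg_imp_linear_zero[OF ineq] by simp
  qed
  then show ?thesis using u by blast
qed

section \<open>Orthogonal projection onto finite dimensional subspaces\<close>

lemma orthogonal_span:
  assumes "S \<subseteq> V" "w \<in> V" "\<And>b. b \<in> S \<Longrightarrow> B w b = 0" "x \<in> span S"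
  shows "B w x = 0"
proof -
  have "subspace {x \<in> V. B w x = 0}"
    using assms(2) B_scale2[of 0 w 0] by (auto simp: subspace_def V_intros B_expand)
  moreover have "S \<subseteq> {x \<in> V. B w x = 0}" using assms by auto
  ultimately show ?thesis using span_minimal assms(4) by blast
qed

lemma span_subset_V: "S \<subseteq> V \<Longrightarrow> span S \<subseteq> V"
  using span_minimal subspace by blast

text \<open>Gram--Schmidt: the new generator \<open>a\<close> is replaced by \<open>e\<close>, its
  residual against \<open>span S\<close>. The induction hypothesis is used for \<open>a\<close> as
  well as for \<open>v\<close>, hence the generalization over \<open>v\<close>.\<close>

lemma projection_onto_span:
  assumes "finite S" "S \<subseteq> V" "v \<in> V"
  shows "\<exists>u\<in>span S. \<forall>b\<in>S. B (v - u) b = 0"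
  using assms
proof (induction S arbitrary: v rule: finite_induct)
  case empty
  then show ?case by auto
next
  case (insert a S)
  then have SV: "S \<subseteq> V" and a: "a \<in> V" by auto
  obtain a' where a': "a' \<in> span S" "\<forall>b\<in>S. B (a - a') b = 0" using insert.IH[OF SV a] by blast
  obtain u where u: "u \<in> span S" "\<forall>b\<in>S. B (v - u) b = 0" using insert.IH[OF SV insert.prems(2)] by blast
  have V: "a' \<in> V" "u \<in> V" "v \<in> V" using a' u span_subset_V[OF SV] insert.prems by auto
  define e where "e = a - a'"
  have e: "e \<in> V" "e \<in> span (insert a S)"
    using V_diff[OF a V(1)] span_diff[OF span_base[of a "insert a S"] subsetD[OF span_mono[OF subset_insertI] a'(1)]]
    by (simp_all add: e_def)
  have Be: "B e b = 0" if "b \<in> S" for b using a' that by (simp add: e_def)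
  \<comment> \<open>If \<open>e\<close> has norm zero, no coefficient can be computed, but by
    Cauchy--Schwarz the residual is already orthogonal to \<open>e\<close> and 0 will do.\<close>
  define c where "c = (if B e e = 0 then 0 else B (v - u) e / B e e)"
  define w where "w = v - (u + c *\<^sub>R e)"
  have w: "w \<in> V" "w = (v - u) - c *\<^sub>R e" using V e by (auto simp: w_def V_intros)
  have wS: "B w b = 0" if "b \<in> S" for b
  proof -
    have b: "b \<in> V" "B e b = 0" "B (v - u) b = 0" using SV that Be u by auto
    have "B w b = B (v - u) b - c * B e b"
      unfolding w(2) using b(1) V e(1) by (metis B_diff B_scale V_diff V_scale)
    then show ?thesis using b by simp
  qed
  have "B (v - u) e = 0" if "B e e = 0"
    using that B_null[of e "v - u"] e V by (auto simp: V_intros)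
  then have we: "B w e = 0" using w V e by (auto simp: c_def B_diff V_intros B_scale)
  have "B w a' = 0" by (rule orthogonal_span[OF SV w(1) wS a'(1)])
  then have "B w a = 0" using we a V w(1) by (simp add: e_def B_diff2)
  then have "\<forall>b\<in>insert a S. B w b = 0" using wS by auto
  moreover have "u + c *\<^sub>R e \<in> span (insert a S)"
    using u(1) e(2) span_mono[of S "insert a S"] by (auto intro!: span_add span_scale)
  ultimately show ?case unfolding w_def by blast
qed

text \<open>The generators are only required to reach \<open>W\<close> up to vectors of norm zero,
  which matches finite dimensionality modulo null sets. Such vectors are orthogonal to everything,
  so orthogonality to the span carries over to \<open>W\<close>.\<close>

lemma projection_onto_finite_dim:
  assumes W: "subspace W" "W \<subseteq> V" and S: "finite S" "S \<subseteq> W"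
    and gen: "\<And>w. w \<in> W \<Longrightarrow> \<exists>x\<in>span S. B (w - x) (w - x) = 0" and v: "v \<in> V"
  shows "\<exists>u\<in>W. \<forall>w\<in>W. B (v - u) w = 0"
proof -
  have SV: "S \<subseteq> V" using S W by auto
  obtain u where u: "u \<in> span S" "\<forall>b\<in>S. B (v - u) b = 0"
    using projection_onto_span[OF S(1) SV v] by blast
  have uW: "u \<in> W" using u(1) span_minimal[OF S(2) W(1)] by auto
  have vu: "v - u \<in> V" using uW W v by (auto intro: V_intros)
  have "B (v - u) w = 0" if w: "w \<in> W" for w
  proof -
    obtain x where x: "x \<in> span S" "B (w - x) (w - x) = 0" using gen[OF w] by blast
    have xV: "x \<in> V" "w \<in> V" using x span_subset_V[OF SV] w W by auto
    have "B (v - u) (w - x) = 0" using B_null[of "w - x" "v - u"] x xV vu by (auto simp: V_intros)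
    moreover have "B (v - u) x = 0" using orthogonal_span[OF SV vu _ x(1)] u by auto
    ultimately show ?thesis using xV vu by (simp add: B_diff2)
  qed
  then show ?thesis using uW by blast
qed

text \<open>
  Sokal's proof without the Baire category theorem: by the triangle inequality one of
  \<open>P (x + y)\<close>, \<open>P (x - y)\<close> is at least \<open>P y\<close>, so steps of length \<open>3\<^sup>-\<^sup>n\<close> can be
  chosen along which the \<open>n\<close>-th seminorm becomes large, and later steps cannot undo this.
\<close>

lemma uniform_boundedness:
  assumes complete: complete_space
    and P_add: "\<And>i x y. \<lbrakk>i \<in> I; x \<in> V; y \<in> V\<rbrakk> \<Longrightarrow> P i (x + y) \<le> P i x + P i y"
    and P_scale: "\<And>i x c. \<lbrakk>i \<in> I; x \<in> V\<rbrakk> \<Longrightarrow> P i (c *\<^sub>R x) = \<bar>c\<bar> * P i x"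
    and P_bound: "\<And>i x. \<lbrakk>i \<in> I; x \<in> V\<rbrakk> \<Longrightarrow> P i x \<le> C i * N x"
    and pointwise: "\<And>x. x \<in> V \<Longrightarrow> \<exists>K. \<forall>i\<in>I. P i x \<le> K"
  shows "\<exists>M. \<forall>i\<in>I. \<forall>x\<in>V. P i x \<le> M * N x"
proof (rule ccontr)
  assume contra: "\<not> ?thesis"
  \<comment> \<open>The operator norm of the \<open>i\<close>-th seminorm. The individual bounds
    \<open>C i\<close> make the supremum finite and keep \<open>P i\<close> from being positive on
    vectors of norm zero.\<close>
  define L where "L i = (SUP x\<in>{x\<in>V. N x \<le> 1}. P i x)" for i
  have bdd: "bdd_above (P i ` {x\<in>V. N x \<le> 1})" if "i \<in> I" for i
  proof (rule bdd_aboveI2)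
    fix x assume "x \<in> {x\<in>V. N x \<le> 1}"
    then have "P i x \<le> C i * N x" "0 \<le> N x" "N x \<le> 1" using P_bound[OF that] by auto
    moreover have "C i * N x \<le> \<bar>C i\<bar> * 1" by (intro mult_mono) (use calculation in auto)
    ultimately show "P i x \<le> \<bar>C i\<bar>" by linarith
  qed
  have L_upper: "P i x \<le> L i" if "i \<in> I" "x \<in> V" "N x \<le> 1" for i x
    unfolding L_def by (rule cSUP_upper[OF _ bdd]) (use that in auto)
  have PL: "P i x \<le> L i * N x" if "i \<in> I" "x \<in> V" for i x
  proof (cases "N x = 0")
    case True
    then show ?thesis using P_bound[OF that] by simp
  next
    case False
    then have pos: "N x > 0" using N_nonneg[OF that(2)] by linarith
    have "P i ((1 / N x) *\<^sub>R x) \<le> L i"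
      using that pos by (intro L_upper) (auto simp: V_intros N_scale)
    then show ?thesis using that pos by (simp add: P_scale field_simps)
  qed
  \<comment> \<open>Otherwise \<open>4 ^ n\<close> itself would be a uniform bound. The base 4 is
    chosen to beat the step length \<open>(1/3)^n\<close>.\<close>
  have "\<exists>i\<in>I. L i > 4 ^ n" for n :: nat
  proof (rule ccontr)
    assume "\<not> ?thesis"
    then have "\<forall>i\<in>I. L i \<le> 4 ^ n" by (auto simp: not_less)
    then have "\<forall>i\<in>I. \<forall>x\<in>V. P i x \<le> 4 ^ n * N x"
      using PL by (meson N_nonneg mult_right_mono order_trans)
    then show False using contra by blast
  qed
  then obtain j where j: "\<And>n. j n \<in> I" "\<And>n. L (j n) > 4 ^ n" by metis
  have L_pos: "L (j n) > 0" for n using j(2)[of n] zero_less_power[of "4::real" n] by linarith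
  have "\<exists>y\<in>V. N y \<le> 1 \<and> P (j n) y > 2/3 * L (j n)" for n
  proof -
    \<comment> \<open>The supremum need not be attained, so a fixed fraction of it is used. The
      fraction has to exceed 1/2, the share that all later steps together can take away.\<close>
    have *: "2/3 * L (j n) < Sup (P (j n) ` {x\<in>V. N x \<le> 1})"
      using L_pos[of n] unfolding L_def by simp
    have "0 \<in> {x\<in>V. N x \<le> 1}" by simp
    then have "P (j n) ` {x\<in>V. N x \<le> 1} \<noteq> {}" by blast
    from less_cSupD[OF this *] show ?thesis by blast
  qed
  then obtain y where y: "\<And>n. y n \<in> V" "\<And>n. N (y n) \<le> 1" "\<And>n. P (j n) (y n) > 2/3 * L (j n)"
    by metis
  define X where "X = rec_nat 0 (\<lambda>n x. if P (j n) (x + (1/3)^n *\<^sub>R y n) \<ge> P (j n) (x - (1/3)^n *\<^sub>R y n)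
     then x + (1/3)^n *\<^sub>R y n else x - (1/3)^n *\<^sub>R y n)"
  have X0: "X 0 = 0" by (simp add: X_def)
  have XS: "X (Suc n) = (if P (j n) (X n + (1/3)^n *\<^sub>R y n) \<ge> P (j n) (X n - (1/3)^n *\<^sub>R y n)
     then X n + (1/3)^n *\<^sub>R y n else X n - (1/3)^n *\<^sub>R y n)" for n
    by (simp add: X_def)
  have X: "X n \<in> V" for n
    by (induction n) (auto simp: X0 XS y V_intros)
  have step: "N (X (Suc n) - X n) \<le> (1/3)^n" for n
  proof -
    have "N (X (Suc n) - X n) = (1/3)^n * N (y n)"
      using N_scale[OF y(1), of "(1/3)^n" n] N_scale[OF y(1), of "-((1/3)^n)" n] by (auto simp: XS)
    then show ?thesis using y(2)[of n] by (simp add: mult_left_le)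
  qed
  have big: "P (j n) (X (Suc n)) > 2/3 * (1/3)^n * L (j n)" for n
  proof -
    let ?z = "(1/3)^n *\<^sub>R y n"
    have z: "?z \<in> V" by (intro V_intros y)
    have "2 * P (j n) ?z = P (j n) ((X n + ?z) + (-1) *\<^sub>R (X n - ?z))"
      using P_scale[OF j(1) z, of n 2] unfolding scaleR_2 by simp
    also have "\<dots> \<le> P (j n) (X n + ?z) + P (j n) (X n - ?z)"
      using P_add[OF j(1), of "X n + ?z" "(-1) *\<^sub>R (X n - ?z)" n] P_scale[OF j(1), of "X n - ?z" n "-1"] X z
      by (simp add: V_intros subspace_neg subspace)
    also have "\<dots> \<le> 2 * P (j n) (X (Suc n))" by (auto simp: XS)
    finally have "P (j n) (X (Suc n)) \<ge> (1/3)^n * P (j n) (y n)"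
      using P_scale[OF j(1) y(1), of n "(1/3)^n"] by simp
    moreover have "(1/3)^n * P (j n) (y n) > (1/3)^n * (2/3 * L (j n))"
      using y(3) by (intro mult_strict_left_mono) auto
    ultimately show ?thesis by (metis (no_types, lifting) mult.commute mult.left_commute order_less_le_trans)
  qed
  \<comment> \<open>Partial sums of the geometric series of step lengths; the full tail from
    \<open>n\<close> on is \<open>3/2 * (1/3)^n\<close>.\<close>
  have tail: "N (X (n + k) - X n) \<le> 3/2 * (1/3)^n * (1 - (1/3)^k)" for n k
  proof (induction k)
    case (Suc k)
    have "N (X (n + Suc k) - X n) \<le> N (X (Suc (n + k)) - X (n + k)) + N (X (n + k) - X n)"
      using N_triangle[of "X (Suc (n + k)) - X (n + k)" "X (n + k) - X n"] X by (simp add: V_intros)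
    also have "\<dots> \<le> (1/3)^(n+k) + 3/2 * (1/3)^n * (1 - (1/3)^k)"
      using step[of "n+k"] Suc.IH by simp
    also have "\<dots> = 3/2 * (1/3)^n * (1 - (1/3)^Suc k)"
      by (simp add: power_add field_simps)
    finally show ?case .
  qed simp
  have tail': "N (X m - X n) \<le> 3/2 * (1/3)^n" if "m \<ge> n" for m n
  proof -
    have "N (X m - X n) \<le> 3/2 * (1/3)^n * (1 - (1/3)^(m - n))" using tail[of n "m - n"] that by simp
    also have "\<dots> \<le> 3/2 * (1/3)^n" by (intro mult_left_le) auto
    finally show ?thesis .
  qed
  have lim0: "(\<lambda>n. c * (1/3)^n) \<longlonglongrightarrow> (0::real)" for c
    using tendsto_mult_right_zero[OF LIMSEQ_power_zero[of "1/3::real"]] by simp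
  have "\<exists>M. \<forall>m\<ge>M. \<forall>n\<ge>M. N (X m - X n) < e" if "e > 0" for e
  proof -
    obtain M where M: "3 * (1/3)^M < e"
      using order_tendstoD(2)[OF lim0[of 3] \<open>e > 0\<close>] by (auto simp: eventually_sequentially)
    have "N (X m - X n) < e" if "m \<ge> M" "n \<ge> M" for m n
      using N_diff_le[of "X m - X M" "X n - X M"] tail'[OF that(1)] tail'[OF that(2)] M X
      by (simp add: V_intros)
    then show ?thesis by blast
  qed
  then obtain x where x: "x \<in> V" and lim: "(\<lambda>n. N (X n - x)) \<longlonglongrightarrow> 0"
    using complete X unfolding complete_space_def by (metis image_subsetI)
  have near: "N (X n - x) \<le> 3/2 * (1/3)^n" for n
  proof (rule tendsto_lowerbound)
    show "(\<lambda>m. 3/2 * (1/3)^n + N (X m - x)) \<longlonglongrightarrow> 3/2 * (1/3)^n"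
      using tendsto_add[OF tendsto_const lim, of "3/2 * (1/3)^n"] by simp
    show "\<forall>\<^sub>F m in sequentially. N (X n - x) \<le> 3/2 * (1/3)^n + N (X m - x)"
      using eventually_ge_at_top[of n]
    proof eventually_elim
      case (elim m)
      have "N (X n - x) \<le> N (X n - X m) + N (X m - x)"
        using N_triangle[of "X n - X m" "X m - x"] X x by (simp add: V_intros)
      then show ?case using tail'[OF elim] N_minus_commute[OF X X, of n m] by simp
    qed
  qed simp
  have large: "P (j n) x \<ge> 1/6 * (4/3)^n" for n
  proof -
    have "P (j n) (X (Suc n)) \<le> P (j n) x + P (j n) (X (Suc n) - x)"
      using P_add[OF j(1) x, of "X (Suc n) - x" n] X x by (simp add: V_intros)
    also have "P (j n) (X (Suc n) - x) \<le> L (j n) * N (X (Suc n) - x)"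
      by (intro PL j V_intros X x)
    also have "\<dots> \<le> L (j n) * (3/2 * (1/3)^Suc n)"
      using near[of "Suc n"] L_pos[of n] by (intro mult_left_mono) simp_all
    \<comment> \<open>The tail starts at \<open>Suc n\<close> and costs at most
      \<open>3/2 * 1/3 = 1/2\<close> of \<open>(1/3)^n * L (j n)\<close>, which leaves
      \<open>2/3 - 1/2 = 1/6\<close>.\<close>
    finally have "P (j n) x \<ge> 1/6 * (1/3)^n * L (j n)" using big[of n] by (simp add: algebra_simps)
    moreover have "1/6 * (1/3)^n * L (j n) \<ge> 1/6 * (1/3)^n * 4^n"
      using j(2)[of n] by (intro mult_left_mono) auto
    moreover have "1/6 * (1/3)^n * 4^n = 1/6 * (4/3::real)^n" by (simp add: power_divide)
    ultimately show ?thesis by linarith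
  qed
  obtain K where K: "\<forall>i\<in>I. P i x \<le> K" using pointwise[OF x] by blast
  obtain n where "6 * K < (4/3::real)^n" using real_arch_pow[of "4/3::real" "6*K"] by auto
  then show False using large[of n] K j(1)[of n] by (force dest: bspec)
qed

end

section \<open>Square integrable functions\<close>

lemma L2_measurable: "u \<in> L2 \<Omega> \<Longrightarrow> u \<in> borel_measurable (lebesgue_on \<Omega>)"
  and L2_integrable: "u \<in> L2 \<Omega> \<Longrightarrow> integrable (lebesgue_on \<Omega>) (\<lambda>x. (norm (u x))\<^sup>2)"
  by (auto simp: L2_def)

lemma norm_add_power2_le:
  fixes a b :: "'b::real_inner"
  shows "(norm (a + b))\<^sup>2 \<le> 2 * (norm a)\<^sup>2 + 2 * (norm b)\<^sup>2"
proof -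
  have "0 \<le> (norm (a - b))\<^sup>2" by simp
  then show ?thesis
    by (simp add: power2_norm_eq_inner inner_add_left inner_add_right inner_diff_left inner_diff_right inner_commute)
qed

lemma abs_inner_le_power2:
  fixes a b :: "'b::real_inner"
  shows "\<bar>a \<bullet> b\<bar> \<le> (norm a)\<^sup>2 + (norm b)\<^sup>2"
proof -
  have "\<bar>a \<bullet> b\<bar> \<le> norm a * norm b" by (rule Cauchy_Schwarz_ineq2)
  also have "\<dots> \<le> (norm a)\<^sup>2 + (norm b)\<^sup>2"
    using sum_squares_bound[of "norm a" "norm b"] mult_nonneg_nonneg[OF norm_ge_zero norm_ge_zero, of a b]
    unfolding mult.assoc by linarith
  finally show ?thesis .
qed

lemma L2_I:
  assumes "u \<in> borel_measurable (lebesgue_on \<Omega>)" "integrable (lebesgue_on \<Omega>) g"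
    and "\<And>x. x \<in> \<Omega> \<Longrightarrow> (norm (u x))\<^sup>2 \<le> g x"
  shows "u \<in> L2 \<Omega>"
  unfolding L2_def mem_Collect_eq
  by (intro conjI assms(1) Bochner_Integration.integrable_bound[OF assms(2)])
     (use assms in \<open>auto intro!: AE_I2 intro: order_trans[OF _ abs_ge_self] simp: space_restrict_space\<close>)

lemma integrable_L2_inner:
  assumes "u \<in> L2 \<Omega>" "v \<in> L2 \<Omega>"
  shows "integrable (lebesgue_on \<Omega>) (\<lambda>x. u x \<bullet> v x)"
proof (rule Bochner_Integration.integrable_bound)
  show "integrable (lebesgue_on \<Omega>) (\<lambda>x. (norm (u x))\<^sup>2 + (norm (v x))\<^sup>2)"
    using assms by (intro Bochner_Integration.integrable_add L2_integrable)
  show "(\<lambda>x. u x \<bullet> v x) \<in> borel_measurable (lebesgue_on \<Omega>)"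
    using assms by (intro borel_measurable_inner L2_measurable)
  show "AE x in lebesgue_on \<Omega>. norm (u x \<bullet> v x) \<le> norm ((norm (u x))\<^sup>2 + (norm (v x))\<^sup>2)"
    using abs_inner_le_power2 by (auto intro!: AE_I2)
qed

lemma L2_add: "u \<in> L2 \<Omega> \<Longrightarrow> v \<in> L2 \<Omega> \<Longrightarrow> (\<lambda>x. u x + v x) \<in> L2 \<Omega>"
  by (rule L2_I[where g = "\<lambda>x. 2 * (norm (u x))\<^sup>2 + 2 * (norm (v x))\<^sup>2"])
     (intro borel_measurable_add Bochner_Integration.integrable_add integrable_mult_right
       L2_integrable L2_measurable norm_add_power2_le; assumption)+

lemma L2_scale: "u \<in> L2 \<Omega> \<Longrightarrow> (\<lambda>x. c *\<^sub>R u x) \<in> L2 \<Omega>"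
  by (rule L2_I[where g = "\<lambda>x. c\<^sup>2 * (norm (u x))\<^sup>2"])
     (use L2_measurable L2_integrable in \<open>auto intro!: borel_measurable_scaleR simp: power_mult_distrib\<close>)

lemma subspace_L2: "subspace (L2 \<Omega>)"
proof -
  have "(\<lambda>x. 0) \<in> L2 \<Omega>" by (simp add: L2_def)
  then show ?thesis
    using L2_add L2_scale by (auto simp: subspace_def zero_fun_def plus_fun_def scaleR_fun_def)
qed

lemma L2_inner_commute: "L2_inner \<Omega> u v = L2_inner \<Omega> v u"
  by (simp add: L2_inner_def inner_commute)

interpretation L2: semi_inner "L2 \<Omega>" "L2_inner \<Omega>"
  rewrites "semi_inner.N (L2_inner \<Omega>) = L2_norm \<Omega>"
proof -
  show *: "semi_inner (L2 \<Omega>) (L2_inner \<Omega>)"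
    by (unfold_locales, rule subspace_L2, auto simp: L2_inner_def inner_add_left integrable_L2_inner)
       (simp add: inner_commute)
  show "semi_inner.N (L2_inner \<Omega>) = L2_norm \<Omega>"
    by (rule ext) (simp add: semi_inner.N_def[OF *] L2_norm_def)
qed

lemma L2_norm_power2: "u \<in> L2 \<Omega> \<Longrightarrow> (L2_norm \<Omega> u)\<^sup>2 = (LINT x|lebesgue_on \<Omega>. (norm (u x))\<^sup>2)"
  by (simp add: L2.N_power2 L2_inner_def power2_norm_eq_inner)

lemma L2_inner_cong_AE:
  assumes "u \<in> L2 \<Omega>" "u' \<in> L2 \<Omega>" "v \<in> L2 \<Omega>" "v' \<in> L2 \<Omega>"
    and "AE x in lebesgue_on \<Omega>. u x = u' x" "AE x in lebesgue_on \<Omega>. v x = v' x"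
  shows "L2_inner \<Omega> u v = L2_inner \<Omega> u' v'"
  unfolding L2_inner_def using assms(5,6)
  by (intro integral_cong_AE borel_measurable_inner L2_measurable assms) (auto elim: eventually_elim2)

lemma L2_norm_cong_AE:
  assumes "u \<in> L2 \<Omega>" "u' \<in> L2 \<Omega>" "AE x in lebesgue_on \<Omega>. u x = u' x"
  shows "L2_norm \<Omega> u = L2_norm \<Omega> u'"
  unfolding L2_norm_def using L2_inner_cong_AE[OF assms(1,2,1,2,3,3)] by simp

lemma L2_norm_eq_0_iff:
  assumes "u \<in> L2 \<Omega>"
  shows "L2_norm \<Omega> u = 0 \<longleftrightarrow> (AE x in lebesgue_on \<Omega>. u x = 0)"
proof -
  have "L2_norm \<Omega> u = 0 \<longleftrightarrow> (LINT x|lebesgue_on \<Omega>. (norm (u x))\<^sup>2) = 0"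
    using L2_norm_power2[OF assms] by (metis power_zero_numeral zero_eq_power2)
  also have "\<dots> \<longleftrightarrow> (AE x in lebesgue_on \<Omega>. (norm (u x))\<^sup>2 = 0)"
    using L2_integrable[OF assms] by (intro integral_nonneg_eq_0_iff_AE) auto
  finally show ?thesis by simp
qed

text \<open>Riesz--Fischer: a rapidly Cauchy subsequence is summable in \<open>L\<^sup>1\<close>, hence converges almost
  everywhere, and Fatou's lemma identifies the limit.\<close>

lemma L2_complete:
  assumes \<Omega>: "\<Omega> \<in> lmeasurable"
  shows "semi_inner.complete_space (L2 \<Omega> :: ('a::euclidean_space \<Rightarrow> 'b::euclidean_space) set) (L2_inner \<Omega>)"
  unfolding L2.complete_space_def
proof (intro allI impI, elim conjE)
  fix X :: "nat \<Rightarrow> 'a \<Rightarrow> 'b"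
  assume "range X \<subseteq> L2 \<Omega>" and Cauchy: "\<forall>e>0. \<exists>M. \<forall>m\<ge>M. \<forall>n\<ge>M. L2_norm \<Omega> (X m - X n) < e"
  then have X: "X n \<in> L2 \<Omega>" for n by auto
  let ?M = "lebesgue_on \<Omega>"
  interpret finite_measure ?M by (rule finite_measure_lebesgue_on[OF \<Omega>])
  have "\<exists>M. \<forall>m\<ge>M. \<forall>n\<ge>M. L2_norm \<Omega> (X m - X n) < (1/2)^k" for k :: nat
    using Cauchy by simp
  then obtain r0 where r0: "\<And>k m n. m \<ge> r0 k \<Longrightarrow> n \<ge> r0 k \<Longrightarrow> L2_norm \<Omega> (X m - X n) < (1/2)^k"
    by metis
  \<comment> \<open>The thresholds \<open>r0\<close> need not be monotone; their running maximum
    is.\<close>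
  define r where "r k = Max (r0 ` {..k})" for k
  have r_mono: "r k \<le> r l" if "k \<le> l" for k l
    unfolding r_def using that by (intro Max_mono image_mono) auto
  have r_ge: "r0 k \<le> r k" for k by (auto simp: r_def)
  have r: "L2_norm \<Omega> (X m - X n) < (1/2)^k" if "m \<ge> r k" "n \<ge> r k" for k m n
    using r0 r_ge that order_trans by blast
  define Y where "Y k = X (r k)" for k
  define D where "D k = Y (Suc k) - Y k" for k
  have Y: "Y k \<in> L2 \<Omega>" for k by (simp add: Y_def X)
  have D: "D k \<in> L2 \<Omega>" for k by (simp add: D_def Y L2.V_diff)
  have Y_meas [measurable]: "Y k \<in> borel_measurable ?M" for k by (intro L2_measurable Y)
  have D_meas [measurable]: "D k \<in> borel_measurable ?M" for k by (intro L2_measurable D)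
  \<comment> \<open>Because the measure is finite, the constant 1 is square integrable, and pairing
    with it bounds L1 norms by L2 norms.\<close>
  have one: "(\<lambda>x. 1::real) \<in> L2 \<Omega>" by (simp add: L2_def)
  have nD: "(\<lambda>x. norm (D k x)) \<in> L2 \<Omega>" for k
    using L2_integrable[OF D[of k]] by (simp add: L2_def)
  have D_int: "integrable ?M (\<lambda>x. norm (D k x))" for k
    using integrable_L2_inner[OF nD one, of k] by simp
  have L1: "(LINT x|?M. norm (D k x)) \<le> (1/2)^k * L2_norm \<Omega> (\<lambda>x. 1::real)" for k
  proof -
    have "(LINT x|?M. norm (D k x)) = L2_inner \<Omega> (\<lambda>x. norm (D k x)) (\<lambda>x. 1)"
      by (simp add: L2_inner_def)
    also have "\<dots> \<le> L2_norm \<Omega> (\<lambda>x. norm (D k x)) * L2_norm \<Omega> (\<lambda>x. 1::real)"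
      using L2.Cauchy_Schwarz[OF nD one, of k] by simp
    also have "L2_norm \<Omega> (\<lambda>x. norm (D k x)) = L2_norm \<Omega> (D k)"
      by (simp add: L2_norm_def L2_inner_def power2_norm_eq_inner flip: power2_eq_square)
    also have "L2_norm \<Omega> (D k) \<le> (1/2)^k"
      unfolding D_def Y_def using r[of k "r (Suc k)" "r k"] r_mono[of k "Suc k"] by simp
    finally show ?thesis using L2.N_nonneg[OF one] by (auto intro: mult_right_mono)
  qed
  have "(\<integral>\<^sup>+x. (\<Sum>k. ennreal (norm (D k x))) \<partial>?M) = (\<Sum>k. \<integral>\<^sup>+x. ennreal (norm (D k x)) \<partial>?M)"
    by (intro nn_integral_suminf) simp
  also have "\<dots> = (\<Sum>k. ennreal (LINT x|?M. norm (D k x)))"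
    by (intro suminf_cong nn_integral_eq_integral D_int) auto
  also have "\<dots> \<le> (\<Sum>k. ennreal ((1/2)^k * L2_norm \<Omega> (\<lambda>x. 1::real)))"
    by (intro suminf_le ennreal_leI L1) auto
  also have "\<dots> = ennreal (\<Sum>k. (1/2)^k * L2_norm \<Omega> (\<lambda>x. 1::real))"
    using L2.N_nonneg[OF one] by (intro suminf_ennreal2 summable_mult2 summable_geometric) auto
  also have "\<dots> < \<infinity>" by simp
  finally have "AE x in ?M. (\<Sum>k. ennreal (norm (D k x))) \<noteq> \<infinity>"
    by (intro nn_integral_PInf_AE) auto
  then have conv: "AE x in ?M. convergent (\<lambda>n. Y n x)"
  proof eventually_elim
    case (elim x)
    then have "summable (\<lambda>k. norm (D k x))"
      by (intro summable_suminf_not_top) auto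
    then have "summable (\<lambda>k. Y (Suc k) x - Y k x)"
      using summable_norm_cancel by (simp add: D_def)
    then have "convergent (\<lambda>n. (\<Sum>k<n. Y (Suc k) x - Y k x) + Y 0 x)"
      by (intro convergent_add convergent_const) (simp add: summable_iff_convergent)
    then show ?case using sum_lessThan_telescope[of "\<lambda>n. Y n x"] by simp
  qed
  \<comment> \<open>Where the sequence diverges, \<open>lim\<close> has an unspecified value. This
    concerns a null set only, and measurability is not affected.\<close>
  define u where "u x = lim (\<lambda>n. Y n x)" for x
  have u_meas [measurable]: "u \<in> borel_measurable ?M" unfolding u_def by measurable
  have lim: "AE x in ?M. (\<lambda>n. Y n x) \<longlonglongrightarrow> u x"
    using conv by eventually_elim (simp add: u_def convergent_LIMSEQ_iff)
  have fatou: "(\<integral>\<^sup>+x. ennreal ((norm (u x - Y k x))\<^sup>2) \<partial>?M) \<le> ennreal (((1/2)^k)\<^sup>2)" for k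
  proof -
    have "(\<integral>\<^sup>+x. ennreal ((norm (u x - Y k x))\<^sup>2) \<partial>?M)
        = (\<integral>\<^sup>+x. liminf (\<lambda>j. ennreal ((norm (Y j x - Y k x))\<^sup>2)) \<partial>?M)"
    proof (rule nn_integral_cong_AE, use lim in eventually_elim)
      case (elim x)
      have "(\<lambda>j. ennreal ((norm (Y j x - Y k x))\<^sup>2)) \<longlonglongrightarrow> ennreal ((norm (u x - Y k x))\<^sup>2)"
        by (intro tendsto_ennrealI tendsto_intros elim)
      from lim_imp_Liminf[OF sequentially_bot this] show ?case by simp
    qed
    also have "\<dots> \<le> liminf (\<lambda>j. \<integral>\<^sup>+x. ennreal ((norm (Y j x - Y k x))\<^sup>2) \<partial>?M)"
      by (intro nn_integral_liminf) measurable
    also have "\<dots> \<le> limsup (\<lambda>j. \<integral>\<^sup>+x. ennreal ((norm (Y j x - Y k x))\<^sup>2) \<partial>?M)"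
      by (rule Liminf_le_Limsup) simp
    also have "\<dots> \<le> ennreal (((1/2)^k)\<^sup>2)"
    proof (rule Limsup_bounded, use eventually_ge_at_top[of k] in eventually_elim)
      case (elim j)
      have d: "Y j - Y k \<in> L2 \<Omega>" by (intro L2.V_diff Y)
      have "(\<integral>\<^sup>+x. ennreal ((norm (Y j x - Y k x))\<^sup>2) \<partial>?M) = ennreal ((L2_norm \<Omega> (Y j - Y k))\<^sup>2)"
        using nn_integral_eq_integral[OF L2_integrable[OF d]] L2_norm_power2[OF d] by simp
      also have "\<dots> \<le> ennreal (((1/2)^k)\<^sup>2)"
        using r[of k "r j" "r k"] r_mono[OF elim] L2.N_nonneg[OF d]
        by (intro ennreal_leI power_mono) (auto simp: Y_def)
      finally show ?case .
    qed
    finally show ?thesis .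
  qed
  \<comment> \<open>Fatou's bound is what yields square integrability: first of
    \<open>u - Y k\<close>, then of \<open>u\<close> by adding \<open>Y 0\<close> back.\<close>
  have uY: "u - Y k \<in> L2 \<Omega>" for k
    using order_le_less_trans[OF fatou[of k], of \<infinity>]
    by (auto simp: L2_def integrable_iff_bounded fun_diff_def)
  have "L2_norm \<Omega> (u - Y k) \<le> (1/2)^k" for k
  proof -
    have "ennreal ((L2_norm \<Omega> (u - Y k))\<^sup>2) = (\<integral>\<^sup>+x. ennreal ((norm (u x - Y k x))\<^sup>2) \<partial>?M)"
      using nn_integral_eq_integral[OF L2_integrable[OF uY]] L2_norm_power2[OF uY, of k] by simp
    then have "(L2_norm \<Omega> (u - Y k))\<^sup>2 \<le> ((1/2)^k)\<^sup>2"
      using fatou[of k] by (metis ennreal_le_iff zero_le_power2)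
    then show ?thesis by (rule power2_le_imp_le) simp
  qed
  moreover have u: "u \<in> L2 \<Omega>" using L2.V_add[OF uY[of 0] Y[of 0]] by simp
  ultimately have uY_le: "L2_norm \<Omega> (Y k - u) \<le> (1/2)^k" for k
    using L2.N_minus_commute[OF u Y[of k]] by metis
  have "(\<lambda>n. L2_norm \<Omega> (X n - u)) \<longlonglongrightarrow> 0"
  proof (rule LIMSEQ_I)
    fix e :: real assume "e > 0"
    then obtain k where k: "(1/2)^k < e/2" using real_arch_pow_inv[of "e/2" "1/2"] by auto
    have "norm (L2_norm \<Omega> (X n - u) - 0) < e" if "n \<ge> r k" for n
    proof -
      have "L2_norm \<Omega> (X n - u) \<le> L2_norm \<Omega> (X n - Y k) + L2_norm \<Omega> (Y k - u)"
        using L2.N_triangle[of "X n - Y k" \<Omega> "Y k - u"] X Y u by (simp add: L2.V_diff)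
      also have "\<dots> < e" using r[OF that order_refl] uY_le[of k] k by (simp add: Y_def)
      finally show ?thesis using X u by (simp add: L2.V_diff)
    qed
    then show "\<exists>no. \<forall>n\<ge>no. norm (L2_norm \<Omega> (X n - u) - 0) < e" by blast
  qed
  then show "\<exists>x\<in>L2 \<Omega>. (\<lambda>n. L2_norm \<Omega> (X n - x)) \<longlonglongrightarrow> 0" using u by blast
qed

lemma component_measurable_iff:
  fixes \<tau> :: "'a \<Rightarrow> real^'d::finite"
  shows "\<tau> \<in> borel_measurable M \<longleftrightarrow> (\<forall>i. (\<lambda>x. \<tau> x $ i) \<in> borel_measurable M)"
  by (subst borel_measurable_euclidean_space) (auto simp: Basis_vec_def inner_axis)

lemma L2_vec_iff:
  fixes \<tau> :: "'a::euclidean_space \<Rightarrow> real^'d::finite"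
  shows "\<tau> \<in> L2 \<Omega> \<longleftrightarrow> (\<forall>i. (\<lambda>x. \<tau> x $ i) \<in> L2 \<Omega>)"
proof
  assume \<tau>: "\<tau> \<in> L2 \<Omega>"
  show "\<forall>i. (\<lambda>x. \<tau> x $ i) \<in> L2 \<Omega>"
  proof
    fix i
    show "(\<lambda>x. \<tau> x $ i) \<in> L2 \<Omega>"
      by (rule L2_I[OF _ L2_integrable[OF \<tau>]])
         (use L2_measurable[OF \<tau>] component_measurable_iff in
          \<open>auto intro: power2_le_iff_abs_le[THEN iffD2] component_le_norm_cart\<close>)
  qed
next
  assume *: "\<forall>i. (\<lambda>x. \<tau> x $ i) \<in> L2 \<Omega>"
  show "\<tau> \<in> L2 \<Omega>"
  proof (rule L2_I)
    show "integrable (lebesgue_on \<Omega>) (\<lambda>x. \<Sum>i\<in>UNIV. (norm (\<tau> x $ i))\<^sup>2)"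
      using * by (intro Bochner_Integration.integrable_sum L2_integrable) auto
    show "\<tau> \<in> borel_measurable (lebesgue_on \<Omega>)"
      using * L2_measurable unfolding component_measurable_iff[of \<tau>] by blast
  qed (simp add: power2_norm_eq_inner inner_vec_def flip: power2_eq_square)
qed

lemma L2_inner_vec:
  fixes \<tau> \<xi> :: "'a::euclidean_space \<Rightarrow> real^'d::finite"
  assumes "\<tau> \<in> L2 \<Omega>" "\<xi> \<in> L2 \<Omega>"
  shows "L2_inner \<Omega> \<tau> \<xi> = (\<Sum>i\<in>UNIV. L2_inner \<Omega> (\<lambda>x. \<tau> x $ i) (\<lambda>x. \<xi> x $ i))"
proof -
  have "integrable (lebesgue_on \<Omega>) (\<lambda>x. \<tau> x $ i * \<xi> x $ i)" for i
    using integrable_L2_inner[of "\<lambda>x. \<tau> x $ i" \<Omega> "\<lambda>x. \<xi> x $ i"] assms L2_vec_iff by force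
  then show ?thesis unfolding L2_inner_def inner_vec_def
    by (simp add: Bochner_Integration.integral_sum)
qed

section \<open>Test functions\<close>

lemma has_derivative_imp_pderiv_at: "(\<phi> has_derivative D) (at x) \<Longrightarrow> pderiv_at i \<phi> x = D (axis i 1)"
  unfolding pderiv_at_def by (drule frechet_derivative_at) simp

lemma differentiable_imp_has_derivative_frechet:
  "\<phi> differentiable (at x) \<Longrightarrow> (\<phi> has_derivative frechet_derivative \<phi> (at x)) (at x)"
  by (simp add: frechet_derivative_works)

lemma pderiv_at_add:
  assumes "f differentiable (at x)" "g differentiable (at x)"
  shows "pderiv_at i (\<lambda>x. f x + g x) x = pderiv_at i f x + pderiv_at i g x"
  using has_derivative_imp_pderiv_at[OF has_derivative_add[OF assms[THEN differentiable_imp_has_derivative_frechet]]]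
  by (simp add: pderiv_at_def)

lemma pderiv_at_mult:
  assumes "f differentiable (at x)" "g differentiable (at x)"
  shows "pderiv_at i (\<lambda>x. f x * g x) x = f x * pderiv_at i g x + pderiv_at i f x * g x"
  using has_derivative_imp_pderiv_at[OF has_derivative_mult[OF assms[THEN differentiable_imp_has_derivative_frechet]]]
  by (simp add: pderiv_at_def)

lemma Ck_SucI:
  assumes "\<And>x. \<phi> differentiable (at x)" "\<And>i x. pderiv_at i \<phi> x = \<psi> i x" "\<And>i. Ck k (\<psi> i)"
  shows "Ck (Suc k) \<phi>"
proof -
  have "pderiv_at i \<phi> = \<psi> i" for i using assms(2) by blast
  then show ?thesis using assms by simp
qed

lemma Ck_imp_continuous: "Ck k \<phi> \<Longrightarrow> continuous_on UNIV \<phi>"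
  by (cases k) (simp_all add: continuous_at_imp_continuous_on differentiable_imp_continuous_within)

lemma Ck_Suc_imp: "Ck (Suc k) \<phi> \<Longrightarrow> Ck k \<phi>"
proof (induction k arbitrary: \<phi>)
  case 0
  then show ?case using Ck_imp_continuous[of 1] by simp
next
  case (Suc k)
  from Suc.prems have "\<And>x. \<phi> differentiable (at x)" "\<And>i. Ck (Suc k) (pderiv_at i \<phi>)"
    unfolding Ck.simps(2)[of "Suc k"] by blast+
  then show ?case unfolding Ck.simps(2)[of k \<phi>] by (intro conjI allI Suc.IH)
qed

lemma Ck_const: "Ck k (\<lambda>x. c)"
proof (induction k arbitrary: c)
  case (Suc k)
  show ?case
    by (rule Ck_SucI[where \<psi> = "\<lambda>i x. 0"]) (auto intro: has_derivative_imp_pderiv_at Suc)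
qed simp

lemma Ck_add: "Ck k f \<Longrightarrow> Ck k g \<Longrightarrow> Ck k (\<lambda>x. f x + g x)"
proof (induction k arbitrary: f g)
  case 0
  then show ?case by (auto intro: continuous_on_add)
next
  case (Suc k)
  then show ?case
    by (intro Ck_SucI[where \<psi> = "\<lambda>i x. pderiv_at i f x + pderiv_at i g x"])
       (auto simp: pderiv_at_add)
qed

lemma Ck_mult: "Ck k f \<Longrightarrow> Ck k g \<Longrightarrow> Ck k (\<lambda>x. f x * g x)"
proof (induction k arbitrary: f g)
  case 0
  then show ?case by (auto intro: continuous_on_mult)
next
  case (Suc k)
  have k: "Ck k f" "Ck k g" by (rule Ck_Suc_imp, rule Suc.prems)+
  show ?case
    using Suc.prems
    by (intro Ck_SucI[where \<psi> = "\<lambda>i x. f x * pderiv_at i g x + pderiv_at i f x * g x"])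
       (auto simp: pderiv_at_mult intro!: Ck_add Suc.IH k)
qed

lemma Ck_prod: "finite A \<Longrightarrow> (\<And>j. j \<in> A \<Longrightarrow> Ck k (f j)) \<Longrightarrow> Ck k (\<lambda>x. \<Prod>j\<in>A. f j x)"
  by (induction A rule: finite_induct) (simp_all add: Ck_const Ck_mult)

section \<open>Smooth bump functions on boxes\<close>

primrec Ck1 :: "nat \<Rightarrow> (real \<Rightarrow> real) \<Rightarrow> bool" where
  "Ck1 0 h \<longleftrightarrow> continuous_on UNIV h"
| "Ck1 (Suc k) h \<longleftrightarrow> (\<exists>h'. (\<forall>t. (h has_real_derivative h' t) (at t)) \<and> Ck1 k h')"

lemma Ck_comp_affine_coordinate:
  fixes i :: "'d::finite"
  shows "Ck1 k h \<Longrightarrow> Ck k (\<lambda>x::real^'d. h (a * x $ i + b))"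
proof (induction k arbitrary: h)
  case 0
  have "continuous_on UNIV (\<lambda>x::real^'d. a * x $ i + b)" by (intro continuous_intros)
  then show ?case using 0 by (auto intro: continuous_on_compose2)
next
  case (Suc k)
  then obtain h' where h': "\<And>t. (h has_real_derivative h' t) (at t)" "Ck1 k h'" by auto
  have D: "((\<lambda>x::real^'d. h (a * x $ i + b)) has_derivative (\<lambda>v. h' (a * x $ i + b) * (a * v $ i))) (at x)"
    for x
  proof -
    have "((\<lambda>x::real^'d. a * x $ i + b) has_derivative (\<lambda>v. a * v $ i)) (at x)"
      by (auto intro!: derivative_eq_intros bounded_linear_imp_has_derivative bounded_linear_vec_nth)
    then show ?thesis
      using has_derivative_compose[of _ _ x UNIV h] h'(1)[unfolded has_field_derivative_def] by blast
  qed
  show ?case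
  proof (rule Ck_SucI[where \<psi> = "\<lambda>j x. (if i = j then a else 0) * h' (a * x $ i + b)"])
    show "Ck k (\<lambda>x. (if i = j then a else 0) * h' (a * x $ i + b))" for j
      by (intro Ck_mult Ck_const Suc.IH h')
    show "(\<lambda>x. h (a * x $ i + b)) differentiable (at x)" for x :: "real^'d"
      using D differentiable_def by blast
    show "pderiv_at j (\<lambda>x. h (a * x $ i + b)) x = (if i = j then a else 0) * h' (a * x $ i + b)" for j x
      using has_derivative_imp_pderiv_at[OF D, of j x] by (auto simp: axis_def)
  qed
qed

lemma Ck_coordinate: "Ck k (\<lambda>x::real^'d::finite. x $ i)"
proof -
  have "Ck1 k (\<lambda>t. c * t + d)" for c d
  proof (induction k arbitrary: c d)
    case (Suc k)
    have "Ck1 k (\<lambda>t. c)" using Suc.IH[of 0 c] by simp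
    moreover have "((\<lambda>t. c * t + d) has_real_derivative c) (at t)" for t
      by (auto intro!: derivative_eq_intros)
    ultimately show ?case unfolding Ck1.simps by (intro exI[of _ "\<lambda>t. c"]) simp
  qed (auto intro!: continuous_intros)
  from Ck_comp_affine_coordinate[OF this[of 1 0], of 1 i 0] show ?thesis by simp
qed

text \<open>The classical function that is smooth, positive on the right half line, and flat to
  infinite order at 0.\<close>

definition flat :: "real \<Rightarrow> real" where
  "flat t = (if t > 0 then exp (- inverse t) else 0)"

text \<open>The extra power \<open>y ^ n\<close> is there for the induction on the polynomial:
  splitting off the constant coefficient turns one factor \<open>y\<close> of the rest into a higher
  power.\<close>

lemma tendsto_power_poly_exp_0:
  "((\<lambda>y. y ^ n * poly p y * exp (- y)) \<longlongrightarrow> (0::real)) at_top"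
proof (induction p arbitrary: n)
  case (pCons a p)
  have "((\<lambda>y. a * (y ^ n / exp y) + y ^ Suc n * poly p y * exp (- y)) \<longlongrightarrow> a * 0 + 0) at_top"
    by (intro tendsto_intros tendsto_power_div_exp_0 pCons.IH)
  then show ?case by (simp add: algebra_simps exp_minus divide_inverse)
qed simp

text \<open>These products are closed under differentiation: both \<open>p (1/t)\<close> and
  \<open>exp (- 1/t)\<close> contribute a factor \<open>1/t\<^sup>2\<close>, so \<open>p\<close> is
  replaced by \<open>[:0, 0, 1:] * (p - pderiv p)\<close>. At \<open>t = 0\<close> the formula still
  holds, since \<open>flat 0 = 0\<close>.\<close>

lemma Ck1_poly_flat: "Ck1 k (\<lambda>t. poly p (inverse t) * flat t)"
proof -
  have D: "((\<lambda>t. poly p (inverse t) * flat t) has_real_derivative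
      poly ([:0, 0, 1:] * (p - pderiv p)) (inverse t) * flat t) (at t)" for t p
  proof (cases t "0 :: real" rule: linorder_cases)
    case greater
    have "((\<lambda>t. poly p (inverse t) * exp (- inverse t)) has_real_derivative
        poly ([:0, 0, 1:] * (p - pderiv p)) (inverse t) * flat t) (at t)"
      using greater
      by (auto intro!: derivative_eq_intros DERIV_chain2[OF poly_DERIV]
          simp: flat_def power2_eq_square algebra_simps)
    then show ?thesis
      by (rule has_field_derivative_transform_within_open[OF _ open_greaterThan[of 0]])
         (use greater in \<open>auto simp: flat_def\<close>)
  next
    case less
    have "((\<lambda>t. 0) has_real_derivative poly ([:0, 0, 1:] * (p - pderiv p)) (inverse t) * flat t) (at t)"
      using less by (auto simp: flat_def)
    then show ?thesis
      by (rule has_field_derivative_transform_within_open[OF _ open_lessThan[of 0]])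
         (use less in \<open>auto simp: flat_def\<close>)
  next
    case equal
    \<comment> \<open>The right difference quotient at 0, in the variable \<open>inverse y\<close>,
      is a polynomial times a decaying exponential. From the left it is identically zero.\<close>
    have "((\<lambda>y. poly p (inverse y) * flat y / y) \<longlongrightarrow> 0) (at_right 0)"
    proof (rule Lim_transform_eventually)
      show "((\<lambda>y. inverse y ^ 1 * poly p (inverse y) * exp (- inverse y)) \<longlongrightarrow> 0) (at_right 0)"
        by (rule filterlim_compose[OF tendsto_power_poly_exp_0 filterlim_inverse_at_top_right])
      show "\<forall>\<^sub>F y in at_right 0. inverse y ^ 1 * poly p (inverse y) * exp (- inverse y)
          = poly p (inverse y) * flat y / y"
        using eventually_at_right_less[of 0]
        by eventually_elim (simp add: flat_def divide_inverse)
    qed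
    moreover have "((\<lambda>y. poly p (inverse y) * flat y / y) \<longlongrightarrow> 0) (at_left 0)"
    proof (rule Lim_transform_eventually[OF tendsto_const])
      show "\<forall>\<^sub>F y in at_left 0. 0 = poly p (inverse y) * flat y / y"
        by (auto simp: eventually_at_left_field flat_def intro!: exI[of _ "-1"])
    qed
    ultimately show ?thesis
      using equal by (simp add: has_field_derivative_iff flat_def filterlim_split_at)
  qed
  show ?thesis
  proof (induction k arbitrary: p)
    case 0
    show ?case using DERIV_continuous_on[of UNIV, OF has_field_derivative_at_within[OF D]] by simp
  next
    case (Suc k)
    show ?case unfolding Ck1.simps by (intro exI conjI allI, rule D, rule Suc.IH)
  qed
qed

lemma Ck1_flat: "Ck1 k flat"
  using Ck1_poly_flat[of k 1] by simp

lemma flat_bounds: "0 \<le> flat t" "flat t \<le> 1"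
  by (auto simp: flat_def)

lemma flat_scaled_tendsto: "(\<lambda>n. flat (real (Suc n) * t)) \<longlonglongrightarrow> (if t > 0 then 1 else 0)"
proof (cases "t > 0")
  case True
  have "(\<lambda>n. exp (- (inverse (real (Suc n)) * inverse t))) \<longlonglongrightarrow> exp (- (0 * inverse t))"
    by (intro tendsto_intros LIMSEQ_inverse_real_of_nat)
  then show ?thesis using True by (simp add: flat_def)
next
  case False
  then have "flat (real (Suc n) * t) = 0" for n
    by (auto simp: flat_def zero_less_mult_iff)
  then show ?thesis using False by simp
qed

text \<open>Each face of the box contributes one factor, and the argument is stretched by
  \<open>Suc n\<close> because \<open>flat (n * t)\<close> tends to the indicator of
  \<open>t > 0\<close>. The sequence thus approximates the indicator of the open box with values
  between 0 and 1.\<close>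

definition box_bump :: "real^'d::finite \<Rightarrow> real^'d \<Rightarrow> nat \<Rightarrow> real^'d \<Rightarrow> real" where
  "box_bump a b n x =
     (\<Prod>i\<in>UNIV. flat (real (Suc n) * (x $ i - a $ i)) * flat (real (Suc n) * (b $ i - x $ i)))"

lemma Ck_box_bump: "Ck k (box_bump a b n)"
proof -
  have "Ck k (\<lambda>x. \<Prod>i\<in>UNIV. flat (real (Suc n) * x $ i + real (Suc n) * (- a $ i))
      * flat ((- real (Suc n)) * x $ i + real (Suc n) * b $ i))"
    by (intro Ck_prod Ck_mult Ck_comp_affine_coordinate Ck1_flat) simp
  then show ?thesis by (simp add: box_bump_def[abs_def] algebra_simps)
qed

lemma box_bump_nonneg: "0 \<le> box_bump a b n x"
  unfolding box_bump_def by (intro prod_nonneg ballI mult_nonneg_nonneg flat_bounds)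

lemma box_bump_le_1: "box_bump a b n x \<le> 1"
  unfolding box_bump_def
  by (intro prod_le_1 conjI mult_nonneg_nonneg mult_le_one flat_bounds)

lemma box_bump_outside: "x \<notin> box a b \<Longrightarrow> box_bump a b n x = 0"
proof -
  assume "x \<notin> box a b"
  then obtain i where i: "x $ i \<le> a $ i \<or> b $ i \<le> x $ i" by (auto simp: mem_box_cart not_less)
  have "flat (real (Suc n) * t) = 0" if "t \<le> 0" for t
    using that by (simp add: flat_def zero_less_mult_iff)
  then have "flat (real (Suc n) * (x $ i - a $ i)) * flat (real (Suc n) * (b $ i - x $ i)) = 0"
    using i by (metis diff_le_0_iff_le mult_eq_0_iff)
  then show ?thesis unfolding box_bump_def by (meson UNIV_I finite_class.finite_UNIV prod_zero)
qed

lemma box_bump_tendsto: "(\<lambda>n. box_bump a b n x) \<longlonglongrightarrow> indicator (box a b) x"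
proof (cases "x \<in> box a b")
  case True
  have "(\<lambda>n. box_bump a b n x) \<longlonglongrightarrow>
     (\<Prod>i\<in>UNIV. (if x $ i - a $ i > 0 then 1 else 0) * (if b $ i - x $ i > 0 then 1 else 0))"
    unfolding box_bump_def by (intro tendsto_prod tendsto_mult flat_scaled_tendsto)
  then show ?thesis using True by (simp add: mem_box_cart)
qed (simp add: box_bump_outside)

lemma test_functionsI:
  assumes "\<And>k. Ck k \<phi>" "compact K" "K \<subseteq> \<Omega>" "\<And>x. x \<notin> K \<Longrightarrow> \<phi> x = 0"
  shows "\<phi> \<in> test_functions \<Omega>"
proof -
  have "closure {x. \<phi> x \<noteq> 0} \<subseteq> K"
    using assms by (intro closure_minimal compact_imp_closed) auto
  then show ?thesis
    using assms compact_Int_closed[OF assms(2) closed_closure, of "{x. \<phi> x \<noteq> 0}"]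
    by (auto simp: test_functions_def Int_absorb1)
qed

lemma test_functions_support:
  assumes "\<phi> \<in> test_functions \<Omega>"
  shows "\<exists>K. compact K \<and> K \<subseteq> \<Omega> \<and> (\<forall>x. x \<notin> K \<longrightarrow> \<phi> x = 0)"
  using assms closure_subset[of "{x. \<phi> x \<noteq> 0}"]
  by (intro exI[of _ "closure {x. \<phi> x \<noteq> 0}"]) (auto simp: test_functions_def)

lemma box_bump_test: "cbox a b \<subseteq> \<Omega> \<Longrightarrow> box_bump a b n \<in> test_functions \<Omega>"
  using box_subset_cbox[of a b]
  by (intro test_functionsI[of _ "cbox a b"]) (auto simp: Ck_box_bump intro!: box_bump_outside)

section \<open>The fundamental lemma of the calculus of variations\<close>

lemma continuous_imp_measurable_lebesgue_on:
  fixes f :: "'a::euclidean_space \<Rightarrow> 'b::euclidean_space"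
  shows "continuous_on UNIV f \<Longrightarrow> f \<in> borel_measurable (lebesgue_on \<Omega>)"
  by (intro measurable_restrict_space1 measurable_completion)
     (simp add: borel_measurable_continuous_onI)

locale bounded_domain =
  fixes \<Omega> :: "(real^'d::finite) set"
  assumes open_dom: "open \<Omega>" and bounded_dom: "bounded \<Omega>"
begin

lemma lmeasurable_dom: "\<Omega> \<in> lmeasurable"
  using open_dom bounded_dom by (rule lmeasurable_open[rotated])

lemma sets_dom [simp]: "\<Omega> \<in> sets lebesgue"
  using lmeasurable_dom by (rule fmeasurableD)

sublocale M: finite_measure "lebesgue_on \<Omega>"
  by (rule finite_measure_lebesgue_on[OF lmeasurable_dom])

lemma one_L2: "(\<lambda>x. 1::real) \<in> L2 \<Omega>"
  by (simp add: L2_def)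

lemma integrable_L2: "(g :: real^'d \<Rightarrow> real) \<in> L2 \<Omega> \<Longrightarrow> integrable (lebesgue_on \<Omega>) g"
  using integrable_L2_inner[OF _ one_L2, of g] by simp

text \<open>Orthogonality to the bumps passes to their limit, the indicator of the open box, by
  dominated convergence with majorant \<open>norm (g x)\<close>.\<close>

lemma test_orthogonal_imp_box:
  assumes g: "g \<in> L2 \<Omega>" and orth: "\<And>\<phi>. \<phi> \<in> test_functions \<Omega> \<Longrightarrow> L2_inner \<Omega> g \<phi> = 0"
    and ab: "cbox a b \<subseteq> \<Omega>"
  shows "set_lebesgue_integral (lebesgue_on \<Omega>) (box a b) g = 0"
proof -
  have [measurable]: "g \<in> borel_measurable (lebesgue_on \<Omega>)" by (rule L2_measurable[OF g])
  have [measurable]: "box_bump a b n \<in> borel_measurable (lebesgue_on \<Omega>)" for n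
    by (intro continuous_imp_measurable_lebesgue_on Ck_imp_continuous[OF Ck_box_bump])
  have box: "box a b \<in> sets (lebesgue_on \<Omega>)"
    using ab box_subset_cbox[of a b] by (auto simp: sets_restrict_space_iff)
  have "(\<lambda>n. LINT x|lebesgue_on \<Omega>. g x * box_bump a b n x)
      \<longlonglongrightarrow> (LINT x|lebesgue_on \<Omega>. g x * indicator (box a b) x)"
  proof (rule integral_dominated_convergence[where w = "\<lambda>x. norm (g x)"])
    show "AE x in lebesgue_on \<Omega>. (\<lambda>n. g x * box_bump a b n x) \<longlonglongrightarrow> g x * indicator (box a b) x"
      by (intro AE_I2 tendsto_intros box_bump_tendsto)
    show "AE x in lebesgue_on \<Omega>. norm (g x * box_bump a b n x) \<le> norm (g x)" for n
      by (intro AE_I2) (simp add: abs_mult mult_left_le box_bump_nonneg box_bump_le_1)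
    show "integrable (lebesgue_on \<Omega>) (\<lambda>x. norm (g x))" by (intro integrable_norm integrable_L2 g)
  qed (use box in measurable)
  moreover have "(LINT x|lebesgue_on \<Omega>. g x * box_bump a b n x) = 0" for n
    using orth[OF box_bump_test[OF ab]] by (simp add: L2_inner_def)
  ultimately have "(LINT x|lebesgue_on \<Omega>. g x * indicator (box a b) x) = 0"
    by (simp add: LIMSEQ_const_iff)
  then show ?thesis by (simp add: set_lebesgue_integral_def mult.commute)
qed

text \<open>A Dynkin system argument: open boxes form an intersection stable generator of the Borel
  sets. Cutting with the fixed box \<open>box c d\<close> keeps every set inside the domain and
  gives the complement step a total integral of zero.\<close>

lemma set_integral_zero_of_boxes:
  fixes g :: "real^'d \<Rightarrow> real"
  assumes g: "integrable (lebesgue_on \<Omega>) g"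
    and zero: "\<And>a b. cbox a b \<subseteq> \<Omega> \<Longrightarrow> set_lebesgue_integral (lebesgue_on \<Omega>) (box a b) g = 0"
    and cd: "cbox c d \<subseteq> \<Omega>" and A: "A \<in> sets borel"
  shows "set_lebesgue_integral (lebesgue_on \<Omega>) (A \<inter> box c d) g = 0"
proof -
  let ?M = "lebesgue_on \<Omega>"
  have sub: "box c d \<subseteq> \<Omega>" using cd box_subset_cbox[of c d] by blast
  have meas: "B \<inter> box c d \<in> sets ?M" if "B \<in> sets borel" for B
    using that sub by (auto simp: sets_restrict_space_iff intro!: sets_completionI_sets)
  have int: "set_integrable ?M (B \<inter> box c d) g" if "B \<in> sets borel" for B
    unfolding set_integrable_def by (intro integrable_mult_indicator meas that g)
  have "Int_stable (range (\<lambda>(a, b). box a b :: (real^'d) set))"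
    by (auto simp: Int_stable_def box_Int_box)
  moreover have "range (\<lambda>(a, b). box a b :: (real^'d) set) \<subseteq> Pow UNIV" by auto
  moreover have "A \<in> sigma_sets UNIV (range (\<lambda>(a, b). box a b))"
    using A unfolding borel_eq_box by simp
  ultimately show ?thesis
  proof (induction rule: sigma_sets_induct_disjoint)
    case (basic B)
    then obtain a b where B: "B = box a b" by auto
    obtain a' b' where ab: "B \<inter> box c d = box a' b'" using B by (auto simp: box_Int_box)
    show ?case
    \<comment> \<open>A nonempty open box has \<open>cbox a' b'\<close> as its closure, which stays
      in \<open>cbox c d\<close>. An empty one may have degenerate corners with a nonempty
      \<open>cbox\<close>, so it is treated apart.\<close>
    proof (cases "box a' b' = {}")
      case False
      then have "cbox a' b' = closure (box a' b')" by (simp add: closure_box)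
      also have "\<dots> \<subseteq> closure (box c d)" using ab by (intro closure_mono) auto
      also have "\<dots> \<subseteq> cbox c d" by (intro closure_minimal box_subset_cbox closed_cbox)
      finally show ?thesis using zero[of a' b'] cd ab by auto
    qed (simp add: ab set_lebesgue_integral_def)
  next
    case empty
    show ?case by (simp add: set_lebesgue_integral_def)
  next
    case (compl B)
    then have B: "B \<in> sets borel" by (simp add: borel_eq_box)
    have "set_lebesgue_integral ?M ((B \<inter> box c d) \<union> ((UNIV - B) \<inter> box c d)) g
        = set_lebesgue_integral ?M (B \<inter> box c d) g + set_lebesgue_integral ?M ((UNIV - B) \<inter> box c d) g"
      using B by (intro set_integral_Un int) auto
    moreover have "(B \<inter> box c d) \<union> ((UNIV - B) \<inter> box c d) = box c d" by auto
    ultimately show ?case using zero[OF cd] compl.IH by simp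
  next
    case (union F)
    then have F: "F i \<in> sets borel" for i by (auto simp: borel_eq_box)
    have eq: "(\<Union>i. F i) \<inter> box c d = (\<Union>i. F i \<inter> box c d)" by auto
    have "set_lebesgue_integral ?M (\<Union>i. F i \<inter> box c d) g = (\<Sum>i. set_lebesgue_integral ?M (F i \<inter> box c d) g)"
    proof (rule lebesgue_integral_countable_add)
      show "set_integrable ?M (\<Union>i. F i \<inter> box c d) g"
        unfolding eq[symmetric] using F by (intro int) auto
      show "F i \<inter> box c d \<inter> (F j \<inter> box c d) = {}" if "i \<noteq> j" for i j
        using union.hyps(1) that by (auto simp: disjoint_family_on_def)
    qed (intro meas F)
    then show ?case unfolding eq using union.IH by simp
  qed
qed

text \<open>On a single box, integrals over all measurable subsets vanish, which forces the function
  to vanish there almost everywhere. An open set is a countable union of closed boxes, so the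
  exceptional null sets can be collected.\<close>

lemma AE_zero_of_test_orthogonal:
  assumes g: "g \<in> L2 \<Omega>" and orth: "\<And>\<phi>. \<phi> \<in> test_functions \<Omega> \<Longrightarrow> L2_inner \<Omega> g \<phi> = 0"
  shows "AE x in lebesgue_on \<Omega>. g x = 0"
proof -
  let ?M = "lebesgue_on \<Omega>"
  note gi = integrable_L2[OF g]
  have on_box: "AE x in ?M. x \<in> cbox c d \<longrightarrow> g x = 0" if cd: "cbox c d \<subseteq> \<Omega>" for c d
  proof -
    have sub: "box c d \<subseteq> \<Omega>" using cd box_subset_cbox[of c d] by blast
    have box: "box c d \<in> sets ?M" using sub by (auto simp: sets_restrict_space_iff)
    have "AE x in ?M. indicator (box c d) x *\<^sub>R g x = 0"
    proof (rule M.density_zero)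
      show "integrable ?M (\<lambda>x. indicator (box c d) x *\<^sub>R g x)"
        by (rule integrable_mult_indicator[OF box gi])
      fix A assume "A \<in> sets ?M"
      then have A: "A \<in> sets lebesgue" "A \<subseteq> \<Omega>" by (auto simp: sets_restrict_space_iff)
      \<comment> \<open>A Lebesgue measurable set is a Borel set up to a null set, and the Dynkin
        argument covers Borel sets only.\<close>
      then obtain S N N' where S: "A = S \<union> N" "N \<subseteq> N'" "N' \<in> null_sets lborel" "S \<in> sets lborel"
        by (auto elim: sets_completionE)
      have S': "S \<inter> box c d \<in> sets ?M" "A \<inter> box c d \<in> sets ?M"
        using S(4) A sub by (auto simp: sets_restrict_space_iff)
      have "sym_diff (A \<inter> box c d) (S \<inter> box c d) \<in> null_sets ?M"
      proof (rule null_sets_subset)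
        show "N' \<inter> \<Omega> \<in> null_sets ?M"
          using S(3) null_sets_completionI[OF S(3)]
          by (auto simp: null_sets_restrict_space intro: null_set_Int2)
        show "sym_diff (A \<inter> box c d) (S \<inter> box c d) \<in> sets ?M" using S' by auto
        show "sym_diff (A \<inter> box c d) (S \<inter> box c d) \<subseteq> N' \<inter> \<Omega>" using S A by auto
      qed
      then have "set_lebesgue_integral ?M (A \<inter> box c d) g = set_lebesgue_integral ?M (S \<inter> box c d) g"
        by (intro set_integral_null_delta gi S')
      also have "\<dots> = 0"
        using S(4) by (intro set_integral_zero_of_boxes[OF gi _ cd] test_orthogonal_imp_box[OF g orth]) auto
      finally show "set_lebesgue_integral ?M A (\<lambda>x. indicator (box c d) x *\<^sub>R g x) = 0"
        by (simp add: set_lebesgue_integral_def indicator_inter_arith mult.assoc)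
    qed
    moreover have "AE x in ?M. x \<notin> cbox c d - box c d"
      using negligible_frontier_interval[of c d]
      using cd by (intro AE_not_in)
        (auto simp: negligible_iff_null_sets null_sets_restrict_space)
    ultimately show ?thesis by eventually_elim auto
  qed
  obtain \<D> where \<D>: "countable \<D>" "\<D> \<subseteq> Pow \<Omega>" "\<And>X. X \<in> \<D> \<Longrightarrow> \<exists>a b. X = cbox a b" "\<Union>\<D> = \<Omega>"
    using open_countable_Union_open_cbox[OF open_dom] by blast
  have "AE x in ?M. \<forall>X\<in>\<D>. x \<in> X \<longrightarrow> g x = 0"
    unfolding AE_ball_countable[OF \<D>(1)] using \<D>(2,3) on_box by blast
  moreover have "AE x in ?M. x \<in> \<Omega>" by (rule AE_I2) (simp add: space_restrict_space)
  ultimately show ?thesis by eventually_elim (use \<D>(4) in blast)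
qed

end

section \<open>Weak derivatives\<close>

lemma pderiv_at_test:
  assumes "\<phi> \<in> test_functions \<Omega>"
  shows "pderiv_at i \<phi> \<in> test_functions \<Omega>"
proof -
  obtain K where K: "compact K" "K \<subseteq> \<Omega>" "\<And>x. x \<notin> K \<Longrightarrow> \<phi> x = 0"
    using test_functions_support[OF assms] by blast
  show ?thesis
  proof (rule test_functionsI[OF _ K(1,2)])
    show "Ck k (pderiv_at i \<phi>)" for k
    proof -
      have "Ck (Suc k) \<phi>" using assms unfolding test_functions_def by blast
      then show ?thesis by simp
    qed
    show "pderiv_at i \<phi> x = 0" if "x \<notin> K" for x
    proof -
      have "(\<phi> has_derivative (\<lambda>_. 0)) (at x)"
        by (rule has_derivative_transform_within_open[OF has_derivative_const[of 0], of "- K"])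
           (use K that in \<open>auto simp: compact_imp_closed open_Compl\<close>)
      then show ?thesis by (simp add: has_derivative_imp_pderiv_at)
    qed
  qed
qed

lemma test_Ck: "\<phi> \<in> test_functions \<Omega> \<Longrightarrow> Ck k \<phi>"
  by (simp add: test_functions_def)

lemma test_differentiable: "\<phi> \<in> test_functions \<Omega> \<Longrightarrow> \<phi> differentiable (at x)"
  using test_Ck[of \<phi> \<Omega> "Suc 0"] by simp

lemma test_continuous: "\<phi> \<in> test_functions \<Omega> \<Longrightarrow> continuous_on UNIV \<phi>"
  using test_Ck[of \<phi> \<Omega> 0] by simp

lemma test_mult:
  assumes "\<phi> \<in> test_functions \<Omega>" "\<And>k. Ck k f"
  shows "(\<lambda>x. f x * \<phi> x) \<in> test_functions \<Omega>"
proof -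
  obtain K where K: "compact K" "K \<subseteq> \<Omega>" "\<And>x. x \<notin> K \<Longrightarrow> \<phi> x = 0"
    using test_functions_support[OF assms(1)] by blast
  show ?thesis
    by (rule test_functionsI[OF _ K(1,2)]) (auto intro!: Ck_mult assms(2) test_Ck[OF assms(1)] simp: K(3))
qed

lemma test_bounded:
  assumes "\<phi> \<in> test_functions \<Omega>"
  obtains C where "\<And>x. \<bar>\<phi> x\<bar> \<le> C"
proof -
  obtain K where K: "compact K" "K \<subseteq> \<Omega>" "\<And>x. x \<notin> K \<Longrightarrow> \<phi> x = 0"
    using test_functions_support[OF assms] by blast
  have "compact (\<phi> ` K)"
    using test_continuous[OF assms] K(1) by (auto intro: compact_continuous_image continuous_on_subset)
  then obtain C where C: "\<forall>x\<in>K. \<bar>\<phi> x\<bar> \<le> C"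
    by (auto dest!: compact_imp_bounded simp: bounded_iff)
  have "\<bar>\<phi> x\<bar> \<le> max C 0" for x
    using bspec[OF C, of x] K(3)[of x] by (cases "x \<in> K") auto
  then show ?thesis using that by blast
qed

lemma test_integrable_lborel:
  assumes "\<phi> \<in> test_functions \<Omega>"
  shows "integrable lborel \<phi>"
proof -
  obtain K where K: "compact K" "K \<subseteq> \<Omega>" "\<And>x. x \<notin> K \<Longrightarrow> \<phi> x = 0"
    using test_functions_support[OF assms] by blast
  have "integrable lborel (\<lambda>x. indicator K x *\<^sub>R \<phi> x)"
    using K test_continuous[OF assms] by (intro borel_integrable_compact) (auto intro: continuous_on_subset)
  moreover have "(\<lambda>x. indicator K x *\<^sub>R \<phi> x) = \<phi>"
    using K(3) by (auto simp: indicator_def fun_eq_iff)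
  ultimately show ?thesis by simp
qed

text \<open>The difference quotients of a test function have integral zero by translation invariance.\<close>

lemma integral_pderiv_test_lborel:
  fixes \<phi> :: "real^'d::finite \<Rightarrow> real"
  assumes \<phi>: "\<phi> \<in> test_functions \<Omega>"
  shows "(LINT x|lborel. pderiv_at i \<phi> x) = 0"
proof -
  let ?e = "axis i 1 :: real^'d"
  obtain K where K: "compact K" "K \<subseteq> \<Omega>" "\<And>x. x \<notin> K \<Longrightarrow> \<phi> x = 0"
    using test_functions_support[OF \<phi>] by blast
  obtain R where R: "\<And>x. x \<in> K \<Longrightarrow> norm x \<le> R"
    using compact_imp_bounded[OF K(1)] by (auto simp: bounded_iff)
  obtain C where C: "\<And>x. \<bar>pderiv_at i \<phi> x\<bar> \<le> C"
    using test_bounded[OF pderiv_at_test[OF \<phi>]] by blast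
  have [measurable]: "\<phi> \<in> borel_measurable borel"
    using test_continuous[OF \<phi>] by (rule borel_measurable_continuous_onI)
  have [measurable]: "pderiv_at i \<phi> \<in> borel_measurable borel"
    using test_continuous[OF pderiv_at_test[OF \<phi>]] by (rule borel_measurable_continuous_onI)
  have line: "((\<lambda>s. \<phi> (x + s *\<^sub>R ?e)) has_real_derivative pderiv_at i \<phi> (x + t *\<^sub>R ?e)) (at t)" for x t
  proof -
    have d: "(\<phi> has_derivative frechet_derivative \<phi> (at (x + t *\<^sub>R ?e))) (at (x + t *\<^sub>R ?e))"
      by (rule differentiable_imp_has_derivative_frechet[OF test_differentiable[OF \<phi>]])
    have "((\<lambda>s. x + s *\<^sub>R ?e) has_derivative (\<lambda>s. s *\<^sub>R ?e)) (at t)"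
      by (auto intro!: derivative_eq_intros)
    from has_derivative_compose[OF this d]
    have "((\<lambda>s. \<phi> (x + s *\<^sub>R ?e)) has_derivative
        (\<lambda>s. frechet_derivative \<phi> (at (x + t *\<^sub>R ?e)) (s *\<^sub>R ?e))) (at t)" .
    also have "(\<lambda>s. frechet_derivative \<phi> (at (x + t *\<^sub>R ?e)) (s *\<^sub>R ?e))
        = (*) (pderiv_at i \<phi> (x + t *\<^sub>R ?e))"
      using linear_scale[OF has_derivative_linear[OF d]] by (simp add: fun_eq_iff pderiv_at_def)
    finally show ?thesis by (simp add: has_field_derivative_def)
  qed
  define q where "q n x = (\<phi> (x + inverse (real (Suc n)) *\<^sub>R ?e) - \<phi> x) / inverse (real (Suc n))" for n x
  have "(\<lambda>n. LINT x|lborel. q n x) \<longlonglongrightarrow> (LINT x|lborel. pderiv_at i \<phi> x)"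
  \<comment> \<open>\<open>R\<close> bounds the support and the shifts have length at most 1, so the
    quotients vanish outside radius \<open>R + 1\<close>. Inside, the mean value theorem bounds them
    by the bound \<open>C\<close> of the derivative.\<close>
  proof (rule integral_dominated_convergence[where w = "\<lambda>x. indicator (cball 0 (R + 1)) x *\<^sub>R C"])
    show "integrable lborel (\<lambda>x::real^'d. indicator (cball 0 (R + 1)) x *\<^sub>R C)"
      by (intro borel_integrable_compact) auto
    show "AE x in lborel. (\<lambda>n. q n x) \<longlonglongrightarrow> pderiv_at i \<phi> x"
    proof (rule AE_I2)
      fix x :: "real^'d"
      have "((\<lambda>s. (\<phi> (x + s *\<^sub>R ?e) - \<phi> x) / s) \<longlongrightarrow> pderiv_at i \<phi> x) (at 0)"
        using line[of x 0] by (simp add: has_field_derivative_iff)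
      then have "(\<lambda>n. (\<phi> (x + inverse (real (Suc n)) *\<^sub>R ?e) - \<phi> x) / inverse (real (Suc n)))
          \<longlonglongrightarrow> pderiv_at i \<phi> x"
        by (rule filterlim_compose)
           (simp add: filterlim_at LIMSEQ_inverse_real_of_nat del: of_nat_Suc)
      then show "(\<lambda>n. q n x) \<longlonglongrightarrow> pderiv_at i \<phi> x" by (simp add: q_def)
    qed
    show "AE x in lborel. norm (q n x) \<le> indicator (cball 0 (R + 1)) x *\<^sub>R C" for n
    proof (rule AE_I2)
      fix x :: "real^'d"
      define t where "t = inverse (real (Suc n))"
      have t: "0 < t" "t \<le> 1" unfolding t_def by (auto simp: inverse_le_1_iff)
      have q: "q n x = (\<phi> (x + t *\<^sub>R ?e) - \<phi> x) / t" by (simp only: q_def t_def)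
      show "norm (q n x) \<le> indicator (cball 0 (R + 1)) x *\<^sub>R C"
      proof (cases "x \<in> cball 0 (R + 1)")
        case True
        obtain z where "\<phi> (x + t *\<^sub>R ?e) - \<phi> (x + 0 *\<^sub>R ?e) = (t - 0) * pderiv_at i \<phi> (x + z *\<^sub>R ?e)"
          using MVT2[OF t(1), of "\<lambda>s. \<phi> (x + s *\<^sub>R ?e)" "\<lambda>s. pderiv_at i \<phi> (x + s *\<^sub>R ?e)"] line
          by blast
        then have "q n x = pderiv_at i \<phi> (x + z *\<^sub>R ?e)"
          using t by (simp add: q)
        then show ?thesis using C True by simp
      next
        case False
        then have "norm x > R + 1" by simp
        moreover have "norm (x + t *\<^sub>R ?e) \<ge> norm x - norm (t *\<^sub>R ?e)" by (rule norm_diff_ineq)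
        ultimately have "norm (x + t *\<^sub>R ?e) > R" using t by (simp add: norm_axis_1)
        then have "x + t *\<^sub>R ?e \<notin> K" "x \<notin> K" using R \<open>norm x > R + 1\<close> by force+
        then show ?thesis using K(3) False by (simp add: q)
      qed
    qed
  qed (simp_all add: q_def)
  moreover have "(LINT x|lborel. q n x) = 0" for n
  proof -
    let ?c = "inverse (real (Suc n)) *\<^sub>R ?e"
    have *: "(LINT x|lborel. \<phi> (x + ?c)) = (LINT x|lborel. \<phi> x)"
      using integral_distr[of "(+) ?c" lborel borel \<phi>] by (simp add: lborel_distr_plus add.commute)
    have "integrable (distr lborel borel ((+) ?c)) \<phi>"
      by (simp add: lborel_distr_plus test_integrable_lborel[OF \<phi>])
    then have "integrable lborel (\<lambda>x. \<phi> (x + ?c))"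
      by (subst (asm) integrable_distr_eq) (auto simp: add.commute)
    then have "(LINT x|lborel. q n x) = ((LINT x|lborel. \<phi> (x + ?c)) - (LINT x|lborel. \<phi> x)) / inverse (real (Suc n))"
      unfolding q_def by (subst Bochner_Integration.integral_diff[symmetric]) (auto intro: test_integrable_lborel[OF \<phi>])
    then show ?thesis unfolding * by simp
  qed
  ultimately show ?thesis by (simp add: LIMSEQ_const_iff)
qed

context bounded_domain
begin

lemma bounded_measurable_L2:
  fixes u :: "real^'d \<Rightarrow> 'b::euclidean_space"
  assumes "u \<in> borel_measurable (lebesgue_on \<Omega>)" "\<And>x. x \<in> \<Omega> \<Longrightarrow> norm (u x) \<le> C"
  shows "u \<in> L2 \<Omega>"
  by (rule L2_I[where g = "\<lambda>x. C\<^sup>2"]) (use assms in \<open>auto intro: power_mono\<close>)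

lemma test_L2: "\<phi> \<in> test_functions \<Omega> \<Longrightarrow> \<phi> \<in> L2 \<Omega>"
  using test_bounded[of \<phi> \<Omega>]
  by (metis bounded_measurable_L2 continuous_imp_measurable_lebesgue_on real_norm_def test_continuous)

lemma integral_dom_eq_lborel:
  fixes f :: "real^'d \<Rightarrow> real"
  assumes "f \<in> borel_measurable borel" "\<And>x. x \<notin> \<Omega> \<Longrightarrow> f x = 0"
  shows "(LINT x|lebesgue_on \<Omega>. f x) = (LINT x|lborel. f x)"
proof -
  have "(LINT x|lebesgue_on \<Omega>. f x) = (LINT x|lebesgue. indicator \<Omega> x *\<^sub>R f x)"
    by (rule integral_restrict_space) simp
  also have "(\<lambda>x. indicator \<Omega> x *\<^sub>R f x) = f" using assms(2) by (auto simp: indicator_def fun_eq_iff)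
  also have "(LINT x|lebesgue. f x) = (LINT x|lborel. f x)"
    by (rule integral_completion) (simp add: assms(1))
  finally show ?thesis by simp
qed

lemma integral_pderiv_test:
  assumes "\<phi> \<in> test_functions \<Omega>"
  shows "(LINT x|lebesgue_on \<Omega>. pderiv_at i \<phi> x) = 0"
proof -
  note t = pderiv_at_test[OF assms, of i]
  obtain K where K: "K \<subseteq> \<Omega>" "\<And>x. x \<notin> K \<Longrightarrow> pderiv_at i \<phi> x = 0"
    using test_functions_support[OF t] by blast
  have "(LINT x|lebesgue_on \<Omega>. pderiv_at i \<phi> x) = (LINT x|lborel. pderiv_at i \<phi> x)"
    using K by (intro integral_dom_eq_lborel borel_measurable_continuous_onI test_continuous[OF t]) blast
  then show ?thesis by (simp add: integral_pderiv_test_lborel[OF assms])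
qed

text \<open>Integration by parts: the product with another test function is again a test function,
  so its derivative integrates to zero, and the product rule splits that integral.\<close>

lemma test_has_weak_pderiv:
  assumes \<phi>: "\<phi> \<in> test_functions \<Omega>"
  shows "has_weak_pderiv \<Omega> i \<phi> (pderiv_at i \<phi>)"
  unfolding has_weak_pderiv_def
proof (intro conjI ballI test_L2 pderiv_at_test \<phi>)
  fix \<psi> assume \<psi>: "\<psi> \<in> test_functions \<Omega>"
  have "(LINT x|lebesgue_on \<Omega>. pderiv_at i (\<lambda>x. \<phi> x * \<psi> x) x) = 0"
    by (intro integral_pderiv_test test_mult[OF \<psi>] test_Ck[OF \<phi>])
  moreover have "pderiv_at i (\<lambda>x. \<phi> x * \<psi> x) x = \<phi> x \<bullet> pderiv_at i \<psi> x + pderiv_at i \<phi> x \<bullet> \<psi> x" for x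
    by (simp add: pderiv_at_mult test_differentiable[OF \<phi>] test_differentiable[OF \<psi>])
  ultimately have "L2_inner \<Omega> \<phi> (pderiv_at i \<psi>) + L2_inner \<Omega> (pderiv_at i \<phi>) \<psi> = 0"
    unfolding L2_inner_def
    using integrable_L2_inner[OF test_L2[OF \<phi>] test_L2[OF pderiv_at_test[OF \<psi>]], of i]
      integrable_L2_inner[OF test_L2[OF pderiv_at_test[OF \<phi>]] test_L2[OF \<psi>], of i]
    by (subst Bochner_Integration.integral_add[symmetric]) simp_all
  then show "L2_inner \<Omega> \<phi> (pderiv_at i \<psi>) = - L2_inner \<Omega> (pderiv_at i \<phi>) \<psi>" by simp
qed

lemma has_weak_pderiv_L2: "has_weak_pderiv \<Omega> i u g \<Longrightarrow> u \<in> L2 \<Omega>" "has_weak_pderiv \<Omega> i u g \<Longrightarrow> g \<in> L2 \<Omega>"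
  by (simp_all add: has_weak_pderiv_def)

lemma has_weak_pderiv_unique:
  assumes "has_weak_pderiv \<Omega> i u g" "has_weak_pderiv \<Omega> i u g'"
  shows "AE x in lebesgue_on \<Omega>. g x = g' x"
proof -
  have "AE x in lebesgue_on \<Omega>. (g - g') x = 0"
  proof (rule AE_zero_of_test_orthogonal)
    show "g - g' \<in> L2 \<Omega>" using assms by (intro L2.V_diff has_weak_pderiv_L2)
    fix \<phi> assume \<phi>: "\<phi> \<in> test_functions \<Omega>"
    then have "L2_inner \<Omega> g \<phi> = L2_inner \<Omega> g' \<phi>" using assms by (simp add: has_weak_pderiv_def)
    then show "L2_inner \<Omega> (g - g') \<phi> = 0"
      using assms by (simp add: L2.B_diff has_weak_pderiv_L2 test_L2[OF \<phi>])
  qed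
  then show ?thesis by simp
qed

lemma has_weak_pderiv_0: "has_weak_pderiv \<Omega> i 0 0"
  unfolding has_weak_pderiv_def by (simp only: L2.V_0) (simp add: L2_inner_def)

lemma has_weak_pderiv_add:
  assumes "has_weak_pderiv \<Omega> i u g" "has_weak_pderiv \<Omega> i v h"
  shows "has_weak_pderiv \<Omega> i (u + v) (g + h)"
  using assms unfolding has_weak_pderiv_def
  by (simp add: L2.V_add L2.B_add test_L2 pderiv_at_test)

lemma has_weak_pderiv_scale:
  assumes "has_weak_pderiv \<Omega> i u g"
  shows "has_weak_pderiv \<Omega> i (c *\<^sub>R u) (c *\<^sub>R g)"
  using assms unfolding has_weak_pderiv_def
  by (simp add: L2.V_scale L2.B_scale test_L2 pderiv_at_test)

lemma has_weak_pderiv_cong: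
  assumes "has_weak_pderiv \<Omega> i u g" "v \<in> L2 \<Omega>" "AE x in lebesgue_on \<Omega>. u x = v x"
  shows "has_weak_pderiv \<Omega> i v g"
  unfolding has_weak_pderiv_def
proof (intro conjI ballI assms(2) has_weak_pderiv_L2(2)[OF assms(1)])
  fix \<phi> assume \<phi>: "\<phi> \<in> test_functions \<Omega>"
  have "L2_inner \<Omega> v (pderiv_at i \<phi>) = L2_inner \<Omega> u (pderiv_at i \<phi>)"
    using assms \<phi> by (intro L2_inner_cong_AE) (auto simp: has_weak_pderiv_L2 test_L2 pderiv_at_test)
  then show "L2_inner \<Omega> v (pderiv_at i \<phi>) = - L2_inner \<Omega> g \<phi>"
    using assms(1) \<phi> by (simp add: has_weak_pderiv_def)
qed

text \<open>For a fixed test function both sides of the defining identity are continuous in L2. This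
  closedness is what turns L2 completeness into completeness for gradients.\<close>

lemma has_weak_pderiv_closed:
  assumes X: "\<And>n. has_weak_pderiv \<Omega> i (X n) (G n)" and u: "u \<in> L2 \<Omega>" and g: "g \<in> L2 \<Omega>"
    and limX: "(\<lambda>n. L2_norm \<Omega> (X n - u)) \<longlonglongrightarrow> 0" and limG: "(\<lambda>n. L2_norm \<Omega> (G n - g)) \<longlonglongrightarrow> 0"
  shows "has_weak_pderiv \<Omega> i u g"
  unfolding has_weak_pderiv_def
proof (intro conjI ballI u g)
  fix \<phi> assume \<phi>: "\<phi> \<in> test_functions \<Omega>"
  have 1: "(\<lambda>n. L2_inner \<Omega> (X n) (pderiv_at i \<phi>)) \<longlonglongrightarrow> L2_inner \<Omega> u (pderiv_at i \<phi>)"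
    by (rule L2.tendsto_B) (use X limX u test_L2 pderiv_at_test \<phi> has_weak_pderiv_L2 in blast)+
  have 2: "(\<lambda>n. L2_inner \<Omega> (G n) \<phi>) \<longlonglongrightarrow> L2_inner \<Omega> g \<phi>"
    by (rule L2.tendsto_B) (use X limG g test_L2 \<phi> has_weak_pderiv_L2 in blast)+
  have "L2_inner \<Omega> (X n) (pderiv_at i \<phi>) = - L2_inner \<Omega> (G n) \<phi>" for n
    using X \<phi> by (simp add: has_weak_pderiv_def)
  then show "L2_inner \<Omega> u (pderiv_at i \<phi>) = - L2_inner \<Omega> g \<phi>"
    using LIMSEQ_unique[OF 1] tendsto_minus[OF 2] by simp
qed

lemma has_weak_div_L2: "has_weak_div \<Omega> \<tau> g \<Longrightarrow> \<tau> \<in> L2 \<Omega>" "has_weak_div \<Omega> \<tau> g \<Longrightarrow> g \<in> L2 \<Omega>"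
  by (simp_all add: has_weak_div_def)

lemma cgrad_L2: "\<phi> \<in> test_functions \<Omega> \<Longrightarrow> cgrad \<phi> \<in> L2 \<Omega>"
  unfolding L2_vec_iff by (simp add: cgrad_def test_L2 pderiv_at_test)

lemma has_weak_div_unique:
  assumes "has_weak_div \<Omega> \<tau> g" "has_weak_div \<Omega> \<tau> g'"
  shows "AE x in lebesgue_on \<Omega>. g x = g' x"
proof -
  have "AE x in lebesgue_on \<Omega>. (g - g') x = 0"
  proof (rule AE_zero_of_test_orthogonal)
    show "g - g' \<in> L2 \<Omega>" using assms by (intro L2.V_diff has_weak_div_L2)
    fix \<phi> assume \<phi>: "\<phi> \<in> test_functions \<Omega>"
    then have "L2_inner \<Omega> g \<phi> = L2_inner \<Omega> g' \<phi>" using assms by (simp add: has_weak_div_def)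
    then show "L2_inner \<Omega> (g - g') \<phi> = 0"
      using assms by (simp add: L2.B_diff has_weak_div_L2 test_L2[OF \<phi>])
  qed
  then show ?thesis by simp
qed

lemma has_weak_div_add:
  assumes "has_weak_div \<Omega> \<tau> g" "has_weak_div \<Omega> \<xi> h"
  shows "has_weak_div \<Omega> (\<tau> + \<xi>) (g + h)"
  using assms unfolding has_weak_div_def
  by (simp add: L2.V_add L2.B_add test_L2 cgrad_L2)

lemma has_weak_div_scale:
  assumes "has_weak_div \<Omega> \<tau> g"
  shows "has_weak_div \<Omega> (c *\<^sub>R \<tau>) (c *\<^sub>R g)"
  using assms unfolding has_weak_div_def
  by (simp add: L2.V_scale L2.B_scale test_L2 cgrad_L2)

lemma has_weak_div_wdiv: "\<tau> \<in> Hdiv \<Omega> \<Longrightarrow> has_weak_div \<Omega> \<tau> (wdiv \<Omega> \<tau>)"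
  by (simp add: Hdiv_def wdiv_def some_eq_ex[of "has_weak_div \<Omega> \<tau>"])

lemma Hdiv_L2: "\<tau> \<in> Hdiv \<Omega> \<Longrightarrow> \<tau> \<in> L2 \<Omega>" and wdiv_L2: "\<tau> \<in> Hdiv \<Omega> \<Longrightarrow> wdiv \<Omega> \<tau> \<in> L2 \<Omega>"
  using has_weak_div_L2 has_weak_div_wdiv by blast+

lemma wdiv_AE: "has_weak_div \<Omega> \<tau> g \<Longrightarrow> AE x in lebesgue_on \<Omega>. wdiv \<Omega> \<tau> x = g x"
  using has_weak_div_unique[OF has_weak_div_wdiv] by (auto simp: Hdiv_def)

lemma subspace_Hdiv: "subspace (Hdiv \<Omega>)"
proof -
  have "has_weak_div \<Omega> 0 0"
    unfolding has_weak_div_def by (simp only: L2.V_0) (simp add: L2_inner_def)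
  then show ?thesis
    unfolding subspace_def Hdiv_def using has_weak_div_add has_weak_div_scale by blast
qed

section \<open>First-order Sobolev spaces\<close>

lemma Hs_1_iff: "u \<in> Hs 1 \<Omega> \<longleftrightarrow> u \<in> L2 \<Omega> \<and> (\<forall>i. \<exists>g. has_weak_pderiv \<Omega> i u g)"
proof -
  have "weak_pderiv \<Omega> i u \<in> L2 \<Omega>" if "\<exists>g. has_weak_pderiv \<Omega> i u g" for i
    using someI_ex[OF that] has_weak_pderiv_L2 unfolding weak_pderiv_def by blast
  then show ?thesis by (auto simp: Hs_def)
qed

lemma weak_pderiv_works: "u \<in> Hs 1 \<Omega> \<Longrightarrow> has_weak_pderiv \<Omega> i u (weak_pderiv \<Omega> i u)"
  by (simp add: weak_pderiv_def Hs_1_iff some_eq_ex[of "has_weak_pderiv \<Omega> i u"])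

lemma Hs_1I: "(\<And>i. has_weak_pderiv \<Omega> i u (g i)) \<Longrightarrow> u \<in> Hs 1 \<Omega>"
  using has_weak_pderiv_L2 unfolding Hs_1_iff by blast

lemma Hs_1_L2: "u \<in> Hs 1 \<Omega> \<Longrightarrow> u \<in> L2 \<Omega>"
  by (simp add: Hs_1_iff)

lemma grad_L2: "u \<in> Hs 1 \<Omega> \<Longrightarrow> grad \<Omega> u \<in> L2 \<Omega>"
  unfolding L2_vec_iff grad_def using has_weak_pderiv_L2(2)[OF weak_pderiv_works] by simp

text \<open>The components of \<open>grad\<close> are chosen independently; each agrees with a given
  weak derivative off a null set, and there are finitely many of them.\<close>

lemma grad_AE:
  assumes "\<And>i. has_weak_pderiv \<Omega> i u (g i)"
  shows "AE x in lebesgue_on \<Omega>. grad \<Omega> u x = (\<chi> i. g i x)"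
proof -
  have "AE x in lebesgue_on \<Omega>. \<forall>i\<in>UNIV. weak_pderiv \<Omega> i u x = g i x"
    using has_weak_pderiv_unique[OF weak_pderiv_works[OF Hs_1I[OF assms]] assms]
    by (intro AE_finite_allI) auto
  then show ?thesis by eventually_elim (simp add: grad_def)
qed

lemma subspace_Hs_1: "subspace (Hs 1 \<Omega>)"
proof -
  have "0 \<in> Hs 1 \<Omega>" by (rule Hs_1I[OF has_weak_pderiv_0])
  moreover have "u + v \<in> Hs 1 \<Omega>" if "u \<in> Hs 1 \<Omega>" "v \<in> Hs 1 \<Omega>" for u v
    using that by (intro Hs_1I[OF has_weak_pderiv_add[OF weak_pderiv_works weak_pderiv_works]])
  moreover have "c *\<^sub>R u \<in> Hs 1 \<Omega>" if "u \<in> Hs 1 \<Omega>" for c u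
    using that by (intro Hs_1I[OF has_weak_pderiv_scale[OF weak_pderiv_works]])
  ultimately show ?thesis by (simp add: subspace_def)
qed

text \<open>The representative chosen for the sum is unrelated to those chosen for the summands, so
  equality can hold only almost everywhere.\<close>

lemma grad_add_AE:
  assumes "u \<in> Hs 1 \<Omega>" "v \<in> Hs 1 \<Omega>"
  shows "AE x in lebesgue_on \<Omega>. grad \<Omega> (u + v) x = (grad \<Omega> u + grad \<Omega> v) x"
  using grad_AE[OF has_weak_pderiv_add[OF weak_pderiv_works[OF assms(1)] weak_pderiv_works[OF assms(2)]]]
  by eventually_elim (simp add: grad_def vec_eq_iff)

lemma grad_scale_AE:
  assumes "u \<in> Hs 1 \<Omega>"
  shows "AE x in lebesgue_on \<Omega>. grad \<Omega> (c *\<^sub>R u) x = (c *\<^sub>R grad \<Omega> u) x"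
  using grad_AE[OF has_weak_pderiv_scale[OF weak_pderiv_works[OF assms]]]
  by eventually_elim (simp add: grad_def vec_eq_iff)

lemma wdiv_add_AE:
  assumes "\<tau> \<in> Hdiv \<Omega>" "\<xi> \<in> Hdiv \<Omega>"
  shows "AE x in lebesgue_on \<Omega>. wdiv \<Omega> (\<tau> + \<xi>) x = (wdiv \<Omega> \<tau> + wdiv \<Omega> \<xi>) x"
  by (intro wdiv_AE has_weak_div_add has_weak_div_wdiv assms)

lemma wdiv_scale_AE:
  assumes "\<tau> \<in> Hdiv \<Omega>"
  shows "AE x in lebesgue_on \<Omega>. wdiv \<Omega> (c *\<^sub>R \<tau>) x = (c *\<^sub>R wdiv \<Omega> \<tau>) x"
  by (intro wdiv_AE has_weak_div_scale has_weak_div_wdiv assms)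

text \<open>The fractional part of 1 is 0, so no Gagliardo term occurs and the squares of the
  components add up to that of the gradient.\<close>

lemma Hs_norm_1:
  assumes "u \<in> Hs 1 \<Omega>"
  shows "Hs_norm 1 \<Omega> u = sqrt ((L2_norm \<Omega> u)\<^sup>2 + (L2_norm \<Omega> (grad \<Omega> u))\<^sup>2)"
proof -
  note g = grad_L2[OF assms]
  have "(\<lambda>x. grad \<Omega> u x $ i) = weak_pderiv \<Omega> i u" for i by (simp add: grad_def)
  moreover have "weak_pderiv \<Omega> i u \<in> L2 \<Omega>" for i using has_weak_pderiv_L2(2)[OF weak_pderiv_works[OF assms]] .
  ultimately have "(L2_norm \<Omega> (grad \<Omega> u))\<^sup>2 = (\<Sum>i\<in>UNIV. (L2_norm \<Omega> (weak_pderiv \<Omega> i u))\<^sup>2)"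
    using L2_inner_vec[OF g g] by (simp add: L2.N_power2 g)
  then show ?thesis by (simp add: Hs_norm_def)
qed

end

lemma test_add:
  assumes "\<phi> \<in> test_functions \<Omega>" "\<psi> \<in> test_functions \<Omega>"
  shows "\<phi> + \<psi> \<in> test_functions \<Omega>"
proof -
  obtain K where K: "compact K" "K \<subseteq> \<Omega>" "\<And>x. x \<notin> K \<Longrightarrow> \<phi> x = 0"
    using test_functions_support[OF assms(1)] by blast
  obtain L where L: "compact L" "L \<subseteq> \<Omega>" "\<And>x. x \<notin> L \<Longrightarrow> \<psi> x = 0"
    using test_functions_support[OF assms(2)] by blast
  show ?thesis
    by (rule test_functionsI[of _ "K \<union> L"])
       (use K L in \<open>auto simp: plus_fun_def intro!: Ck_add test_Ck[OF assms(1)] test_Ck[OF assms(2)]\<close>)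
qed

lemma test_scale: "\<phi> \<in> test_functions \<Omega> \<Longrightarrow> c *\<^sub>R \<phi> \<in> test_functions \<Omega>"
  using test_mult[OF _ Ck_const] by (simp add: scaleR_fun_def)

context bounded_domain
begin

lemma L2_norm_component_le:
  fixes \<tau> :: "real^'d \<Rightarrow> real^'e::finite"
  assumes "\<tau> \<in> L2 \<Omega>"
  shows "L2_norm \<Omega> (\<lambda>x. \<tau> x $ i) \<le> L2_norm \<Omega> \<tau>"
proof -
  have c: "(\<lambda>x. \<tau> x $ i) \<in> L2 \<Omega>" for i using assms L2_vec_iff by blast
  have "L2_inner \<Omega> (\<lambda>x. \<tau> x $ i) (\<lambda>x. \<tau> x $ i) \<le> (\<Sum>i\<in>UNIV. L2_inner \<Omega> (\<lambda>x. \<tau> x $ i) (\<lambda>x. \<tau> x $ i))"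
    by (rule member_le_sum) (auto intro: L2.B_nonneg[OF c])
  then show ?thesis unfolding L2_norm_def by (simp add: L2_inner_vec[OF assms assms])
qed

lemma Hs_1_intros:
  "u \<in> Hs 1 \<Omega> \<Longrightarrow> v \<in> Hs 1 \<Omega> \<Longrightarrow> u + v \<in> Hs 1 \<Omega>" "u \<in> Hs 1 \<Omega> \<Longrightarrow> c *\<^sub>R u \<in> Hs 1 \<Omega>"
  "u \<in> Hs 1 \<Omega> \<Longrightarrow> v \<in> Hs 1 \<Omega> \<Longrightarrow> u - v \<in> Hs 1 \<Omega>"
  using subspace_Hs_1 by (auto simp: subspace_add subspace_scale subspace_diff)

text \<open>Inside an inner product the linearity of the gradient becomes exact; in this form it
  feeds the axioms of \<open>semi_inner\<close>.\<close>

lemma inner_grad_add: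
  assumes "u \<in> Hs 1 \<Omega>" "v \<in> Hs 1 \<Omega>" "\<xi> \<in> L2 \<Omega>"
  shows "L2_inner \<Omega> (grad \<Omega> (u + v)) \<xi> = L2_inner \<Omega> (grad \<Omega> u) \<xi> + L2_inner \<Omega> (grad \<Omega> v) \<xi>"
proof -
  have "L2_inner \<Omega> (grad \<Omega> (u + v)) \<xi> = L2_inner \<Omega> (grad \<Omega> u + grad \<Omega> v) \<xi>"
    using assms by (intro L2_inner_cong_AE grad_add_AE grad_L2 Hs_1_intros L2.V_add) auto
  then show ?thesis using assms by (simp add: L2.B_add grad_L2)
qed

lemma inner_grad_scale:
  assumes "u \<in> Hs 1 \<Omega>" "\<xi> \<in> L2 \<Omega>"
  shows "L2_inner \<Omega> (grad \<Omega> (c *\<^sub>R u)) \<xi> = c * L2_inner \<Omega> (grad \<Omega> u) \<xi>"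
proof -
  have "L2_inner \<Omega> (grad \<Omega> (c *\<^sub>R u)) \<xi> = L2_inner \<Omega> (c *\<^sub>R grad \<Omega> u) \<xi>"
    using assms by (intro L2_inner_cong_AE grad_scale_AE grad_L2 Hs_1_intros L2.V_scale) auto
  then show ?thesis using assms by (simp add: L2.B_scale grad_L2)
qed

lemma Hdiv_intros:
  "\<tau> \<in> Hdiv \<Omega> \<Longrightarrow> \<xi> \<in> Hdiv \<Omega> \<Longrightarrow> \<tau> + \<xi> \<in> Hdiv \<Omega>" "\<tau> \<in> Hdiv \<Omega> \<Longrightarrow> c *\<^sub>R \<tau> \<in> Hdiv \<Omega>"
  "\<tau> \<in> Hdiv \<Omega> \<Longrightarrow> \<xi> \<in> Hdiv \<Omega> \<Longrightarrow> \<tau> - \<xi> \<in> Hdiv \<Omega>"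
  using subspace_Hdiv by (auto simp: subspace_add subspace_scale subspace_diff)

lemma inner_wdiv_add:
  assumes "\<tau> \<in> Hdiv \<Omega>" "\<xi> \<in> Hdiv \<Omega>" "g \<in> L2 \<Omega>"
  shows "L2_inner \<Omega> (wdiv \<Omega> (\<tau> + \<xi>)) g = L2_inner \<Omega> (wdiv \<Omega> \<tau>) g + L2_inner \<Omega> (wdiv \<Omega> \<xi>) g"
proof -
  have "L2_inner \<Omega> (wdiv \<Omega> (\<tau> + \<xi>)) g = L2_inner \<Omega> (wdiv \<Omega> \<tau> + wdiv \<Omega> \<xi>) g"
    using assms by (intro L2_inner_cong_AE wdiv_add_AE wdiv_L2 Hdiv_intros L2.V_add) auto
  then show ?thesis using assms by (simp add: L2.B_add wdiv_L2)
qed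

lemma inner_wdiv_scale:
  assumes "\<tau> \<in> Hdiv \<Omega>" "g \<in> L2 \<Omega>"
  shows "L2_inner \<Omega> (wdiv \<Omega> (c *\<^sub>R \<tau>)) g = c * L2_inner \<Omega> (wdiv \<Omega> \<tau>) g"
proof -
  have "L2_inner \<Omega> (wdiv \<Omega> (c *\<^sub>R \<tau>)) g = L2_inner \<Omega> (c *\<^sub>R wdiv \<Omega> \<tau>) g"
    using assms by (intro L2_inner_cong_AE wdiv_scale_AE wdiv_L2 Hdiv_intros L2.V_scale) auto
  then show ?thesis using assms by (simp add: L2.B_scale wdiv_L2)
qed

section \<open>The inner product of the first-order Sobolev space\<close>

definition H1_inner :: "(real^'d \<Rightarrow> real) \<Rightarrow> (real^'d \<Rightarrow> real) \<Rightarrow> real" where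
  "H1_inner u v = L2_inner \<Omega> u v + L2_inner \<Omega> (grad \<Omega> u) (grad \<Omega> v)"

sublocale H1: semi_inner "Hs 1 \<Omega>" H1_inner
proof
  show "H1_inner u v = H1_inner v u" for u v
    by (simp add: H1_inner_def L2_inner_commute)
qed (auto simp: H1_inner_def subspace_Hs_1 L2.B_add L2.B_scale inner_grad_add inner_grad_scale
    Hs_1_L2 grad_L2 L2.B_nonneg distrib_left)

lemma H1_N: "u \<in> Hs 1 \<Omega> \<Longrightarrow> H1.N u = Hs_norm 1 \<Omega> u"
  by (simp add: H1.N_def H1_inner_def Hs_norm_1 L2.N_power2 Hs_1_L2 grad_L2)

lemma L2_norm_le_H1_N: "u \<in> Hs 1 \<Omega> \<Longrightarrow> L2_norm \<Omega> u \<le> H1.N u"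
  and grad_norm_le_H1_N: "u \<in> Hs 1 \<Omega> \<Longrightarrow> L2_norm \<Omega> (grad \<Omega> u) \<le> H1.N u"
  unfolding H1_N by (simp_all add: Hs_norm_1 real_le_rsqrt)

lemma H1_N_le:
  assumes "u \<in> Hs 1 \<Omega>"
  shows "H1.N u \<le> L2_norm \<Omega> u + L2_norm \<Omega> (grad \<Omega> u)"
  unfolding H1_N[OF assms] Hs_norm_1[OF assms]
  by (intro sqrt_sum_squares_le_sum L2.N_nonneg Hs_1_L2 grad_L2 assms)

lemma test_Hs_1: "\<phi> \<in> test_functions \<Omega> \<Longrightarrow> \<phi> \<in> Hs 1 \<Omega>"
  by (rule Hs_1I[OF test_has_weak_pderiv])

lemma grad_test_AE: "\<phi> \<in> test_functions \<Omega> \<Longrightarrow> AE x in lebesgue_on \<Omega>. grad \<Omega> \<phi> x = cgrad \<phi> x"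
  using grad_AE[OF test_has_weak_pderiv] by (simp add: cgrad_def)

lemma L2_norm_grad_diff:
  assumes "u \<in> Hs 1 \<Omega>" "v \<in> Hs 1 \<Omega>"
  shows "L2_norm \<Omega> (grad \<Omega> (u - v)) = L2_norm \<Omega> (grad \<Omega> u - grad \<Omega> v)"
proof (rule L2_norm_cong_AE)
  show "AE x in lebesgue_on \<Omega>. grad \<Omega> (u - v) x = (grad \<Omega> u - grad \<Omega> v) x"
    using grad_add_AE[OF assms(1) Hs_1_intros(2)[OF assms(2), of "-1"]] grad_scale_AE[OF assms(2), of "-1"]
    by eventually_elim simp
qed (intro grad_L2 Hs_1_intros L2.V_diff assms)+

section \<open>The space of functions vanishing on the boundary\<close>

lemma H10_iff:
  "u \<in> H10 \<Omega> \<longleftrightarrow> u \<in> Hs 1 \<Omega> \<and> (\<exists>\<phi>. (\<forall>n. \<phi> n \<in> test_functions \<Omega>) \<and> (\<lambda>n. H1.N (u - \<phi> n)) \<longlonglongrightarrow> 0)"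
proof -
  have eq: "(\<lambda>n. H1.N (u - \<phi> n)) = (\<lambda>n. Hs_norm 1 \<Omega> (\<lambda>x. u x - \<phi> n x))"
    if "u \<in> Hs 1 \<Omega>" "\<forall>n. \<phi> n \<in> test_functions \<Omega>" for \<phi> :: "nat \<Rightarrow> real^'d \<Rightarrow> real"
    using H1_N[OF Hs_1_intros(3)[OF that(1) test_Hs_1]] that(2) by (simp add: fun_diff_def)
  show ?thesis
    unfolding H10_def mem_Collect_eq by (intro conj_cong refl iff_exI) (subst eq, assumption+, rule refl)
qed

lemma H10_Hs_1: "u \<in> H10 \<Omega> \<Longrightarrow> u \<in> Hs 1 \<Omega>"
  by (simp add: H10_iff)

lemma H10_L2: "u \<in> H10 \<Omega> \<Longrightarrow> u \<in> L2 \<Omega>"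
  by (simp add: H10_Hs_1 Hs_1_L2)

lemma H10_grad_L2: "u \<in> H10 \<Omega> \<Longrightarrow> grad \<Omega> u \<in> L2 \<Omega>"
  by (simp add: H10_Hs_1 grad_L2)

lemma test_H10: "\<phi> \<in> test_functions \<Omega> \<Longrightarrow> \<phi> \<in> H10 \<Omega>"
  unfolding H10_iff by (intro conjI test_Hs_1 exI[of _ "\<lambda>n. \<phi>"]) auto

lemma H10_approx:
  assumes "u \<in> H10 \<Omega>"
  obtains \<phi> where "\<And>n. \<phi> n \<in> test_functions \<Omega>" "(\<lambda>n. L2_norm \<Omega> (\<phi> n - u)) \<longlonglongrightarrow> 0"
    "(\<lambda>n. L2_norm \<Omega> (grad \<Omega> (\<phi> n) - grad \<Omega> u)) \<longlonglongrightarrow> 0"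
proof -
  obtain \<phi> where \<phi>: "\<And>n. \<phi> n \<in> test_functions \<Omega>" and lim: "(\<lambda>n. H1.N (u - \<phi> n)) \<longlonglongrightarrow> 0"
    using assms unfolding H10_iff by blast
  note u = H10_Hs_1[OF assms] and \<phi>1 = test_Hs_1[OF \<phi>]
  have lim': "(\<lambda>n. H1.N (\<phi> n - u)) \<longlonglongrightarrow> 0"
    using lim by (simp add: H1.N_minus_commute[OF u \<phi>1])
  show ?thesis
  proof (rule that[OF \<phi>])
    show "(\<lambda>n. L2_norm \<Omega> (\<phi> n - u)) \<longlonglongrightarrow> 0"
      by (rule tendsto_sandwich[OF _ _ tendsto_const lim'])
         (auto intro!: always_eventually L2_norm_le_H1_N L2.N_nonneg Hs_1_L2 Hs_1_intros \<phi>1 u)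
    show "(\<lambda>n. L2_norm \<Omega> (grad \<Omega> (\<phi> n) - grad \<Omega> u)) \<longlonglongrightarrow> 0"
      unfolding L2_norm_grad_diff[OF \<phi>1 u, symmetric]
      by (rule tendsto_sandwich[OF _ _ tendsto_const lim'])
         (auto intro!: always_eventually grad_norm_le_H1_N L2.N_nonneg grad_L2 Hs_1_intros \<phi>1 u)
  qed
qed

lemma subspace_H10: "subspace (H10 \<Omega>)"
  unfolding subspace_def
proof (intro conjI ballI allI)
  have "(\<lambda>x. 0) \<in> test_functions \<Omega>" by (rule test_functionsI[of _ "{}"]) (auto simp: Ck_const)
  then show "0 \<in> H10 \<Omega>" using test_H10 by (simp add: zero_fun_def)
  fix u assume "u \<in> H10 \<Omega>"
  then obtain \<phi> where u: "u \<in> Hs 1 \<Omega>" and \<phi>: "\<And>n. \<phi> n \<in> test_functions \<Omega>"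
    and limu: "(\<lambda>n. H1.N (u - \<phi> n)) \<longlonglongrightarrow> 0"
    unfolding H10_iff by blast
  note \<phi>1 = test_Hs_1[OF \<phi>]
  show "c *\<^sub>R u \<in> H10 \<Omega>" for c
    unfolding H10_iff
  proof (intro conjI exI allI)
    show "(\<lambda>n. H1.N (c *\<^sub>R u - c *\<^sub>R \<phi> n)) \<longlonglongrightarrow> 0"
      unfolding scaleR_diff_right[symmetric] H1.N_scale[OF Hs_1_intros(3)[OF u \<phi>1]]
      by (rule tendsto_mult_right_zero[OF limu])
  qed (intro Hs_1_intros u test_scale \<phi>)+
  fix v assume "v \<in> H10 \<Omega>"
  then obtain \<psi> where v: "v \<in> Hs 1 \<Omega>" and \<psi>: "\<And>n. \<psi> n \<in> test_functions \<Omega>"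
    and limv: "(\<lambda>n. H1.N (v - \<psi> n)) \<longlonglongrightarrow> 0"
    unfolding H10_iff by blast
  note \<psi>1 = test_Hs_1[OF \<psi>]
  show "u + v \<in> H10 \<Omega>"
    unfolding H10_iff
  proof (intro conjI exI allI)
    have "H1.N (u + v - (\<phi> n + \<psi> n)) \<le> H1.N (u - \<phi> n) + H1.N (v - \<psi> n)" for n
      using H1.N_triangle[OF Hs_1_intros(3)[OF u \<phi>1] Hs_1_intros(3)[OF v \<psi>1], of n n]
      by (simp add: algebra_simps)
    then show "(\<lambda>n. H1.N (u + v - (\<phi> n + \<psi> n))) \<longlonglongrightarrow> 0"
      by (intro tendsto_sandwich[OF _ _ tendsto_const tendsto_add_zero[OF limu limv]])
         (auto intro!: always_eventually H1.N_nonneg Hs_1_intros u v \<phi>1 \<psi>1)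
  qed (intro Hs_1_intros u v test_add \<phi> \<psi>)+
qed

lemma H10_intros:
  "u \<in> H10 \<Omega> \<Longrightarrow> v \<in> H10 \<Omega> \<Longrightarrow> u + v \<in> H10 \<Omega>" "u \<in> H10 \<Omega> \<Longrightarrow> c *\<^sub>R u \<in> H10 \<Omega>"
  "u \<in> H10 \<Omega> \<Longrightarrow> v \<in> H10 \<Omega> \<Longrightarrow> u - v \<in> H10 \<Omega>"
  using subspace_H10 by (auto simp: subspace_add subspace_scale subspace_diff)

text \<open>Integrating \<open>\<partial>\<^sub>i (x\<^sub>i \<phi>\<^sup>2)\<close> gives \<open>(\<phi>, \<phi>) = - 2 (\<partial>\<^sub>i \<phi>, x\<^sub>i \<phi>)\<close>.\<close>

lemma Poincare_test:
  assumes R: "\<And>x. x \<in> \<Omega> \<Longrightarrow> norm x \<le> R" "0 \<le> R" and \<phi>: "\<phi> \<in> test_functions \<Omega>"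
  shows "L2_norm \<Omega> \<phi> \<le> 2 * R * L2_norm \<Omega> (grad \<Omega> \<phi>)"
proof -
  \<comment> \<open>One coordinate direction is enough, since the norm of one partial derivative is
    at most that of the gradient.\<close>
  fix i :: 'd
  define \<psi> where "\<psi> x = x $ i * \<phi> x" for x
  have \<psi>: "\<psi> \<in> test_functions \<Omega>"
    unfolding \<psi>_def by (intro test_mult \<phi> Ck_coordinate)
  let ?d = "pderiv_at i \<phi>"
  have d: "?d \<in> test_functions \<Omega>" by (rule pderiv_at_test[OF \<phi>])
  have xd: "(\<lambda>x. x $ i * ?d x) \<in> test_functions \<Omega>" by (intro test_mult d Ck_coordinate)
  note L2s = test_L2[OF \<phi>] test_L2[OF \<psi>] test_L2[OF d] test_L2[OF xd]
  have "((\<lambda>x::real^'d. x $ i) has_derivative (\<lambda>v. v $ i)) (at x)" for x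
    by (intro bounded_linear_imp_has_derivative bounded_linear_vec_nth)
  note D = this
  have coord: "(\<lambda>x::real^'d. x $ i) differentiable (at x)" "pderiv_at i (\<lambda>x::real^'d. x $ i) x = 1" for x
    using D[of x] has_derivative_imp_pderiv_at[OF D] by (auto simp: differentiable_def)
  have "pderiv_at i \<psi> = (\<lambda>x. x $ i * ?d x) + \<phi>"
    unfolding \<psi>_def using pderiv_at_mult[OF coord(1) test_differentiable[OF \<phi>], where i = i]
    by (simp add: fun_eq_iff coord)
  then have "L2_inner \<Omega> \<phi> (pderiv_at i \<psi>) = L2_inner \<Omega> \<phi> (\<lambda>x. x $ i * ?d x) + L2_inner \<Omega> \<phi> \<phi>"
    by (simp add: L2.B_add2 L2s)
  moreover have "L2_inner \<Omega> \<phi> (\<lambda>x. x $ i * ?d x) = L2_inner \<Omega> ?d \<psi>"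
    by (simp add: L2_inner_def \<psi>_def mult_ac)
  moreover have "L2_inner \<Omega> \<phi> (pderiv_at i \<psi>) = - L2_inner \<Omega> ?d \<psi>"
    using test_has_weak_pderiv[OF \<phi>, of i] \<psi> by (simp add: has_weak_pderiv_def)
  ultimately have "(L2_norm \<Omega> \<phi>)\<^sup>2 = - 2 * L2_inner \<Omega> ?d \<psi>"
    by (simp add: L2.N_power2 L2s)
  also have "\<dots> \<le> 2 * (L2_norm \<Omega> ?d * L2_norm \<Omega> \<psi>)"
    using L2.Cauchy_Schwarz[OF L2s(3) L2s(2)] by linarith
  also have "L2_norm \<Omega> \<psi> \<le> R * L2_norm \<Omega> \<phi>"
  proof -
    have "(L2_norm \<Omega> \<psi>)\<^sup>2 \<le> (LINT x|lebesgue_on \<Omega>. R\<^sup>2 * (norm (\<phi> x))\<^sup>2)"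
      unfolding L2_norm_power2[OF L2s(2)]
    proof (rule integral_mono)
      show "(norm (\<psi> x))\<^sup>2 \<le> R\<^sup>2 * (norm (\<phi> x))\<^sup>2" if "x \<in> space (lebesgue_on \<Omega>)" for x
      proof -
        have "\<bar>x $ i\<bar> \<le> R"
          using that R(1)[of x] component_le_norm_cart[of x i] by (simp add: space_restrict_space)
        then have "\<bar>x $ i\<bar>\<^sup>2 \<le> R\<^sup>2" by (intro power_mono) auto
        then show ?thesis by (simp add: \<psi>_def power_mult_distrib mult_right_mono)
      qed
    qed (intro L2_integrable L2s integrable_mult_right)+
    also have "\<dots> = (R * L2_norm \<Omega> \<phi>)\<^sup>2" by (simp add: power_mult_distrib L2_norm_power2[OF L2s(1)])
    finally show ?thesis by (rule power2_le_imp_le) (simp add: R L2.N_nonneg L2s)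
  qed
  finally have "(L2_norm \<Omega> \<phi>)\<^sup>2 \<le> 2 * (L2_norm \<Omega> ?d * (R * L2_norm \<Omega> \<phi>))"
    by (simp add: mult_left_mono L2.N_nonneg L2s)
  moreover have "2 * (b * (R * a)) = (2 * R * b) * a" for a b :: real by simp
  ultimately have "L2_norm \<Omega> \<phi> * L2_norm \<Omega> \<phi> \<le> (2 * R * L2_norm \<Omega> ?d) * L2_norm \<Omega> \<phi>"
    by (simp only: power2_eq_square)
  then have "L2_norm \<Omega> \<phi> \<le> 2 * R * L2_norm \<Omega> ?d"
    using L2.N_nonneg[OF L2s(1)] L2.N_nonneg[OF L2s(3)] R(2)
    by (cases "L2_norm \<Omega> \<phi> = 0") (auto simp: mult_le_cancel_right)
  also have "L2_norm \<Omega> ?d = L2_norm \<Omega> (\<lambda>x. cgrad \<phi> x $ i)" by (simp add: cgrad_def)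
  also have "\<dots> \<le> L2_norm \<Omega> (cgrad \<phi>)" by (rule L2_norm_component_le[OF cgrad_L2[OF \<phi>]])
  also have "\<dots> = L2_norm \<Omega> (grad \<Omega> \<phi>)"
    by (rule L2_norm_cong_AE[OF grad_L2[OF test_Hs_1[OF \<phi>]] cgrad_L2[OF \<phi>] grad_test_AE[OF \<phi>], symmetric])
  finally show ?thesis using R(2) by (simp add: mult_left_mono)
qed

lemma L2_norm_tendsto:
  fixes u :: "real^'d \<Rightarrow> 'b::euclidean_space"
  assumes "\<And>n. X n \<in> L2 \<Omega>" "u \<in> L2 \<Omega>" "(\<lambda>n. L2_norm \<Omega> (X n - u)) \<longlonglongrightarrow> 0"
  shows "(\<lambda>n. L2_norm \<Omega> (X n)) \<longlonglongrightarrow> L2_norm \<Omega> u"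
proof (rule LIM_zero_cancel, rule Lim_null_comparison[OF _ assms(3)])
  show "\<forall>\<^sub>F n in sequentially. norm (L2_norm \<Omega> (X n) - L2_norm \<Omega> u) \<le> L2_norm \<Omega> (X n - u)"
  proof (rule always_eventually, rule allI)
    fix n
    show "norm (L2_norm \<Omega> (X n) - L2_norm \<Omega> u) \<le> L2_norm \<Omega> (X n - u)"
      using L2.N_triangle[OF L2.V_diff[OF assms(1)[of n] assms(2)] assms(2)]
        L2.N_triangle[OF L2.V_diff[OF assms(2) assms(1)[of n]] assms(1)[of n]]
        L2.N_minus_commute[OF assms(1)[of n] assms(2)]
      by simp
  qed
qed

text \<open>A Poincare constant of the domain. It is fixed by choice so that later constants can
  refer to it without mentioning a radius.\<close>

definition CP :: real where
  "CP = (SOME C. 0 < C \<and> (\<forall>u\<in>H10 \<Omega>. L2_norm \<Omega> u \<le> C * L2_norm \<Omega> (grad \<Omega> u)))"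

text \<open>For test functions the constant is \<open>2 * R\<close> with \<open>R\<close> a bound
  for the domain. Both norms are continuous under the approximation that defines \<open>H10\<close>,
  so the inequality extends by density.\<close>

lemma CP: "0 < CP" "u \<in> H10 \<Omega> \<Longrightarrow> L2_norm \<Omega> u \<le> CP * L2_norm \<Omega> (grad \<Omega> u)"
proof -
  obtain R where R: "0 < R" "\<And>x. x \<in> \<Omega> \<Longrightarrow> norm x \<le> R"
    using bounded_dom by (auto simp: bounded_pos)
  have "L2_norm \<Omega> u \<le> 2 * R * L2_norm \<Omega> (grad \<Omega> u)" if u: "u \<in> H10 \<Omega>" for u
  proof -
    obtain \<phi> where \<phi>: "\<And>n. \<phi> n \<in> test_functions \<Omega>" "(\<lambda>n. L2_norm \<Omega> (\<phi> n - u)) \<longlonglongrightarrow> 0"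
      "(\<lambda>n. L2_norm \<Omega> (grad \<Omega> (\<phi> n) - grad \<Omega> u)) \<longlonglongrightarrow> 0"
      using H10_approx[OF u] by metis
    have 1: "(\<lambda>n. L2_norm \<Omega> (\<phi> n)) \<longlonglongrightarrow> L2_norm \<Omega> u"
      by (intro L2_norm_tendsto test_L2 H10_L2 u \<phi>)
    have 2: "(\<lambda>n. 2 * R * L2_norm \<Omega> (grad \<Omega> (\<phi> n))) \<longlonglongrightarrow> 2 * R * L2_norm \<Omega> (grad \<Omega> u)"
      by (intro tendsto_mult tendsto_const L2_norm_tendsto grad_L2 test_Hs_1 H10_grad_L2 u \<phi>)
    have "L2_norm \<Omega> (\<phi> n) \<le> 2 * R * L2_norm \<Omega> (grad \<Omega> (\<phi> n))" for n
      by (rule Poincare_test[OF R(2) less_imp_le[OF R(1)] \<phi>(1)])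
    then show ?thesis by (intro tendsto_le[OF _ 2 1]) auto
  qed
  then have "\<exists>C. 0 < C \<and> (\<forall>u\<in>H10 \<Omega>. L2_norm \<Omega> u \<le> C * L2_norm \<Omega> (grad \<Omega> u))"
    using R(1) by (intro exI[of _ "2 * R"]) auto
  from someI_ex[OF this] show "0 < CP" "u \<in> H10 \<Omega> \<Longrightarrow> L2_norm \<Omega> u \<le> CP * L2_norm \<Omega> (grad \<Omega> u)"
    unfolding CP_def by blast+
qed

section \<open>The Dirichlet form, the Poisson problem and Green's formula\<close>

definition dirichlet :: "(real^'d \<Rightarrow> real) \<Rightarrow> (real^'d \<Rightarrow> real) \<Rightarrow> real" where
  "dirichlet u v = L2_inner \<Omega> (grad \<Omega> u) (grad \<Omega> v)"

sublocale D: semi_inner "H10 \<Omega>" dirichlet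
proof
  show "dirichlet u v = dirichlet v u" for u v
    by (simp add: dirichlet_def L2_inner_commute)
qed (auto simp: dirichlet_def subspace_H10 inner_grad_add inner_grad_scale
    H10_Hs_1 grad_L2 L2.B_nonneg)

lemma D_N: "D.N u = L2_norm \<Omega> (grad \<Omega> u)"
  by (simp add: D.N_def dirichlet_def L2_norm_def)

text \<open>By the Poincare inequality a Dirichlet--Cauchy sequence converges in L2 together with
  its gradients, and closedness of weak derivatives identifies the limit of the gradients. What
  remains is that the limit lies in \<open>H10\<close>.\<close>

lemma D_complete: "D.complete_space"
  unfolding D.complete_space_def
proof (intro allI impI, elim conjE)
  fix X :: "nat \<Rightarrow> real^'d \<Rightarrow> real"
  assume "range X \<subseteq> H10 \<Omega>" and Cauchy: "\<forall>e>0. \<exists>M. \<forall>m\<ge>M. \<forall>n\<ge>M. D.N (X m - X n) < e"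
  then have X: "X n \<in> H10 \<Omega>" for n by auto
  note X1 = H10_Hs_1[OF X]
  have "\<exists>M. \<forall>m\<ge>M. \<forall>n\<ge>M. L2_norm \<Omega> (X m - X n) < e" if "e > 0" for e
  proof -
    obtain M where M: "\<forall>m\<ge>M. \<forall>n\<ge>M. D.N (X m - X n) < e / CP"
      using Cauchy \<open>e > 0\<close> CP(1) by (meson divide_pos_pos)
    have "L2_norm \<Omega> (X m - X n) < e" if "m \<ge> M" "n \<ge> M" for m n
    proof -
      have "L2_norm \<Omega> (X m - X n) \<le> CP * D.N (X m - X n)"
        unfolding D_N by (intro CP(2) H10_intros X)
      also have "\<dots> < CP * (e / CP)" using M that CP(1) by (intro mult_strict_left_mono) auto
      finally show ?thesis using CP(1) by simp
    qed
    then show ?thesis by blast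
  qed
  moreover have "range X \<subseteq> L2 \<Omega>" using H10_L2[OF X] by auto
  ultimately obtain u where u: "u \<in> L2 \<Omega>" "(\<lambda>n. L2_norm \<Omega> (X n - u)) \<longlonglongrightarrow> 0"
    using L2_complete[OF lmeasurable_dom] unfolding L2.complete_space_def by metis
  have "\<forall>e>0. \<exists>M. \<forall>m\<ge>M. \<forall>n\<ge>M. L2_norm \<Omega> (grad \<Omega> (X m) - grad \<Omega> (X n)) < e"
    using Cauchy unfolding D_N L2_norm_grad_diff[OF X1 X1] .
  moreover have "range (\<lambda>n. grad \<Omega> (X n)) \<subseteq> L2 \<Omega>" using grad_L2[OF X1] by auto
  ultimately obtain g where g: "g \<in> L2 \<Omega>" "(\<lambda>n. L2_norm \<Omega> (grad \<Omega> (X n) - g)) \<longlonglongrightarrow> 0"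
    using L2_complete[OF lmeasurable_dom] unfolding L2.complete_space_def by metis
  have weak: "has_weak_pderiv \<Omega> i u (\<lambda>x. g x $ i)" for i
  proof (rule has_weak_pderiv_closed[OF weak_pderiv_works[OF X1] u(1) _ u(2)])
    show "(\<lambda>x. g x $ i) \<in> L2 \<Omega>" using g(1) L2_vec_iff by blast
    have wp: "weak_pderiv \<Omega> i (X n) \<in> L2 \<Omega>" for n
      by (rule has_weak_pderiv_L2(2)[OF weak_pderiv_works[OF X1]])
    have le: "L2_norm \<Omega> (weak_pderiv \<Omega> i (X n) - (\<lambda>x. g x $ i)) \<le> L2_norm \<Omega> (grad \<Omega> (X n) - g)" for n
      using L2_norm_component_le[OF L2.V_diff[OF grad_L2[OF X1] g(1)], of n i]
      by (simp add: grad_def fun_diff_def)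
    show "(\<lambda>n. L2_norm \<Omega> (weak_pderiv \<Omega> i (X n) - (\<lambda>x. g x $ i))) \<longlonglongrightarrow> 0"
      by (rule tendsto_sandwich[OF _ _ tendsto_const g(2)])
         (auto intro!: always_eventually le L2.N_nonneg L2.V_diff wp \<open>(\<lambda>x. g x $ i) \<in> L2 \<Omega>\<close>)
  qed
  have u1: "u \<in> Hs 1 \<Omega>" by (rule Hs_1I[OF weak])
  have gu: "AE x in lebesgue_on \<Omega>. grad \<Omega> u x = g x"
    using grad_AE[OF weak] by simp
  have "L2_norm \<Omega> (grad \<Omega> (X n) - g) = L2_norm \<Omega> (grad \<Omega> (X n - u))" for n
    unfolding L2_norm_grad_diff[OF X1 u1]
    by (rule L2_norm_cong_AE) (use gu in \<open>auto intro!: L2.V_diff grad_L2 X1 u1 g(1) elim: eventually_mono\<close>)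
  then have lim: "(\<lambda>n. L2_norm \<Omega> (grad \<Omega> (X n - u))) \<longlonglongrightarrow> 0" using g(2) by simp
  have limN: "(\<lambda>n. H1.N (X n - u)) \<longlonglongrightarrow> 0"
    by (rule tendsto_sandwich[OF _ _ tendsto_const tendsto_add_zero[OF u(2) lim]])
       (auto intro!: always_eventually H1_N_le H1.N_nonneg Hs_1_intros X1 u1)
  \<comment> \<open>A diagonal choice: each \<open>X n\<close> is replaced by a test function closer
    than \<open>inverse (real (Suc n))\<close>, and these converge to \<open>u\<close> as
    well.\<close>
  have "\<exists>\<phi>\<in>test_functions \<Omega>. H1.N (X n - \<phi>) < inverse (real (Suc n))" for n
  proof -
    obtain \<phi> where "\<And>k. \<phi> k \<in> test_functions \<Omega>" "(\<lambda>k. H1.N (X n - \<phi> k)) \<longlonglongrightarrow> 0"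
      using X[of n] unfolding H10_iff by blast
    moreover from this(2) have "\<forall>\<^sub>F k in sequentially. H1.N (X n - \<phi> k) < inverse (real (Suc n))"
      by (rule order_tendstoD) simp
    then obtain k where "H1.N (X n - \<phi> k) < inverse (real (Suc n))"
      by (auto simp: eventually_sequentially)
    ultimately show ?thesis by blast
  qed
  then obtain \<phi> where \<phi>: "\<And>n. \<phi> n \<in> test_functions \<Omega>" "\<And>n. H1.N (X n - \<phi> n) < inverse (real (Suc n))"
    by metis
  note \<phi>1 = test_Hs_1[OF \<phi>(1)]
  have "H1.N (u - \<phi> n) \<le> H1.N (X n - u) + inverse (real (Suc n))" for n
    using H1.N_triangle[OF Hs_1_intros(3)[OF u1 X1] Hs_1_intros(3)[OF X1 \<phi>1], of n n n]
      H1.N_minus_commute[OF u1 X1, of n] \<phi>(2)[of n] by simp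
  then have "(\<lambda>n. H1.N (u - \<phi> n)) \<longlonglongrightarrow> 0"
    by (intro tendsto_sandwich[OF _ _ tendsto_const tendsto_add_zero[OF limN LIMSEQ_inverse_real_of_nat]])
       (auto intro!: always_eventually H1.N_nonneg Hs_1_intros u1 \<phi>1)
  then have "u \<in> H10 \<Omega>" using u1 \<phi>(1) unfolding H10_iff by blast
  then show "\<exists>x\<in>H10 \<Omega>. (\<lambda>n. D.N (X n - x)) \<longlonglongrightarrow> 0" using lim unfolding D_N by blast
qed

text \<open>The Riesz representation for the Dirichlet form; the Poincare inequality bounds the
  functional given by \<open>f\<close>.\<close>

lemma poisson_solution_exists:
  assumes f: "f \<in> L2 \<Omega>"
  shows "\<exists>u. poisson_solution \<Omega> f u"
proof -
  have "\<exists>u\<in>H10 \<Omega>. \<forall>v\<in>H10 \<Omega>. dirichlet u v = L2_inner \<Omega> f v"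
  proof (rule D.Riesz_representation[OF D_complete])
    fix v assume v: "v \<in> H10 \<Omega>"
    have "\<bar>L2_inner \<Omega> f v\<bar> \<le> L2_norm \<Omega> f * L2_norm \<Omega> v"
      by (intro L2.Cauchy_Schwarz f H10_L2 v)
    also have "\<dots> \<le> L2_norm \<Omega> f * (CP * D.N v)"
      unfolding D_N by (intro mult_left_mono CP v L2.N_nonneg f)
    finally show "\<bar>L2_inner \<Omega> f v\<bar> \<le> (L2_norm \<Omega> f * CP) * D.N v" by (simp add: mult.assoc)
  qed (simp_all add: L2.B_add2 L2.B_scale2 f H10_L2)
  then show ?thesis unfolding poisson_solution_def dirichlet_def by blast
qed

text \<open>Green's formula. For test functions it is the definition of the weak divergence; density
  gives it on \<open>H10\<close>, and no boundary term can arise.\<close>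

lemma inner_grad_H10_Hdiv:
  assumes p: "p \<in> H10 \<Omega>" and \<xi>: "\<xi> \<in> Hdiv \<Omega>"
  shows "L2_inner \<Omega> (grad \<Omega> p) \<xi> = - L2_inner \<Omega> p (wdiv \<Omega> \<xi>)"
proof -
  obtain \<phi> where \<phi>: "\<And>n. \<phi> n \<in> test_functions \<Omega>" "(\<lambda>n. L2_norm \<Omega> (\<phi> n - p)) \<longlonglongrightarrow> 0"
    "(\<lambda>n. L2_norm \<Omega> (grad \<Omega> (\<phi> n) - grad \<Omega> p)) \<longlonglongrightarrow> 0"
    using H10_approx[OF p] by metis
  have 1: "(\<lambda>n. L2_inner \<Omega> (grad \<Omega> (\<phi> n)) \<xi>) \<longlonglongrightarrow> L2_inner \<Omega> (grad \<Omega> p) \<xi>"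
    by (rule L2.tendsto_B[OF _ _ _ \<phi>(3)]) (auto intro: grad_L2 test_Hs_1 \<phi>(1) H10_grad_L2 p Hdiv_L2 \<xi>)
  have 2: "(\<lambda>n. L2_inner \<Omega> (\<phi> n) (wdiv \<Omega> \<xi>)) \<longlonglongrightarrow> L2_inner \<Omega> p (wdiv \<Omega> \<xi>)"
    by (rule L2.tendsto_B[OF _ _ _ \<phi>(2)]) (auto intro: test_L2 \<phi>(1) H10_L2 p wdiv_L2 \<xi>)
  have "L2_inner \<Omega> (grad \<Omega> (\<phi> n)) \<xi> = - L2_inner \<Omega> (\<phi> n) (wdiv \<Omega> \<xi>)" for n
  proof -
    have "L2_inner \<Omega> (grad \<Omega> (\<phi> n)) \<xi> = L2_inner \<Omega> (cgrad (\<phi> n)) \<xi>"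
      by (intro L2_inner_cong_AE grad_test_AE grad_L2 test_Hs_1 cgrad_L2 Hdiv_L2 \<xi> \<phi>(1)) auto
    also have "\<dots> = - L2_inner \<Omega> (\<phi> n) (wdiv \<Omega> \<xi>)"
      using has_weak_div_wdiv[OF \<xi>] \<phi>(1) by (simp add: has_weak_div_def L2_inner_commute)
    finally show ?thesis .
  qed
  then show ?thesis using LIMSEQ_unique[OF 1] tendsto_minus[OF 2] by simp
qed

lemma has_weak_divI:
  assumes "\<tau> \<in> L2 \<Omega>" "w \<in> L2 \<Omega>"
    and "\<And>q. q \<in> H10 \<Omega> \<Longrightarrow> L2_inner \<Omega> \<tau> (grad \<Omega> q) = - L2_inner \<Omega> w q"
  shows "has_weak_div \<Omega> \<tau> w"
  unfolding has_weak_div_def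
proof (intro conjI ballI assms(1,2))
  fix \<phi> assume \<phi>: "\<phi> \<in> test_functions \<Omega>"
  have "L2_inner \<Omega> \<tau> (cgrad \<phi>) = L2_inner \<Omega> \<tau> (grad \<Omega> \<phi>)"
    using grad_test_AE[OF \<phi>]
    by (intro L2_inner_cong_AE assms(1) cgrad_L2 grad_L2 test_Hs_1 \<phi>) (auto elim: eventually_mono)
  then show "L2_inner \<Omega> \<tau> (cgrad \<phi>) = - L2_inner \<Omega> w \<phi>"
    using assms(3)[OF test_H10[OF \<phi>]] by simp
qed

end

section \<open>The first-order system\<close>

context bounded_domain
begin

text \<open>The sum of the two left-hand sides of the system: the terms without divergences collapse
  into the first inner product. Pairs are used so that the product space is itself a vector
  space.\<close>

definition energy ::
  "(real^'d \<Rightarrow> real^'d) \<times> (real^'d \<Rightarrow> real) \<Rightarrow> (real^'d \<Rightarrow> real^'d) \<times> (real^'d \<Rightarrow> real) \<Rightarrow> real" where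
  "energy v w = L2_inner \<Omega> (fst v - grad \<Omega> (snd v)) (fst w - grad \<Omega> (snd w))
     + L2_inner \<Omega> (wdiv \<Omega> (fst v)) (wdiv \<Omega> (fst w))"

lemma flux_L2: "\<tau> \<in> Hdiv \<Omega> \<Longrightarrow> p \<in> H10 \<Omega> \<Longrightarrow> \<tau> - grad \<Omega> p \<in> L2 \<Omega>"
  by (intro L2.V_diff Hdiv_L2 H10_grad_L2)

lemma inner_flux_add:
  assumes "\<tau> \<in> Hdiv \<Omega>" "\<tau>' \<in> Hdiv \<Omega>" "p \<in> H10 \<Omega>" "p' \<in> H10 \<Omega>" "\<eta> \<in> L2 \<Omega>"
  shows "L2_inner \<Omega> (\<tau> + \<tau>' - grad \<Omega> (p + p')) \<eta>
    = L2_inner \<Omega> (\<tau> - grad \<Omega> p) \<eta> + L2_inner \<Omega> (\<tau>' - grad \<Omega> p') \<eta>"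
  using assms
  by (simp add: L2.B_diff L2.B_add L2.V_add inner_grad_add Hdiv_L2 H10_grad_L2 H10_Hs_1 H10_intros)

lemma inner_flux_scale:
  assumes "\<tau> \<in> Hdiv \<Omega>" "p \<in> H10 \<Omega>" "\<eta> \<in> L2 \<Omega>"
  shows "L2_inner \<Omega> (c *\<^sub>R \<tau> - grad \<Omega> (c *\<^sub>R p)) \<eta> = c * L2_inner \<Omega> (\<tau> - grad \<Omega> p) \<eta>"
  using assms
  by (simp add: L2.B_diff L2.B_scale L2.V_scale inner_grad_scale Hdiv_L2 H10_grad_L2 H10_Hs_1 H10_intros
      right_diff_distrib)

sublocale E: semi_inner "Hdiv \<Omega> \<times> H10 \<Omega>" energy
proof
  show "subspace (Hdiv \<Omega> \<times> H10 \<Omega>)"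
    by (intro subspace_Times subspace_Hdiv subspace_H10)
  show "energy v w = energy w v" for v w
    by (simp add: energy_def L2_inner_commute)
  show "0 \<le> energy v v" if "v \<in> Hdiv \<Omega> \<times> H10 \<Omega>" for v
    using that by (auto simp: energy_def intro!: add_nonneg_nonneg L2.B_nonneg flux_L2 wdiv_L2)
  show "energy (u + v) w = energy u w + energy v w"
    if "u \<in> Hdiv \<Omega> \<times> H10 \<Omega>" "v \<in> Hdiv \<Omega> \<times> H10 \<Omega>" "w \<in> Hdiv \<Omega> \<times> H10 \<Omega>" for u v w
    using that by (auto simp: energy_def inner_flux_add inner_wdiv_add flux_L2 wdiv_L2)
  show "energy (c *\<^sub>R v) w = c * energy v w"
    if "v \<in> Hdiv \<Omega> \<times> H10 \<Omega>" "w \<in> Hdiv \<Omega> \<times> H10 \<Omega>" for c v w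
    using that by (auto simp: energy_def inner_flux_scale inner_wdiv_scale flux_L2 wdiv_L2 distrib_left)
qed

lemma E_N:
  assumes "\<tau> \<in> Hdiv \<Omega>" "p \<in> H10 \<Omega>"
  shows "E.N (\<tau>, p) = sqrt ((L2_norm \<Omega> (\<tau> - grad \<Omega> p))\<^sup>2 + (L2_norm \<Omega> (wdiv \<Omega> \<tau>))\<^sup>2)"
  using assms by (simp add: E.N_def energy_def L2.N_power2 flux_L2 wdiv_L2)

text \<open>Coercivity in the second component. Writing \<open>grad \<Omega> p\<close> as
  \<open>\<tau>\<close> minus the flux, Green's formula turns
  \<open>(\<tau>, grad \<Omega> p)\<close> into \<open>- (p, wdiv \<Omega> \<tau>)\<close>, the
  Poincare inequality absorbs \<open>p\<close>, and one factor \<open>g\<close> is divided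
  out.\<close>

lemma grad_le_energy:
  assumes \<tau>: "\<tau> \<in> Hdiv \<Omega>" and p: "p \<in> H10 \<Omega>"
  shows "L2_norm \<Omega> (grad \<Omega> p) \<le> (1 + CP) * E.N (\<tau>, p)"
proof -
  note L2s = flux_L2[OF \<tau> p] wdiv_L2[OF \<tau>] H10_grad_L2[OF p] H10_L2[OF p] Hdiv_L2[OF \<tau>]
  define g where "g = L2_norm \<Omega> (grad \<Omega> p)"
  have g0: "0 \<le> g" unfolding g_def by (rule L2.N_nonneg[OF L2s(3)])
  have a: "L2_norm \<Omega> (\<tau> - grad \<Omega> p) \<le> E.N (\<tau>, p)" and b: "L2_norm \<Omega> (wdiv \<Omega> \<tau>) \<le> E.N (\<tau>, p)"
    unfolding E_N[OF \<tau> p] by (rule real_le_rsqrt, simp)+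
  have "g\<^sup>2 = L2_inner \<Omega> \<tau> (grad \<Omega> p) - L2_inner \<Omega> (\<tau> - grad \<Omega> p) (grad \<Omega> p)"
    using L2s by (simp add: g_def L2.N_power2 L2.B_diff)
  also have "L2_inner \<Omega> \<tau> (grad \<Omega> p) = - L2_inner \<Omega> p (wdiv \<Omega> \<tau>)"
    using inner_grad_H10_Hdiv[OF p \<tau>] by (simp add: L2_inner_commute)
  also have "- L2_inner \<Omega> p (wdiv \<Omega> \<tau>) - L2_inner \<Omega> (\<tau> - grad \<Omega> p) (grad \<Omega> p)
      \<le> L2_norm \<Omega> p * L2_norm \<Omega> (wdiv \<Omega> \<tau>) + L2_norm \<Omega> (\<tau> - grad \<Omega> p) * g"
    using L2.Cauchy_Schwarz[OF L2s(4) L2s(2)] L2.Cauchy_Schwarz[OF L2s(1) L2s(3)]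
    unfolding g_def by linarith
  also have "\<dots> \<le> (CP * g) * E.N (\<tau>, p) + E.N (\<tau>, p) * g"
    using CP(2)[OF p] CP(1) g0 E.N_nonneg[of "(\<tau>, p)"] \<tau> p unfolding g_def[symmetric]
    by (intro add_mono mult_mono a b L2.N_nonneg L2s) auto
  finally have "g * g \<le> ((1 + CP) * E.N (\<tau>, p)) * g"
    by (simp add: power2_eq_square algebra_simps)
  moreover have "0 \<le> (1 + CP) * E.N (\<tau>, p)" using CP(1) E.N_nonneg[of "(\<tau>, p)"] \<tau> p by simp
  ultimately show ?thesis
    unfolding g_def[symmetric] using g0 by (cases "g = 0") (auto simp: mult_le_cancel_right)
qed

text \<open>The Poincare constant times the coercivity constant: it passes from the energy norm
  through the gradient to the L2 norm of the second component.\<close>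

definition CE :: real where "CE = CP * (1 + CP)"

lemma CE_pos: "0 < CE"
  using CP(1) by (simp add: CE_def)

lemma L2_le_energy:
  assumes "v \<in> Hdiv \<Omega> \<times> H10 \<Omega>"
  shows "L2_norm \<Omega> (snd v) \<le> CE * E.N v"
proof -
  obtain \<tau> p where v: "v = (\<tau>, p)" "\<tau> \<in> Hdiv \<Omega>" "p \<in> H10 \<Omega>" using assms by auto
  have "L2_norm \<Omega> p \<le> CP * L2_norm \<Omega> (grad \<Omega> p)" by (rule CP(2)[OF v(3)])
  also have "\<dots> \<le> CP * ((1 + CP) * E.N (\<tau>, p))"
    using CP(1) by (intro mult_left_mono grad_le_energy v) auto
  finally show ?thesis by (simp add: v CE_def mult.assoc)
qed

text \<open>The factor 2 arises because \<open>Hdiv_norm\<close> is used once for the field and once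
  for its divergence.\<close>

lemma energy_le_norms:
  assumes \<tau>: "\<tau> \<in> Hdiv \<Omega>" and p: "p \<in> H10 \<Omega>"
  shows "E.N (\<tau>, p) \<le> 2 * Hdiv_norm \<Omega> \<tau> + Hs_norm 1 \<Omega> p"
proof -
  note L2s = flux_L2[OF \<tau> p] wdiv_L2[OF \<tau>] H10_grad_L2[OF p] Hdiv_L2[OF \<tau>]
  have "E.N (\<tau>, p) \<le> L2_norm \<Omega> (\<tau> - grad \<Omega> p) + L2_norm \<Omega> (wdiv \<Omega> \<tau>)"
    unfolding E_N[OF \<tau> p] by (intro sqrt_sum_squares_le_sum L2.N_nonneg L2s)
  also have "L2_norm \<Omega> (\<tau> - grad \<Omega> p) \<le> L2_norm \<Omega> \<tau> + L2_norm \<Omega> (grad \<Omega> p)"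
    by (intro L2.N_diff_le L2s)
  also have "L2_norm \<Omega> \<tau> \<le> Hdiv_norm \<Omega> \<tau>" unfolding Hdiv_norm_def by (rule real_le_rsqrt) simp
  also have "L2_norm \<Omega> (wdiv \<Omega> \<tau>) \<le> Hdiv_norm \<Omega> \<tau>" unfolding Hdiv_norm_def by (rule real_le_rsqrt) simp
  also have "L2_norm \<Omega> (grad \<Omega> p) \<le> Hs_norm 1 \<Omega> p"
    unfolding Hs_norm_1[OF H10_Hs_1[OF p]] by (rule real_le_rsqrt) simp
  finally show ?thesis by simp
qed

text \<open>The two equations are recovered from their sum by testing with pairs in which one
  component is zero.\<close>

lemma LLstar_solution_iff:
  assumes S: "subspace S" "S \<subseteq> Hdiv \<Omega>" and U: "subspace U" "U \<subseteq> H10 \<Omega>"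
  shows "LLstar_solution \<Omega> S U f \<tau> p \<longleftrightarrow>
    (\<tau>, p) \<in> S \<times> U \<and> (\<forall>w\<in>S \<times> U. energy (\<tau>, p) w = L2_inner \<Omega> f (snd w))"
proof (cases "\<tau> \<in> S \<and> p \<in> U")
  case True
  then have \<tau>: "\<tau> \<in> Hdiv \<Omega>" and p: "p \<in> H10 \<Omega>" using S U by auto
  have 0: "0 \<in> S" "0 \<in> U" using S U subspace_0 by auto
  define F where "F \<xi> = L2_inner \<Omega> \<tau> \<xi> + L2_inner \<Omega> (wdiv \<Omega> \<tau>) (wdiv \<Omega> \<xi>) - L2_inner \<Omega> (grad \<Omega> p) \<xi>" for \<xi>
  define G where "G q = - L2_inner \<Omega> \<tau> (grad \<Omega> q) + L2_inner \<Omega> (grad \<Omega> p) (grad \<Omega> q)" for q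
  have E: "energy (\<tau>, p) (\<xi>, q) = F \<xi> + G q" if "\<xi> \<in> Hdiv \<Omega>" "q \<in> H10 \<Omega>" for \<xi> q
    using that \<tau> p
    by (simp add: energy_def F_def G_def L2.B_diff L2.B_diff2 flux_L2 Hdiv_L2 H10_grad_L2)
  \<comment> \<open>\<open>wdiv \<Omega> 0\<close> is only some representative of zero, so this
    rests on homogeneity under the inner product rather than on evaluation; likewise for the
    gradient below.\<close>
  have F0: "F 0 = 0"
    using L2.B_scale2[of 0 \<Omega> \<tau> 0] L2.B_scale2[of 0 \<Omega> "grad \<Omega> p" 0]
      inner_wdiv_scale[of 0 "wdiv \<Omega> \<tau>" 0] \<tau> p subspace_0[OF subspace_Hdiv]
    by (simp add: F_def Hdiv_L2 H10_grad_L2 wdiv_L2 L2_inner_commute[of _ _ "wdiv \<Omega> 0"])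
  have G0: "G 0 = 0"
    using inner_grad_scale[of 0 \<tau> 0] inner_grad_scale[of 0 "grad \<Omega> p" 0] \<tau> p subspace_0[OF subspace_Hs_1]
    by (simp add: G_def Hdiv_L2 H10_grad_L2 L2_inner_commute[of _ _ "grad \<Omega> 0"])
  have f0: "L2_inner \<Omega> f 0 = 0" by (simp add: L2_inner_def)
  have "LLstar_solution \<Omega> S U f \<tau> p \<longleftrightarrow> (\<forall>\<xi>\<in>S. F \<xi> = 0) \<and> (\<forall>q\<in>U. G q = L2_inner \<Omega> f q)"
    using True by (simp add: LLstar_solution_def F_def G_def)
  also have "\<dots> \<longleftrightarrow> (\<forall>\<xi>\<in>S. \<forall>q\<in>U. F \<xi> + G q = L2_inner \<Omega> f q)"
    using 0 F0 G0 f0 by (metis add_cancel_left_left add_cancel_right_right)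
  also have "\<dots> \<longleftrightarrow> (\<forall>w\<in>S \<times> U. energy (\<tau>, p) w = L2_inner \<Omega> f (snd w))"
    using E S(2) U(2) by (auto simp: subset_iff)
  finally show ?thesis using True by simp
qed (auto simp: LLstar_solution_def)

text \<open>Covers the continuous and the discrete problem at once, so that linearity and
  boundedness of the solution operator are proved a single time.\<close>

definition solvable_pair :: "(real^'d \<Rightarrow> real^'d) set \<Rightarrow> (real^'d \<Rightarrow> real) set \<Rightarrow> bool" where
  "solvable_pair S U \<longleftrightarrow> subspace S \<and> S \<subseteq> Hdiv \<Omega> \<and> subspace U \<and> U \<subseteq> H10 \<Omega> \<and>
     (\<forall>f\<in>L2 \<Omega>. \<exists>\<tau> p. LLstar_solution \<Omega> S U f \<tau> p)"

lemma T_LLstar_h_solution: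
  assumes "solvable_pair S U" "f \<in> L2 \<Omega>"
  shows "\<exists>\<tau>. (\<tau>, T_LLstar_h \<Omega> S U f) \<in> S \<times> U \<and>
    (\<forall>w\<in>S \<times> U. energy (\<tau>, T_LLstar_h \<Omega> S U f) w = L2_inner \<Omega> f (snd w))"
proof -
  have "\<exists>p \<tau>. LLstar_solution \<Omega> S U f \<tau> p" using assms unfolding solvable_pair_def by blast
  then have "\<exists>\<tau>. LLstar_solution \<Omega> S U f \<tau> (T_LLstar_h \<Omega> S U f)"
    unfolding T_LLstar_h_def by (rule someI_ex)
  then obtain \<tau> where *: "LLstar_solution \<Omega> S U f \<tau> (T_LLstar_h \<Omega> S U f)" by blast
  have S: "subspace S" "S \<subseteq> Hdiv \<Omega>" and U: "subspace U" "U \<subseteq> H10 \<Omega>"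
    using assms(1) by (auto simp: solvable_pair_def)
  show ?thesis using * unfolding LLstar_solution_iff[OF S U] by blast
qed

lemma solvable_pair_sub:
  assumes "solvable_pair S U"
  shows "subspace (S \<times> U)" "S \<times> U \<subseteq> Hdiv \<Omega> \<times> H10 \<Omega>"
  using assms by (auto simp: solvable_pair_def subspace_Times)

lemma T_LLstar_h_H10: "solvable_pair S U \<Longrightarrow> f \<in> L2 \<Omega> \<Longrightarrow> T_LLstar_h \<Omega> S U f \<in> H10 \<Omega>"
  using T_LLstar_h_solution[of S U f] by (metis mem_Sigma_iff solvable_pair_def subsetD)

text \<open>Uniqueness of the second component modulo null sets, the part of the solution that the
  operators return.\<close>

lemma energy_orthogonal_self:
  assumes "v \<in> Hdiv \<Omega> \<times> H10 \<Omega>" "energy v v = 0"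
  shows "AE x in lebesgue_on \<Omega>. snd v x = 0"
proof -
  have "L2_norm \<Omega> (snd v) \<le> 0"
    using L2_le_energy[OF assms(1)] by (simp add: E.N_def assms(2))
  moreover have v: "snd v \<in> L2 \<Omega>" using assms(1) H10_L2 by auto
  ultimately have "L2_norm \<Omega> (snd v) = 0" by (intro antisym L2.N_nonneg)
  then show ?thesis using L2_norm_eq_0_iff[OF v] by blast
qed

text \<open>The chosen solution for \<open>f + g\<close> and the sum of the chosen solutions satisfy
  the same equations. Their difference \<open>e\<close> is an admissible test pair, hence has zero
  energy.\<close>

lemma T_LLstar_h_add:
  assumes SU: "solvable_pair S U" and f: "f \<in> L2 \<Omega>" and g: "g \<in> L2 \<Omega>"
  shows "AE x in lebesgue_on \<Omega>.
    T_LLstar_h \<Omega> S U (f + g) x = T_LLstar_h \<Omega> S U f x + T_LLstar_h \<Omega> S U g x"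
proof -
  let ?T = "T_LLstar_h \<Omega> S U"
  obtain \<tau> where \<tau>: "(\<tau>, ?T f) \<in> S \<times> U" "\<forall>w\<in>S \<times> U. energy (\<tau>, ?T f) w = L2_inner \<Omega> f (snd w)"
    using T_LLstar_h_solution[OF SU f] by blast
  obtain \<xi> where \<xi>: "(\<xi>, ?T g) \<in> S \<times> U" "\<forall>w\<in>S \<times> U. energy (\<xi>, ?T g) w = L2_inner \<Omega> g (snd w)"
    using T_LLstar_h_solution[OF SU g] by blast
  obtain \<zeta> where \<zeta>: "(\<zeta>, ?T (f + g)) \<in> S \<times> U"
    "\<forall>w\<in>S \<times> U. energy (\<zeta>, ?T (f + g)) w = L2_inner \<Omega> (f + g) (snd w)"
    using T_LLstar_h_solution[OF SU L2.V_add[OF f g]] by blast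
  note W = solvable_pair_sub[OF SU]
  define e where "e = (\<zeta>, ?T (f + g)) - ((\<tau>, ?T f) + (\<xi>, ?T g))"
  have e: "e \<in> S \<times> U" unfolding e_def by (intro subspace_diff subspace_add W(1) \<zeta>(1) \<tau>(1) \<xi>(1))
  have eV: "e \<in> Hdiv \<Omega> \<times> H10 \<Omega>" using e W(2) by blast
  have "snd e \<in> L2 \<Omega>" using eV H10_L2 by auto
  then have "energy e e = 0"
    using subsetD[OF W(2)] \<tau> \<xi> \<zeta> e f g eV
    by (subst e_def) (simp only: E.B_diff E.B_add E.V_add L2.B_add diff_self)
  then have "AE x in lebesgue_on \<Omega>. snd e x = 0" by (rule energy_orthogonal_self[OF eV])
  then show ?thesis by eventually_elim (simp add: e_def)
qed

lemma T_LLstar_h_scale: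
  assumes SU: "solvable_pair S U" and f: "f \<in> L2 \<Omega>"
  shows "AE x in lebesgue_on \<Omega>. T_LLstar_h \<Omega> S U (c *\<^sub>R f) x = c * T_LLstar_h \<Omega> S U f x"
proof -
  let ?T = "T_LLstar_h \<Omega> S U"
  obtain \<tau> where \<tau>: "(\<tau>, ?T f) \<in> S \<times> U" "\<forall>w\<in>S \<times> U. energy (\<tau>, ?T f) w = L2_inner \<Omega> f (snd w)"
    using T_LLstar_h_solution[OF SU f] by blast
  obtain \<zeta> where \<zeta>: "(\<zeta>, ?T (c *\<^sub>R f)) \<in> S \<times> U"
    "\<forall>w\<in>S \<times> U. energy (\<zeta>, ?T (c *\<^sub>R f)) w = L2_inner \<Omega> (c *\<^sub>R f) (snd w)"
    using T_LLstar_h_solution[OF SU L2.V_scale[OF f]] by blast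
  note W = solvable_pair_sub[OF SU]
  define e where "e = (\<zeta>, ?T (c *\<^sub>R f)) - c *\<^sub>R (\<tau>, ?T f)"
  have e: "e \<in> S \<times> U" unfolding e_def by (intro subspace_diff subspace_scale W(1) \<zeta>(1) \<tau>(1))
  have eV: "e \<in> Hdiv \<Omega> \<times> H10 \<Omega>" using e W(2) by blast
  have "snd e \<in> L2 \<Omega>" using eV H10_L2 by auto
  then have "energy e e = 0"
    using subsetD[OF W(2)] \<tau> \<zeta> e f eV
    by (subst e_def) (simp only: E.B_diff E.B_scale E.V_scale L2.B_scale diff_self)
  then have "AE x in lebesgue_on \<Omega>. snd e x = 0" by (rule energy_orthogonal_self[OF eV])
  then show ?thesis by eventually_elim (simp add: e_def)
qed

text \<open>Testing the solution with itself gives \<open>(E.N z)\<^sup>2 = (f, snd z)\<close>. One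
  factor \<open>CE\<close> bounds the right-hand side, the other returns from energy to L2; neither
  depends on the spaces.\<close>

lemma T_LLstar_h_bound:
  assumes SU: "solvable_pair S U" and f: "f \<in> L2 \<Omega>"
  shows "L2_norm \<Omega> (T_LLstar_h \<Omega> S U f) \<le> CE\<^sup>2 * L2_norm \<Omega> f"
proof -
  let ?T = "T_LLstar_h \<Omega> S U"
  obtain \<tau> where \<tau>: "(\<tau>, ?T f) \<in> S \<times> U" "\<forall>w\<in>S \<times> U. energy (\<tau>, ?T f) w = L2_inner \<Omega> f (snd w)"
    using T_LLstar_h_solution[OF SU f] by blast
  define z where "z = (\<tau>, ?T f)"
  have zV: "z \<in> Hdiv \<Omega> \<times> H10 \<Omega>" using \<tau>(1) solvable_pair_sub(2)[OF SU] by (auto simp: z_def)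
  have Tf: "?T f \<in> L2 \<Omega>" using zV H10_L2 by (auto simp: z_def)
  have "(E.N z)\<^sup>2 = L2_inner \<Omega> f (?T f)" using \<tau> by (simp add: E.N_power2[OF zV]) (simp add: z_def)
  also have "\<dots> \<le> L2_norm \<Omega> f * L2_norm \<Omega> (?T f)" using L2.Cauchy_Schwarz[OF f Tf] by linarith
  also have "\<dots> \<le> L2_norm \<Omega> f * (CE * E.N z)"
    using L2_le_energy[OF zV] by (intro mult_left_mono L2.N_nonneg f) (simp add: z_def)
  finally have "E.N z * E.N z \<le> (CE * L2_norm \<Omega> f) * E.N z" by (simp add: power2_eq_square algebra_simps)
  moreover have "0 \<le> CE * L2_norm \<Omega> f" using CE_pos L2.N_nonneg[OF f] by simp
  ultimately have "E.N z \<le> CE * L2_norm \<Omega> f"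
    using E.N_nonneg[OF zV] by (cases "E.N z = 0") (auto simp: mult_le_cancel_right)
  then have "CE * E.N z \<le> CE * (CE * L2_norm \<Omega> f)" using CE_pos by (intro mult_left_mono) auto
  then show ?thesis using L2_le_energy[OF zV] by (simp add: z_def power2_eq_square mult.assoc)
qed

text \<open>The second equation says \<open>div (\<nabla>p - \<chi>) = - f\<close>, the first that \<open>w = div \<chi>\<close> lies in \<open>H10\<close>
  with \<open>\<nabla>w = \<chi> - \<nabla>p\<close>; hence \<open>w\<close> and \<open>p\<close> solve the Poisson problems with data \<open>- f\<close> and \<open>f - w\<close>.\<close>

lemma LLstar_solution_of_poisson:
  assumes f: "f \<in> L2 \<Omega>" and w: "poisson_solution \<Omega> ((-1) *\<^sub>R f) w" and p: "poisson_solution \<Omega> (f - w) p"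
  shows "has_weak_div \<Omega> (grad \<Omega> w + grad \<Omega> p) w"
    and "LLstar_solution \<Omega> (Hdiv \<Omega>) (H10 \<Omega>) f (grad \<Omega> w + grad \<Omega> p) p"
proof -
  have wH: "w \<in> H10 \<Omega>" and pH: "p \<in> H10 \<Omega>" using w p by (auto simp: poisson_solution_def)
  note gL2 = H10_grad_L2[OF wH] H10_grad_L2[OF pH] H10_L2[OF wH]
  have weq: "L2_inner \<Omega> (grad \<Omega> w) (grad \<Omega> q) = - L2_inner \<Omega> f q" if "q \<in> H10 \<Omega>" for q
    using w that L2.B_scale[OF f H10_L2[OF that], of "-1"] by (simp add: poisson_solution_def)
  have peq: "L2_inner \<Omega> (grad \<Omega> p) (grad \<Omega> q) = L2_inner \<Omega> f q - L2_inner \<Omega> w q" if "q \<in> H10 \<Omega>" for q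
    using p that L2.B_diff[OF f gL2(3) H10_L2[OF that]] by (simp add: poisson_solution_def)
  let ?\<chi> = "grad \<Omega> w + grad \<Omega> p"
  \<comment> \<open>The data \<open>- f\<close> and \<open>f - w\<close> add up to
    \<open>- w\<close>, which is what makes \<open>w\<close> the divergence of the sum of the
    gradients.\<close>
  have \<chi>q: "L2_inner \<Omega> ?\<chi> (grad \<Omega> q) = - L2_inner \<Omega> w q" if "q \<in> H10 \<Omega>" for q
    using that by (simp add: L2.B_add gL2 H10_grad_L2 weq peq)
  show div: "has_weak_div \<Omega> ?\<chi> w"
    by (intro has_weak_divI L2.V_add gL2 \<chi>q)
  then have \<chi>: "?\<chi> \<in> Hdiv \<Omega>" by (auto simp: Hdiv_def)
  show "LLstar_solution \<Omega> (Hdiv \<Omega>) (H10 \<Omega>) f ?\<chi> p"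
    unfolding LLstar_solution_def
  proof (intro conjI ballI \<chi> pH)
    fix \<xi> assume \<xi>: "\<xi> \<in> Hdiv \<Omega>"
    have "L2_inner \<Omega> (wdiv \<Omega> ?\<chi>) (wdiv \<Omega> \<xi>) = L2_inner \<Omega> w (wdiv \<Omega> \<xi>)"
      using wdiv_L2[OF \<xi>] by (intro L2_inner_cong_AE[OF _ _ _ _ wdiv_AE[OF div]] wdiv_L2[OF \<chi>] gL2) auto
    \<comment> \<open>Green's formula for \<open>w\<close> cancels the divergence term against
      \<open>grad \<Omega> w\<close>.\<close>
    then show "L2_inner \<Omega> ?\<chi> \<xi> + L2_inner \<Omega> (wdiv \<Omega> ?\<chi>) (wdiv \<Omega> \<xi>) - L2_inner \<Omega> (grad \<Omega> p) \<xi> = 0"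
      using inner_grad_H10_Hdiv[OF wH \<xi>] by (simp add: L2.B_add gL2 Hdiv_L2[OF \<xi>])
  next
    fix q assume q: "q \<in> H10 \<Omega>"
    show "- L2_inner \<Omega> ?\<chi> (grad \<Omega> q) + L2_inner \<Omega> (grad \<Omega> p) (grad \<Omega> q) = L2_inner \<Omega> f q"
      by (simp add: \<chi>q[OF q] peq[OF q])
  qed
qed

lemma solvable_pair_Hdiv_H10: "solvable_pair (Hdiv \<Omega>) (H10 \<Omega>)"
  unfolding solvable_pair_def
proof (intro conjI subspace_Hdiv subspace_H10 order_refl ballI)
  fix f :: "real^'d \<Rightarrow> real" assume f: "f \<in> L2 \<Omega>"
  obtain w where w: "poisson_solution \<Omega> ((-1) *\<^sub>R f) w"
    using poisson_solution_exists[OF L2.V_scale[OF f]] by blast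
  have "w \<in> L2 \<Omega>" using w H10_L2 by (simp add: poisson_solution_def)
  then obtain p where "poisson_solution \<Omega> (f - w) p"
    using poisson_solution_exists[OF L2.V_diff[OF f]] by blast
  then show "\<exists>\<tau> p. LLstar_solution \<Omega> (Hdiv \<Omega>) (H10 \<Omega>) f \<tau> p"
    using LLstar_solution_of_poisson(2)[OF f w] by blast
qed

section \<open>Null functions, discrete solvability and quasi-optimality\<close>

lemma wdiv_null:
  assumes \<tau>: "\<tau> \<in> Hdiv \<Omega>" and null: "AE x in lebesgue_on \<Omega>. \<tau> x = 0"
  shows "AE x in lebesgue_on \<Omega>. wdiv \<Omega> \<tau> x = 0"
proof -
  have "has_weak_div \<Omega> \<tau> 0"
    unfolding has_weak_div_def
  proof (intro conjI ballI Hdiv_L2 \<tau> L2.V_0)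
    fix \<phi> assume \<phi>: "\<phi> \<in> test_functions \<Omega>"
    have "L2_inner \<Omega> \<tau> (cgrad \<phi>) = L2_inner \<Omega> 0 (cgrad \<phi>)"
      using null by (intro L2_inner_cong_AE Hdiv_L2 \<tau> L2.V_0 cgrad_L2 \<phi>) auto
    then show "L2_inner \<Omega> \<tau> (cgrad \<phi>) = - L2_inner \<Omega> 0 \<phi>" by (simp add: L2_inner_def)
  qed
  from wdiv_AE[OF this] show ?thesis by simp
qed

lemma grad_null:
  assumes u: "u \<in> Hs 1 \<Omega>" and null: "AE x in lebesgue_on \<Omega>. u x = 0"
  shows "AE x in lebesgue_on \<Omega>. grad \<Omega> u x = 0"
proof -
  have "has_weak_pderiv \<Omega> i u 0" for i
    by (rule has_weak_pderiv_cong[OF has_weak_pderiv_0 Hs_1_L2[OF u]]) (use null in \<open>eventually_elim, simp\<close>)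
  from grad_AE[OF this] show ?thesis by eventually_elim (simp add: vec_eq_iff)
qed

text \<open>Basis expansions in the finite dimensional spaces hold only almost everywhere. The
  remainder of such an expansion is thereby shown to be invisible to the energy form.\<close>

lemma energy_null:
  assumes "\<tau> \<in> Hdiv \<Omega>" "p \<in> H10 \<Omega>"
    and "AE x in lebesgue_on \<Omega>. \<tau> x = 0" "AE x in lebesgue_on \<Omega>. p x = 0"
  shows "energy (\<tau>, p) (\<tau>, p) = 0"
proof -
  have "AE x in lebesgue_on \<Omega>. (\<tau> - grad \<Omega> p) x = 0"
    using assms(3) grad_null[OF H10_Hs_1[OF assms(2)] assms(4)] by eventually_elim simp
  then have "L2_norm \<Omega> (\<tau> - grad \<Omega> p) = 0" by (simp only: L2_norm_eq_0_iff[OF flux_L2[OF assms(1,2)]])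
  moreover have "L2_norm \<Omega> (wdiv \<Omega> \<tau>) = 0"
    using wdiv_null[OF assms(1,3)] by (simp only: L2_norm_eq_0_iff[OF wdiv_L2[OF assms(1)]])
  ultimately show ?thesis by (simp add: energy_def L2_norm_def)
qed

end

lemma finite_dim_space_subspace: "finite_dim_space \<Omega> W \<Longrightarrow> subspace W"
  by (simp add: finite_dim_space_def subspace_def zero_fun_def plus_fun_def scaleR_fun_def)

lemma sum_scaleR_fun_apply: "(\<Sum>b\<in>B. c b *\<^sub>R b) x = (\<Sum>b\<in>B. c b *\<^sub>R b x)"
  by (induction B rule: infinite_finite_induct) auto

context bounded_domain
begin

text \<open>The discrete solution is the energy-orthogonal projection of the continuous one, so no
  linear system has to be solved.\<close>

lemma solvable_pair_finite_dim:
  assumes S: "S \<subseteq> Hdiv \<Omega>" "finite_dim_space \<Omega> S" and U: "U \<subseteq> H10 \<Omega>" "finite_dim_space \<Omega> U"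
  shows "solvable_pair S U"
proof -
  have subS: "subspace S" and subU: "subspace U" using S U finite_dim_space_subspace by blast+
  obtain A where A: "finite A" "A \<subseteq> S"
    "\<And>v. v \<in> S \<Longrightarrow> \<exists>c. AE x in lebesgue_on \<Omega>. v x = (\<Sum>b\<in>A. c b *\<^sub>R b x)"
    using S(2) by (auto simp: finite_dim_space_def)
  obtain B where B: "finite B" "B \<subseteq> U"
    "\<And>v. v \<in> U \<Longrightarrow> \<exists>c. AE x in lebesgue_on \<Omega>. v x = (\<Sum>b\<in>B. c b *\<^sub>R b x)"
    using U(2) by (auto simp: finite_dim_space_def)
  define G where "G = (\<lambda>b. (b, 0)) ` A \<union> (\<lambda>b. (0, b)) ` B"
  have G: "finite G" "G \<subseteq> S \<times> U"
    using A B subspace_0[OF subS] subspace_0[OF subU] by (auto simp: G_def)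
  have gen: "\<exists>x\<in>span G. energy (w - x) (w - x) = 0" if "w \<in> S \<times> U" for w
  proof -
    obtain \<xi> q where w: "w = (\<xi>, q)" "\<xi> \<in> S" "q \<in> U" using \<open>w \<in> S \<times> U\<close> by auto
    obtain c where c: "AE x in lebesgue_on \<Omega>. \<xi> x = (\<Sum>b\<in>A. c b *\<^sub>R b x)" using A(3)[OF w(2)] by blast
    obtain d where d: "AE x in lebesgue_on \<Omega>. q x = (\<Sum>b\<in>B. d b *\<^sub>R b x)" using B(3)[OF w(3)] by blast
    let ?\<xi> = "\<Sum>b\<in>A. c b *\<^sub>R b" and ?q = "\<Sum>b\<in>B. d b *\<^sub>R b"
    have in1: "(c b *\<^sub>R b, 0) \<in> span G" if "b \<in> A" for b
      using span_scale[OF span_base[of "(b, 0)" G], of "c b"] that by (auto simp: G_def)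
    have in2: "(0, d b *\<^sub>R b) \<in> span G" if "b \<in> B" for b
      using span_scale[OF span_base[of "(0, b)" G], of "d b"] that by (auto simp: G_def)
    have "(?\<xi>, ?q) = (\<Sum>b\<in>A. (c b *\<^sub>R b, 0)) + (\<Sum>b\<in>B. (0, d b *\<^sub>R b))"
      by (simp add: sum_prod)
    also have "\<dots> \<in> span G" by (intro span_add span_sum in1 in2)
    finally have span: "(?\<xi>, ?q) \<in> span G" .
    have xS: "?\<xi> \<in> S" by (intro subspace_sum subS subspace_scale) (use A in auto)
    have qU: "?q \<in> U" by (intro subspace_sum subU subspace_scale) (use B in auto)
    have "energy (\<xi> - ?\<xi>, q - ?q) (\<xi> - ?\<xi>, q - ?q) = 0"
    proof (rule energy_null)
      show "\<xi> - ?\<xi> \<in> Hdiv \<Omega>" "q - ?q \<in> H10 \<Omega>" using w xS qU S(1) U(1) by (auto intro: Hdiv_intros H10_intros)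
      show "AE x in lebesgue_on \<Omega>. (\<xi> - ?\<xi>) x = 0" using c by eventually_elim (simp add: sum_scaleR_fun_apply)
      show "AE x in lebesgue_on \<Omega>. (q - ?q) x = 0"
        using d by eventually_elim (simp add: sum_scaleR_fun_apply del: real_scaleR_def)
    qed
    then show ?thesis using span w(1) by force
  qed
  have "\<exists>\<tau> p. LLstar_solution \<Omega> S U f \<tau> p" if f: "f \<in> L2 \<Omega>" for f
  proof -
    obtain \<tau> where \<tau>: "(\<tau>, T_LLstar_h \<Omega> (Hdiv \<Omega>) (H10 \<Omega>) f) \<in> Hdiv \<Omega> \<times> H10 \<Omega>"
      "\<forall>w\<in>Hdiv \<Omega> \<times> H10 \<Omega>. energy (\<tau>, T_LLstar_h \<Omega> (Hdiv \<Omega>) (H10 \<Omega>) f) w = L2_inner \<Omega> f (snd w)"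
      using T_LLstar_h_solution[OF solvable_pair_Hdiv_H10 f] by blast
    have sub: "S \<times> U \<subseteq> Hdiv \<Omega> \<times> H10 \<Omega>" using S U by auto
    obtain z where z: "z \<in> S \<times> U"
      "\<forall>w\<in>S \<times> U. energy ((\<tau>, T_LLstar_h \<Omega> (Hdiv \<Omega>) (H10 \<Omega>) f) - z) w = 0"
      using E.projection_onto_finite_dim[OF subspace_Times[OF subS subU] sub G gen \<tau>(1)] by blast
    have "energy z w = L2_inner \<Omega> f (snd w)" if w: "w \<in> S \<times> U" for w
      using E.B_diff[OF \<tau>(1) subsetD[OF sub z(1)] subsetD[OF sub w]] bspec[OF z(2) w]
        bspec[OF \<tau>(2) subsetD[OF sub w]] by simp
    then show ?thesis
      using z(1) LLstar_solution_iff[OF subS S(1) subU U(1), of f "fst z" "snd z"] by auto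
  qed
  then show ?thesis using subS S(1) subU U(1) by (simp add: solvable_pair_def)
qed

text \<open>Galerkin orthogonality removes \<open>v - zh\<close> from one argument of the form, and
  Cauchy--Schwarz finishes. In the energy norm the constant is 1.\<close>

lemma Cea:
  assumes W: "W \<subseteq> Hdiv \<Omega> \<times> H10 \<Omega>" "subspace W"
    and z: "z \<in> Hdiv \<Omega> \<times> H10 \<Omega>" "\<And>w. w \<in> W \<Longrightarrow> energy z w = l w"
    and zh: "zh \<in> W" "\<And>w. w \<in> W \<Longrightarrow> energy zh w = l w" and v: "v \<in> W"
  shows "E.N (z - zh) \<le> E.N (z - v)"
proof -
  have V: "zh \<in> Hdiv \<Omega> \<times> H10 \<Omega>" "v \<in> Hdiv \<Omega> \<times> H10 \<Omega>" using W zh v by auto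
  have d: "z - zh \<in> Hdiv \<Omega> \<times> H10 \<Omega>" "z - v \<in> Hdiv \<Omega> \<times> H10 \<Omega>" by (intro E.V_diff z V)+
  have vz: "v - zh \<in> W" by (intro subspace_diff W v zh)
  then have "energy (z - zh) (v - zh) = 0"
    using E.B_diff[OF z(1) V(1) subsetD[OF W(1) vz]] z(2)[OF vz] zh(2)[OF vz] by simp
  moreover have "energy (z - zh) (z - zh) = energy (z - zh) (z - v) + energy (z - zh) (v - zh)"
    using E.B_add2[OF d(2) subsetD[OF W(1) vz] d(1)] by simp
  ultimately have "E.N (z - zh) * E.N (z - zh) = energy (z - zh) (z - v)"
    using E.N_power2[OF d(1)] by (simp add: power2_eq_square)
  also have "\<dots> \<le> E.N (z - v) * E.N (z - zh)" using E.Cauchy_Schwarz[OF d] by (simp add: mult.commute)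
  finally show ?thesis
    using E.N_nonneg[OF d(1)] E.N_nonneg[OF d(2)] by (cases "E.N (z - zh) = 0") (auto simp: mult_le_cancel_right)
qed

end

section \<open>Regularity and convergence\<close>

context bounded_domain
begin

text \<open>The integrand for \<open>u + v\<close> is pointwise at most twice the sum of the two
  integrands. Finiteness is all that is at stake, so this crude bound replaces a triangle
  inequality.\<close>

lemma gagliardo_add_finite:
  assumes u: "u \<in> L2 \<Omega>" and v: "v \<in> L2 \<Omega>"
    and fin: "gagliardo \<theta> \<Omega> u < \<infinity>" "gagliardo \<theta> \<Omega> v < \<infinity>"
  shows "gagliardo \<theta> \<Omega> (u + v) < \<infinity>"
proof -
  let ?M = "lebesgue_on \<Omega>"
  have um [measurable]: "u \<in> borel_measurable ?M" and vm [measurable]: "v \<in> borel_measurable ?M"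
    using u v L2_measurable by blast+
  have im [measurable]: "(\<lambda>x. x) \<in> borel_measurable ?M"
    by (rule continuous_imp_measurable_lebesgue_on[OF continuous_on_id])
  define k where "k w x y = ennreal ((w x - w y)\<^sup>2 / norm (x - y) powr (real CARD('d) + 2 * \<theta>))"
    for w :: "real^'d \<Rightarrow> real" and x y
  have km [measurable]: "case_prod (k w) \<in> borel_measurable (?M \<Otimes>\<^sub>M ?M)"
    if [measurable]: "w \<in> borel_measurable ?M" for w
    unfolding k_def by measurable
  have k1 [measurable]: "k w x \<in> borel_measurable ?M"
    if [measurable]: "w \<in> borel_measurable ?M" for w x
    unfolding k_def by measurable
  have k2 [measurable]: "(\<lambda>x. \<integral>\<^sup>+y. k w x y \<partial>?M) \<in> borel_measurable ?M"
    if "w \<in> borel_measurable ?M" for w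
    by (rule M.borel_measurable_nn_integral[OF km[OF that]])
  have le: "k (u + v) x y \<le> 2 * k u x y + 2 * k v x y" for x y
  proof -
    let ?n = "norm (x - y) powr (real CARD('d) + 2 * \<theta>)"
    have "((u + v) x - (u + v) y)\<^sup>2 \<le> 2 * (u x - u y)\<^sup>2 + 2 * (v x - v y)\<^sup>2"
      using norm_add_power2_le[of "u x - u y" "v x - v y"] by (simp add: algebra_simps)
    then have "((u + v) x - (u + v) y)\<^sup>2 / ?n \<le> (2 * (u x - u y)\<^sup>2 + 2 * (v x - v y)\<^sup>2) / ?n"
      by (rule divide_right_mono) simp
    also have "\<dots> = 2 * ((u x - u y)\<^sup>2 / ?n) + 2 * ((v x - v y)\<^sup>2 / ?n)"
      by (simp add: add_divide_distrib)
    finally have "k (u + v) x y \<le> ennreal (2 * ((u x - u y)\<^sup>2 / ?n) + 2 * ((v x - v y)\<^sup>2 / ?n))"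
      unfolding k_def by (rule ennreal_leI)
    also have "\<dots> = 2 * k u x y + 2 * k v x y"
    proof -
      have *: "ennreal (2 * a + 2 * b) = 2 * ennreal a + 2 * ennreal b" if "0 \<le> a" "0 \<le> b" for a b
        using that ennreal_mult[of 2 a] ennreal_mult[of 2 b] by (simp add: ennreal_plus)
      show ?thesis unfolding k_def by (rule *) simp_all
    qed
    finally show ?thesis .
  qed
  have "gagliardo \<theta> \<Omega> (u + v) = (\<integral>\<^sup>+x. (\<integral>\<^sup>+y. k (u + v) x y \<partial>?M) \<partial>?M)"
    by (simp add: gagliardo_def k_def)
  also have "\<dots> \<le> (\<integral>\<^sup>+x. (\<integral>\<^sup>+y. 2 * k u x y + 2 * k v x y \<partial>?M) \<partial>?M)"
    by (intro nn_integral_mono le)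
  also have "\<dots> = 2 * (\<integral>\<^sup>+x. (\<integral>\<^sup>+y. k u x y \<partial>?M) \<partial>?M) + 2 * (\<integral>\<^sup>+x. (\<integral>\<^sup>+y. k v x y \<partial>?M) \<partial>?M)"
    using um vm by (simp add: nn_integral_add nn_integral_cmult)
  also have "\<dots> = 2 * gagliardo \<theta> \<Omega> u + 2 * gagliardo \<theta> \<Omega> v"
    by (simp add: gagliardo_def k_def)
  also have "\<dots> < \<infinity>" using fin by (simp add: ennreal_mult_less_top)
  finally show ?thesis .
qed

text \<open>The encoding changes at \<open>s = 1\<close>, where the order is carried by a weak
  derivative; below it, the Gagliardo integral carries the order.\<close>

lemma Hs_add:
  assumes s: "0 < s" "s \<le> 1" and u: "u \<in> Hs s \<Omega>" and v: "v \<in> Hs s \<Omega>"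
  shows "u + v \<in> Hs s \<Omega>"
proof (cases "s = 1")
  case True
  then show ?thesis using u v Hs_1_intros by blast
next
  case False
  then have "\<lfloor>s\<rfloor> = 0" "frac s = s" using s by (auto simp: floor_eq_iff frac_eq)
  then have iff: "w \<in> Hs s \<Omega> \<longleftrightarrow> w \<in> L2 \<Omega> \<and> gagliardo s \<Omega> w < \<infinity>" for w
    using s by (simp add: Hs_def)
  show ?thesis using u v unfolding iff by (blast intro: L2.V_add gagliardo_add_finite)
qed

lemma Hs_Suc:
  assumes "0 \<le> s"
  shows "Hs (1 + s) \<Omega> = {u \<in> L2 \<Omega>. \<forall>i. (\<exists>g. has_weak_pderiv \<Omega> i u g) \<and> weak_pderiv \<Omega> i u \<in> Hs s \<Omega>}"
proof -
  have "nat \<lfloor>1 + s\<rfloor> = Suc (nat \<lfloor>s\<rfloor>)" "frac (1 + s) = frac s"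
    using assms by (simp_all add: nat_add_distrib frac_def)
  then show ?thesis by (simp add: Hs_def)
qed

text \<open>Functions equal almost everywhere have literally the same set of weak derivatives, so
  the choice operator picks the same one. This moves regularity from \<open>w\<close> to
  \<open>wdiv \<Omega> \<tau>\<close>, which equals \<open>w\<close> only almost everywhere.\<close>

lemma Hs_Suc_cong_AE:
  assumes s: "0 \<le> s" and u: "u \<in> Hs (1 + s) \<Omega>" and v: "v \<in> L2 \<Omega>"
    and eq: "AE x in lebesgue_on \<Omega>. u x = v x"
  shows "v \<in> Hs (1 + s) \<Omega>"
proof -
  have "u \<in> L2 \<Omega>" using u by (simp add: Hs_Suc[OF s])
  moreover have "AE x in lebesgue_on \<Omega>. v x = u x" using eq by eventually_elim simp
  ultimately have iff: "has_weak_pderiv \<Omega> i u = has_weak_pderiv \<Omega> i v" for i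
    using has_weak_pderiv_cong v eq by (intro ext) blast
  then have "weak_pderiv \<Omega> i u = weak_pderiv \<Omega> i v" for i by (simp add: weak_pderiv_def)
  then show ?thesis using u v iff by (simp add: Hs_Suc[OF s])
qed

text \<open>The constant contains Sobolev norms of \<open>\<tau>\<close>,
  \<open>wdiv \<Omega> \<tau>\<close> and \<open>p\<close>, finite for each \<open>f\<close> but not
  controlled by its norm; hence the existential inside the scope of \<open>f\<close>.\<close>

lemma T_LLstar_pointwise_estimate:
  assumes s: "1/2 < s" "s \<le> 1"
    and regularity: "\<forall>f\<in>L2 \<Omega>. \<forall>u. poisson_solution \<Omega> f u \<longrightarrow> u \<in> Hs (1 + s) \<Omega>"
    and \<Sigma>: "\<forall>h>0. \<Sigma> h \<subseteq> Hdiv \<Omega> \<and> finite_dim_space \<Omega> (\<Sigma> h)"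
    and U: "\<forall>h>0. U h \<subseteq> H10 \<Omega> \<and> finite_dim_space \<Omega> (U h)"
    and approx: "\<forall>h>0.
       (\<forall>\<tau> \<in> Hdiv \<Omega> \<inter> Hs_vec s \<Omega>. wdiv \<Omega> \<tau> \<in> Hs (1 + s) \<Omega> \<longrightarrow>
          (INF \<xi>\<in>\<Sigma> h. Hdiv_norm \<Omega> (\<lambda>x. \<tau> x - \<xi> x))
            \<le> C * h powr s * (Hs_vec_norm s \<Omega> \<tau> + Hs_norm (1 + s) \<Omega> (wdiv \<Omega> \<tau>))) \<and>
       (\<forall>p \<in> Hs (1 + s) \<Omega> \<inter> H10 \<Omega>.
          (INF v\<in>U h. Hs_norm 1 \<Omega> (\<lambda>x. p x - v x))
            \<le> C * h powr s * Hs_norm (1 + s) \<Omega> p)"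
    and f: "f \<in> L2 \<Omega>"
  shows "\<exists>K. \<forall>h>0. L2_norm \<Omega> (T_LLstar \<Omega> f - T_LLstar_h \<Omega> (\<Sigma> h) (U h) f) \<le> K * h powr s"
proof -
  obtain w where w: "poisson_solution \<Omega> ((-1) *\<^sub>R f) w"
    using poisson_solution_exists[OF L2.V_scale[OF f]] by blast
  then have wH: "w \<in> H10 \<Omega>" by (simp add: poisson_solution_def)
  note fw = L2.V_diff[OF f H10_L2[OF wH]]
  obtain p where p: "poisson_solution \<Omega> (f - w) p" using poisson_solution_exists[OF fw] by blast
  then have pH: "p \<in> H10 \<Omega>" by (simp add: poisson_solution_def)
  define \<tau> where "\<tau> = grad \<Omega> w + grad \<Omega> p"
  have div: "has_weak_div \<Omega> \<tau> w" and sol: "LLstar_solution \<Omega> (Hdiv \<Omega>) (H10 \<Omega>) f \<tau> p"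
    unfolding \<tau>_def by (rule LLstar_solution_of_poisson[OF f w p])+
  have \<tau>: "\<tau> \<in> Hdiv \<Omega>" using div by (auto simp: Hdiv_def)
  have z: "(\<tau>, p) \<in> Hdiv \<Omega> \<times> H10 \<Omega>"
    "\<And>v. v \<in> Hdiv \<Omega> \<times> H10 \<Omega> \<Longrightarrow> energy (\<tau>, p) v = L2_inner \<Omega> f (snd v)"
    using sol LLstar_solution_iff[OF subspace_Hdiv order_refl subspace_H10 order_refl] by blast+
  have wS: "w \<in> Hs (1 + s) \<Omega>" using regularity w L2.V_scale[OF f] by blast
  have pS: "p \<in> Hs (1 + s) \<Omega>" using regularity p fw by blast
  have s0: "0 \<le> s" "0 < s" using s by auto
  have \<tau>S: "\<tau> \<in> Hs_vec s \<Omega>"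
  proof -
    have "weak_pderiv \<Omega> i w + weak_pderiv \<Omega> i p \<in> Hs s \<Omega>" for i
      using wS pS s0 s by (intro Hs_add) (simp_all add: Hs_Suc)
    moreover have "(\<lambda>x. \<tau> x $ i) = weak_pderiv \<Omega> i w + weak_pderiv \<Omega> i p" for i
      by (simp add: \<tau>_def grad_def fun_eq_iff)
    ultimately show ?thesis by (simp add: Hs_vec_def)
  qed
  have divS: "wdiv \<Omega> \<tau> \<in> Hs (1 + s) \<Omega>"
    using wdiv_AE[OF div] by (intro Hs_Suc_cong_AE[OF s0(1) wS wdiv_L2[OF \<tau>]]) auto
  define K1 where "K1 = Hs_vec_norm s \<Omega> \<tau> + Hs_norm (1 + s) \<Omega> (wdiv \<Omega> \<tau>)"
  define K2 where "K2 = Hs_norm (1 + s) \<Omega> p"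
  have "L2_norm \<Omega> (T_LLstar \<Omega> f - T_LLstar_h \<Omega> (\<Sigma> h) (U h) f)
      \<le> (CE * (2 * (C * K1) + C * K2)) * h powr s" if h: "h > 0" for h
  proof -
    have SU: "solvable_pair (\<Sigma> h) (U h)" using \<Sigma> U h by (intro solvable_pair_finite_dim) auto
    note W = solvable_pair_sub[OF SU]
    obtain \<tau>' where z': "(\<tau>', T_LLstar \<Omega> f) \<in> Hdiv \<Omega> \<times> H10 \<Omega>"
      "\<forall>v\<in>Hdiv \<Omega> \<times> H10 \<Omega>. energy (\<tau>', T_LLstar \<Omega> f) v = L2_inner \<Omega> f (snd v)"
      using T_LLstar_h_solution[OF solvable_pair_Hdiv_H10 f] unfolding T_LLstar_def by blast
    obtain \<xi> where zh: "(\<xi>, T_LLstar_h \<Omega> (\<Sigma> h) (U h) f) \<in> \<Sigma> h \<times> U h"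
      "\<forall>v\<in>\<Sigma> h \<times> U h. energy (\<xi>, T_LLstar_h \<Omega> (\<Sigma> h) (U h) f) v = L2_inner \<Omega> f (snd v)"
      using T_LLstar_h_solution[OF SU f] by blast
    let ?z = "(\<tau>, p)" and ?z' = "(\<tau>', T_LLstar \<Omega> f)" and ?zh = "(\<xi>, T_LLstar_h \<Omega> (\<Sigma> h) (U h) f)"
    have zhV: "?zh \<in> Hdiv \<Omega> \<times> H10 \<Omega>" using zh(1) W(2) by blast
    note dV = E.V_diff[OF z(1) zhV] E.V_diff[OF z'(1) z(1)]
    \<comment> \<open>\<open>T_LLstar\<close> may return another representative than
      \<open>p\<close>. Both pairs solve the same problem, so exchanging them costs nothing in
      energy.\<close>
    have "E.N (?z' - ?z) = 0"
    proof -
      have "energy (?z' - ?z) (?z' - ?z) = 0"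
        unfolding E.B_diff[OF z'(1) z(1) dV(2)] using z(2)[OF dV(2)] bspec[OF z'(2) dV(2)] by simp
      then show ?thesis by (simp add: E.N_def)
    qed
    then have N: "E.N (?z' - ?zh) \<le> E.N (?z - ?zh)"
      using E.N_triangle[OF dV(2) dV(1)] by simp
    have cea: "E.N (?z - ?zh) \<le> 2 * Hdiv_norm \<Omega> (\<tau> - \<zeta>) + Hs_norm 1 \<Omega> (p - q)"
      if "\<zeta> \<in> \<Sigma> h" "q \<in> U h" for \<zeta> q
    proof -
      have v: "(\<zeta>, q) \<in> \<Sigma> h \<times> U h" using that by simp
      then have "(\<zeta>, q) \<in> Hdiv \<Omega> \<times> H10 \<Omega>" using W(2) by blast
      then have H: "\<zeta> \<in> Hdiv \<Omega>" "q \<in> H10 \<Omega>" by auto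
      have "E.N (?z - ?zh) \<le> E.N (?z - (\<zeta>, q))"
        using z zh(2) W(2) by (intro Cea[OF W(2,1), where l = "\<lambda>v. L2_inner \<Omega> f (snd v)"] zh(1) v) auto
      also have "\<dots> \<le> 2 * Hdiv_norm \<Omega> (\<tau> - \<zeta>) + Hs_norm 1 \<Omega> (p - q)"
        using energy_le_norms[OF Hdiv_intros(3)[OF \<tau> H(1)] H10_intros(3)[OF pH H(2)]] by simp
      finally show ?thesis .
    qed
    have ne: "\<Sigma> h \<noteq> {}" "U h \<noteq> {}" using zh(1) by auto
    have bounds: "(INF \<zeta>\<in>\<Sigma> h. Hdiv_norm \<Omega> (\<tau> - \<zeta>)) \<le> C * h powr s * K1"
      "(INF q\<in>U h. Hs_norm 1 \<Omega> (p - q)) \<le> C * h powr s * K2"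
      using approx h \<tau> \<tau>S divS pS pH unfolding K1_def K2_def fun_diff_def by blast+
    have "E.N (?z - ?zh) \<le> 2 * (C * h powr s * K1) + C * h powr s * K2"
    \<comment> \<open>The infima need not be attained. The field error enters twice and the scalar
      error once, whence \<open>e / 3\<close> for each.\<close>
    proof (rule field_le_epsilon)
      fix e :: real assume e: "e > 0"
      have "\<exists>y\<in>(\<lambda>\<zeta>. Hdiv_norm \<Omega> (\<tau> - \<zeta>)) ` \<Sigma> h. y < C * h powr s * K1 + e / 3"
        by (rule cInf_lessD) (use ne bounds(1) e in auto)
      then obtain \<zeta> where \<zeta>: "\<zeta> \<in> \<Sigma> h" "Hdiv_norm \<Omega> (\<tau> - \<zeta>) < C * h powr s * K1 + e / 3" by blast
      have "\<exists>y\<in>(\<lambda>q. Hs_norm 1 \<Omega> (p - q)) ` U h. y < C * h powr s * K2 + e / 3"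
        by (rule cInf_lessD) (use ne bounds(2) e in auto)
      then obtain q where q: "q \<in> U h" "Hs_norm 1 \<Omega> (p - q) < C * h powr s * K2 + e / 3" by blast
      show "E.N (?z - ?zh) \<le> 2 * (C * h powr s * K1) + C * h powr s * K2 + e"
        using cea[OF \<zeta>(1) q(1)] \<zeta>(2) q(2) by linarith
    qed
    then have "E.N (?z' - ?zh) \<le> (2 * (C * K1) + C * K2) * h powr s"
      using N by (simp add: algebra_simps)
    then have "CE * E.N (?z' - ?zh) \<le> CE * ((2 * (C * K1) + C * K2) * h powr s)"
      using CE_pos by (intro mult_left_mono) auto
    then show ?thesis
      using L2_le_energy[OF E.V_diff[OF z'(1) zhV]] by (simp add: mult.assoc)
  qed
  then show ?thesis by blast
qed

end

section \<open>From estimates for fixed data to a uniform rate\<close>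

theorem theorem14:
  fixes \<Omega> :: "(real^'d::finite) set"
    and s :: real
    and \<Sigma> :: "real \<Rightarrow> (real^'d \<Rightarrow> real^'d) set"
    and U :: "real \<Rightarrow> (real^'d \<Rightarrow> real) set"
  assumes dim: "CARD('d) = 2 \<or> CARD('d) = 3"
    and domain: "lipschitz_polytopal_domain \<Omega>"
    and s: "1/2 < s" "s \<le> 1"
    and regularity: "\<forall>f\<in>L2 \<Omega>. \<forall>u. poisson_solution \<Omega> f u \<longrightarrow> u \<in> Hs (1 + s) \<Omega>"
    and \<Sigma>: "\<forall>h>0. \<Sigma> h \<subseteq> Hdiv \<Omega> \<and> finite_dim_space \<Omega> (\<Sigma> h)"
    and U: "\<forall>h>0. U h \<subseteq> H10 \<Omega> \<and> finite_dim_space \<Omega> (U h)"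
    and approx: "\<exists>C. \<forall>h>0.
       (\<forall>\<tau> \<in> Hdiv \<Omega> \<inter> Hs_vec s \<Omega>. wdiv \<Omega> \<tau> \<in> Hs (1 + s) \<Omega> \<longrightarrow>
          (INF \<xi>\<in>\<Sigma> h. Hdiv_norm \<Omega> (\<lambda>x. \<tau> x - \<xi> x))
            \<le> C * h powr s * (Hs_vec_norm s \<Omega> \<tau> + Hs_norm (1 + s) \<Omega> (wdiv \<Omega> \<tau>))) \<and>
       (\<forall>p \<in> Hs (1 + s) \<Omega> \<inter> H10 \<Omega>.
          (INF v\<in>U h. Hs_norm 1 \<Omega> (\<lambda>x. p x - v x))
            \<le> C * h powr s * Hs_norm (1 + s) \<Omega> p)"
  shows "\<exists>\<rho> :: real \<Rightarrow> real. (\<rho> \<longlongrightarrow> 0) (at_right 0) \<and>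
    (\<forall>h>0. \<forall>f\<in>L2 \<Omega>.
       L2_norm \<Omega> (\<lambda>x. T_LLstar \<Omega> f x - T_LLstar_h \<Omega> (\<Sigma> h) (U h) f x)
         \<le> \<rho> h * L2_norm \<Omega> f)"
proof -
  interpret bounded_domain \<Omega>
    using domain by unfold_locales (auto simp: lipschitz_polytopal_domain_def)
  obtain C where C: "\<forall>h>0.
       (\<forall>\<tau> \<in> Hdiv \<Omega> \<inter> Hs_vec s \<Omega>. wdiv \<Omega> \<tau> \<in> Hs (1 + s) \<Omega> \<longrightarrow>
          (INF \<xi>\<in>\<Sigma> h. Hdiv_norm \<Omega> (\<lambda>x. \<tau> x - \<xi> x))
            \<le> C * h powr s * (Hs_vec_norm s \<Omega> \<tau> + Hs_norm (1 + s) \<Omega> (wdiv \<Omega> \<tau>))) \<and>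
       (\<forall>p \<in> Hs (1 + s) \<Omega> \<inter> H10 \<Omega>.
          (INF v\<in>U h. Hs_norm 1 \<Omega> (\<lambda>x. p x - v x))
            \<le> C * h powr s * Hs_norm (1 + s) \<Omega> p)"
    using approx by blast
  define D where "D h f = T_LLstar \<Omega> f - T_LLstar_h \<Omega> (\<Sigma> h) (U h) f" for h f
  define P where "P h f = L2_norm \<Omega> (D h f) / h powr s" for h f
  have SU: "solvable_pair (\<Sigma> h) (U h)" if "h > 0" for h
    using \<Sigma> U that by (intro solvable_pair_finite_dim) auto
  note T = solvable_pair_Hdiv_H10
  have TL2: "T_LLstar \<Omega> f \<in> L2 \<Omega>" if "f \<in> L2 \<Omega>" for f
    unfolding T_LLstar_def by (intro H10_L2 T_LLstar_h_H10 T that)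
  have ThL2: "T_LLstar_h \<Omega> (\<Sigma> h) (U h) f \<in> L2 \<Omega>" if "h > 0" "f \<in> L2 \<Omega>" for h f
    by (intro H10_L2 T_LLstar_h_H10 SU that)
  have DL2: "D h f \<in> L2 \<Omega>" if "h > 0" "f \<in> L2 \<Omega>" for h f
    unfolding D_def by (intro L2.V_diff TL2 ThL2 that)
  \<comment> \<open>The index set consists of all mesh parameters \<open>h > 0\<close>, and one
    constant \<open>M\<close> must serve them all.\<close>
  have "\<exists>M. \<forall>h\<in>{0<..}. \<forall>f\<in>L2 \<Omega>. P h f \<le> M * L2_norm \<Omega> f"
  proof (rule L2.uniform_boundedness[OF L2_complete[OF lmeasurable_dom]])
    fix h :: real and f g :: "real^'d \<Rightarrow> real" assume h: "h \<in> {0<..}" and f: "f \<in> L2 \<Omega>" and g: "g \<in> L2 \<Omega>"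
    then have h0: "h > 0" by simp
    have "AE x in lebesgue_on \<Omega>. D h (f + g) x = (D h f + D h g) x"
      using T_LLstar_h_add[OF T f g] T_LLstar_h_add[OF SU[OF h0] f g]
      unfolding D_def T_LLstar_def by eventually_elim simp
    then have "L2_norm \<Omega> (D h (f + g)) = L2_norm \<Omega> (D h f + D h g)"
      by (intro L2_norm_cong_AE DL2 L2.V_add h0 f g)
    also have "\<dots> \<le> L2_norm \<Omega> (D h f) + L2_norm \<Omega> (D h g)"
      by (intro L2.N_triangle DL2 h0 f g)
    finally show "P h (f + g) \<le> P h f + P h g"
      unfolding P_def add_divide_distrib[symmetric] by (intro divide_right_mono) simp_all
  next
    fix h :: real and f :: "real^'d \<Rightarrow> real" and c :: real assume h: "h \<in> {0<..}" and f: "f \<in> L2 \<Omega>"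
    then have h0: "h > 0" by simp
    have "AE x in lebesgue_on \<Omega>. D h (c *\<^sub>R f) x = (c *\<^sub>R D h f) x"
      using T_LLstar_h_scale[OF T f, of c] T_LLstar_h_scale[OF SU[OF h0] f, of c]
      unfolding D_def T_LLstar_def by eventually_elim (simp add: right_diff_distrib)
    then have "L2_norm \<Omega> (D h (c *\<^sub>R f)) = L2_norm \<Omega> (c *\<^sub>R D h f)"
      by (intro L2_norm_cong_AE DL2 L2.V_scale h0 f)
    then show "P h (c *\<^sub>R f) = \<bar>c\<bar> * P h f"
      by (simp add: P_def L2.N_scale DL2 h0 f)
  next
    fix h :: real and f :: "real^'d \<Rightarrow> real" assume h: "h \<in> {0<..}" and f: "f \<in> L2 \<Omega>"
    then have h0: "h > 0" by simp
    have "L2_norm \<Omega> (D h f) \<le> L2_norm \<Omega> (T_LLstar \<Omega> f) + L2_norm \<Omega> (T_LLstar_h \<Omega> (\<Sigma> h) (U h) f)"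
      unfolding D_def by (intro L2.N_diff_le TL2 ThL2 h0 f)
    also have "\<dots> \<le> CE\<^sup>2 * L2_norm \<Omega> f + CE\<^sup>2 * L2_norm \<Omega> f"
      unfolding T_LLstar_def by (intro add_mono T_LLstar_h_bound T SU h0 f)
    \<comment> \<open>This constant blows up as \<open>h\<close> tends to 0, but the principle only
      wants a finite one for each \<open>h\<close>.\<close>
    finally show "P h f \<le> (2 * CE\<^sup>2 / h powr s) * L2_norm \<Omega> f"
      using h0 by (simp add: P_def divide_simps mult_ac)
  next
    fix f :: "real^'d \<Rightarrow> real" assume f: "f \<in> L2 \<Omega>"
    obtain K where "\<forall>h>0. L2_norm \<Omega> (D h f) \<le> K * h powr s"
      using T_LLstar_pointwise_estimate[OF s regularity \<Sigma> U C f] unfolding D_def by blast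
    then show "\<exists>K. \<forall>h\<in>{0<..}. P h f \<le> K"
      by (intro exI[of _ K]) (simp add: P_def divide_simps)
  qed
  then obtain M where M: "\<And>h f. h > 0 \<Longrightarrow> f \<in> L2 \<Omega> \<Longrightarrow> P h f \<le> M * L2_norm \<Omega> f"
    by (metis greaterThan_iff)
  \<comment> \<open>The rate is \<open>\<rho> h = M * h powr s\<close>, so positivity of
    \<open>s\<close> makes it tend to zero.\<close>
  have "((\<lambda>h. h powr s) \<longlongrightarrow> 0) (at_right (0::real))"
    by (rule tendsto_zero_powrI[of _ _ _ s]) (use s in \<open>auto intro!: tendsto_intros eventually_mono[OF eventually_at_right_less]\<close>)
  then have "((\<lambda>h. M * h powr s) \<longlongrightarrow> 0) (at_right 0)" by (rule tendsto_mult_right_zero)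
  moreover have "L2_norm \<Omega> (\<lambda>x. T_LLstar \<Omega> f x - T_LLstar_h \<Omega> (\<Sigma> h) (U h) f x) \<le> M * h powr s * L2_norm \<Omega> f"
    if "h > 0" "f \<in> L2 \<Omega>" for h f
    using M[OF that] that(1) by (simp add: P_def D_def fun_diff_def pos_divide_le_eq mult_ac)
  ultimately show ?thesis by blast
qed

end
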